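(* Let $\langle A;R\rangle$ be a finite presentation with isodiametric function $\le d(\cdot)$. Then the word problem of $\langle A;R\rangle$ is in $\mathrm{DTime}(c^{d(\cdot)})$, where $c>1$ is a constant depending on the presentation.
   Context: $A$ is a finite alphabet, $A^{-1}$ a disjoint copy, $A^{\pm1}=A\cup A^{-1}$, $(A^{\pm1})^*$ the set of words over $A^{\pm1}$, $|w|$ the length of a word. $R\subset(A^{\pm1})^*$ is finite and does not contain the empty word; $R^{\pm1}=R\cup\{r^{-1}:r\in R\}$; $x^y=y^{-1}xy$. $=_{\mathrm{FG}}$ is equality in the free group on $A$ and $=_{\langle A;R\rangle}$ equality in the presented group. The word problem is the language $\{w\in(A^{\pm1})^*: w=_{\langle A;R\rangle}1\}$. The isodiametric function is $\le d(\cdot)$ if every word $w$ with $w=_{\langle A;R\rangle}1$ satisfies $w=_{\mathrm{FG}}\prod_{i\in I}r_i^{x_i}$ for some finite sequence of $r_i\in R^{\pm1}$ and words $x_i\in(A^{\pm1})^*$ with $|x_i|\le d(|w|)$ for all $i\in I$. $\mathrm{DTime}(q)$ denotes the class of languages accepted by deterministic Turing machines with time complexity $O(q(O(n)))$, i.e. time at most $c_1\,q(c_2n)$ for all $n\ge c_3$ on accepted inputs of length $\le n$, for positive constants $c_1,c_2,c_3$ depending on the machine.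
   Formalization: The time bound proved is max(n+1, c^{d(n)}) instead of c^{d(n)}: with bounded d the literal claim fails, e.g. for ⟨a; a²⟩ with d = 0, where constant time cannot recognize words of even length. *)

theory Defs
  imports Complex_Main
begin

section \<open>Group presentations\<close>

text \<open>The letter \<open>(a, False)\<close> stands for \<open>a\<close> and \<open>(a, True)\<close> for its formal inverse.\<close>

type_synonym 'a letter = "'a \<times> bool"
type_synonym 'a word = "'a letter list"

definition inv_letter :: "'a letter \<Rightarrow> 'a letter" where
  "inv_letter x = (fst x, \<not> snd x)"

definition inv_word :: "'a word \<Rightarrow> 'a word" where
  "inv_word w = rev (map inv_letter w)"

definition letters :: "'a set \<Rightarrow> 'a letter set" where
  "letters A = A \<times> UNIV"

abbreviation words :: "'a set \<Rightarrow> 'a word set" where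
  "words A \<equiv> lists (letters A)"

definition finite_presentation :: "'a set \<Rightarrow> 'a word set \<Rightarrow> bool" where
  "finite_presentation A R \<longleftrightarrow> finite A \<and> finite R \<and> R \<subseteq> words A \<and> [] \<notin> R"

inductive pres_step :: "'a set \<Rightarrow> 'a word set \<Rightarrow> 'a word \<Rightarrow> 'a word \<Rightarrow> bool"
  for A :: "'a set" and R :: "'a word set" where
  cancel: "\<lbrakk>u \<in> words A; v \<in> words A; x \<in> letters A\<rbrakk>
    \<Longrightarrow> pres_step A R (u @ [x, inv_letter x] @ v) (u @ v)"
| relator: "\<lbrakk>u \<in> words A; v \<in> words A; r \<in> R\<rbrakk>
    \<Longrightarrow> pres_step A R (u @ r @ v) (u @ v)"

definition pres_eq :: "'a set \<Rightarrow> 'a word set \<Rightarrow> 'a word \<Rightarrow> 'a word \<Rightarrow> bool" where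
  "pres_eq A R = equivclp (pres_step A R)"

abbreviation free_eq :: "'a set \<Rightarrow> 'a word \<Rightarrow> 'a word \<Rightarrow> bool" where
  "free_eq A \<equiv> pres_eq A {}"

definition word_problem :: "'a set \<Rightarrow> 'a word set \<Rightarrow> 'a word set" where
  "word_problem A R = {w \<in> words A. pres_eq A R w []}"

definition sym_relators :: "'a word set \<Rightarrow> 'a word set" where
  "sym_relators R = R \<union> inv_word ` R"

definition conj_word :: "'a word \<Rightarrow> 'a word \<Rightarrow> 'a word" where
  "conj_word r x = inv_word x @ r @ x"

definition isodiametric_le :: "'a set \<Rightarrow> 'a word set \<Rightarrow> (nat \<Rightarrow> nat) \<Rightarrow> bool" where
  "isodiametric_le A R d \<longleftrightarrow>
    (\<forall>w \<in> words A. pres_eq A R w [] \<longrightarrow>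
      (\<exists>ps :: ('a word \<times> 'a word) list.
        (\<forall>(r, x) \<in> set ps. r \<in> sym_relators R \<and> x \<in> words A \<and> length x \<le> d (length w)) \<and>
        free_eq A w (concat (map (\<lambda>(r, x). conj_word r x) ps))))"


section \<open>Deterministic multi-tape Turing machines\<close>

text \<open>
  Tape symbols over the input alphabet \<open>'b\<close>; a machine has only finitely many of them, but
  has an unlimited supply of work symbols to choose from.
\<close>

datatype 'b tape_symbol = Blank | Input 'b | Work nat

datatype direction = Move_Left | Stay | Move_Right

record 'b machine =
  num_tapes :: nat
  states :: "nat set"
  symbols :: "'b tape_symbol set"
  start_state :: nat
  accept_state :: nat
  reject_state :: nat
  delta :: "nat \<Rightarrow> 'b tape_symbol list \<Rightarrow> nat \<times> ('b tape_symbol \<times> direction) list"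

definition turing_machine :: "'b set \<Rightarrow> 'b machine \<Rightarrow> bool" where
  "turing_machine \<Sigma> M \<longleftrightarrow>
    num_tapes M \<ge> 1 \<and> finite (states M) \<and> finite (symbols M) \<and>
    Blank \<in> symbols M \<and> Input ` \<Sigma> \<subseteq> symbols M \<and>
    start_state M \<in> states M \<and> accept_state M \<in> states M \<and> reject_state M \<in> states M \<and>
    accept_state M \<noteq> reject_state M \<and>
    (\<forall>q \<in> states M - {accept_state M, reject_state M}.
      \<forall>ss \<in> lists (symbols M). length ss = num_tapes M \<longrightarrow>
        fst (delta M q ss) \<in> states M \<and>
        length (snd (delta M q ss)) = num_tapes M \<and>
        fst ` set (snd (delta M q ss)) \<subseteq> symbols M)"

text \<open>
  A tape is infinite in both directions and comes with the position of its head; a configuration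
  consists of the state and of all the tapes.
\<close>

type_synonym 'b tape = "(int \<Rightarrow> 'b tape_symbol) \<times> int"
type_synonym 'b config = "nat \<times> 'b tape list"

definition blank_tape :: "'b tape" where
  "blank_tape = (\<lambda>_. Blank, 0)"

definition input_tape :: "'b list \<Rightarrow> 'b tape" where
  "input_tape w = (\<lambda>i. if 0 \<le> i \<and> i < int (length w) then Input (w ! nat i) else Blank, 0)"

definition initial_config :: "'b machine \<Rightarrow> 'b list \<Rightarrow> 'b config" where
  "initial_config M w = (start_state M, input_tape w # replicate (num_tapes M - 1) blank_tape)"

fun move_head :: "direction \<Rightarrow> int \<Rightarrow> int" where
  "move_head Move_Left i = i - 1"
| "move_head Stay i = i"
| "move_head Move_Right i = i + 1"

fun read_tape :: "'b tape \<Rightarrow> 'b tape_symbol" where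
  "read_tape (t, i) = t i"

fun act_tape :: "'b tape \<Rightarrow> 'b tape_symbol \<times> direction \<Rightarrow> 'b tape" where
  "act_tape (t, i) (s, m) = (t(i := s), move_head m i)"

fun machine_step :: "'b machine \<Rightarrow> 'b config \<Rightarrow> 'b config" where
  "machine_step M (q, ts) =
    (if q = accept_state M \<or> q = reject_state M then (q, ts)
     else let (q', as) = delta M q (map read_tape ts) in (q', map2 act_tape ts as))"

text \<open>As the accepting state is final, this is monotone in the number \<open>t\<close> of steps.\<close>

definition accepts_within :: "'b machine \<Rightarrow> 'b list \<Rightarrow> nat \<Rightarrow> bool" where
  "accepts_within M w t \<longleftrightarrow>
    fst ((machine_step M ^^ t) (initial_config M w)) = accept_state M"

definition machine_language :: "'b set \<Rightarrow> 'b machine \<Rightarrow> 'b list set" where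
  "machine_language \<Sigma> M = {w \<in> lists \<Sigma>. \<exists>t. accepts_within M w t}"

text \<open>
  Languages over \<open>\<Sigma>\<close> accepted in time \<open>O(q(O(n)))\<close>.  Only accepted inputs are timed; on other
  inputs a machine need not halt.  No lower bound on \<open>q\<close> is built in.  The usual convention that
  a time bound \<open>f\<close> stands for \<open>max (n + 1) (f n)\<close>, the time for reading the input up to its end,
  therefore has to be stated where it is used.
\<close>

definition DTime :: "'b set \<Rightarrow> (nat \<Rightarrow> real) \<Rightarrow> 'b list set set" where
  "DTime \<Sigma> q = {L. \<exists>M. turing_machine \<Sigma> M \<and> L = machine_language \<Sigma> M \<and>
    (\<exists>(c1 :: real) (c2 :: nat) (c3 :: nat). c1 > 0 \<and> c2 > 0 \<and> c3 > 0 \<and>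
      (\<forall>n \<ge> c3. \<forall>w \<in> L. length w \<le> n \<longrightarrow>
        (\<exists>t. real t \<le> c1 * q (c2 * n) \<and> accepts_within M w t)))}"

end

theory Submission
  imports Defs
begin

text \<open>
  If the group is finite or \<open>R\<close> consists of words that are trivial in the free group, a finite
  automaton or a stack solves the word problem in linear time.  Otherwise the isodiametric function
  grows linearly: a shortest word \<open>s\<close> that is trivial in the group but not in the free group labels
  a simple closed path of the Cayley graph, and if it is conjugated by a long geodesic word, it
  traverses once an edge far from the identity.  The signed number of traversals of an edge is
  invariant under free reduction, and it vanishes for products of short conjugates of relators.  So
  time exponential in \<open>n + d (2 * n)\<close> is available.

  In that time, for \<open>L = 1, 2, \<dots>\<close>, the right congruence generated by the relators can be computed
  within the words of length at most \<open>L\<close>.  Its classes form a folded graph in which exactly one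
  path starts at a given vertex with a given label, as long as it stays inside.  Conjugates
  \<open>r\<^sup>x\<close> with \<open>\<bar>x\<bar> \<le> d\<close> label closed paths at the class of \<open>[]\<close> if \<open>L\<close> is slightly larger than \<open>d\<close>,
  and free reduction preserves end points, so every trivial word is linked to \<open>[]\<close>.
\<close>

section \<open>Structured programs for multi-tape machines\<close>

text \<open>The machine and the constant \<open>c\<close> are fixed before \<open>d\<close> is
  given, and \<open>d\<close> is not assumed to be computable or monotone. Hence the machine never
  evaluates \<open>d\<close>: it enlarges its search without end and accepts only when it has found
  a derivation, while \<open>d\<close> enters the analysis of the running time alone. As
  \<open>DTime\<close> bounds the time for all words of length at most \<open>n\<close> by one value
  \<open>d (c2 * n)\<close>, these words must first be brought to a common length.

  Searching through products of conjugates would not do, since the isodiametric function bounds the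
  conjugators but not the number of factors. In a ball only the words themselves count: coded in
  base \<open>b\<close>, those of length at most \<open>L\<close> are numbers below
  \<open>b ^ L\<close>, and a closure that is polynomial in \<open>b ^ L\<close> is still
  exponential in \<open>L\<close>.

  In the two exceptional cases no linear lower bound for \<open>d\<close> is available; there the
  term \<open>real n + 1\<close> has to pay for the whole computation, which is why they need
  linear-time machines of their own.\<close>

datatype 'b prog =
    Act "'b tape_symbol list \<Rightarrow> ('b tape_symbol \<times> direction) list"
  | Seq "'b prog" "'b prog"
  | Cond "'b tape_symbol list \<Rightarrow> bool" "'b prog" "'b prog"
  | Loop "'b tape_symbol list \<Rightarrow> bool" "'b prog"

definition idle :: "'b tape_symbol list \<Rightarrow> ('b tape_symbol \<times> direction) list" where
  "idle = map (\<lambda>s. (s, Stay))"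

text \<open>A list of programs is the stack of what remains to be run. Control constructs take a
  step of their own that leaves the tapes alone, so program steps match machine steps one to one,
  and the empty stack is a fixed point like the accepting state.\<close>

fun advance ::
  "'b prog list \<Rightarrow> 'b tape_symbol list \<Rightarrow> 'b prog list \<times> ('b tape_symbol \<times> direction) list"
where
  "advance [] ss = ([], idle ss)"
| "advance (Act f # ks) ss = (ks, f ss)"
| "advance (Seq p q # ks) ss = (p # q # ks, idle ss)"
| "advance (Cond b p q # ks) ss = ((if b ss then p else q) # ks, idle ss)"
| "advance (Loop b p # ks) ss = (if b ss then p # Loop b p # ks else ks, idle ss)"

fun prog_step :: "'b prog list \<times> 'b tape list \<Rightarrow> 'b prog list \<times> 'b tape list" where
  "prog_step (ks, ts) =
    (let (ks', as) = advance ks (map read_tape ts) in (ks', map2 act_tape ts as))"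

lemma act_tape_idle: "map2 act_tape ts (idle (map read_tape ts)) = ts"
  by (induction ts) (auto simp: idle_def)

fun wf_prog :: "'b tape_symbol set \<Rightarrow> nat \<Rightarrow> 'b prog \<Rightarrow> bool" where
  "wf_prog S k (Act f) \<longleftrightarrow>
    (\<forall>ss \<in> lists S. length ss = k \<longrightarrow> length (f ss) = k \<and> fst ` set (f ss) \<subseteq> S)"
| "wf_prog S k (Seq p q) \<longleftrightarrow> wf_prog S k p \<and> wf_prog S k q"
| "wf_prog S k (Cond b p q) \<longleftrightarrow> wf_prog S k p \<and> wf_prog S k q"
| "wf_prog S k (Loop b p) \<longleftrightarrow> wf_prog S k p"

text \<open>The stacks that can occur while \<open>p\<close> runs on top of \<open>ks\<close>; they
  become the states of the machine. There are finitely many because the body of a loop always runs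
  on the same stack \<open>Loop b p # ks\<close>, so nothing piles up.\<close>

fun conts :: "'b prog \<Rightarrow> 'b prog list \<Rightarrow> 'b prog list set" where
  "conts (Act f) ks = {Act f # ks}"
| "conts (Seq p q) ks = insert (Seq p q # ks) (conts p (q # ks) \<union> conts q ks)"
| "conts (Cond b p q) ks = insert (Cond b p q # ks) (conts p ks \<union> conts q ks)"
| "conts (Loop b p) ks = insert (Loop b p # ks) (conts p (Loop b p # ks))"

lemma finite_conts: "finite (conts p ks)"
  by (induction p arbitrary: ks) auto

lemma conts_start: "p # ks \<in> conts p ks"
  by (cases p) auto

lemma conts_closed: "c \<in> conts p ks \<Longrightarrow> fst (advance c ss) \<in> insert ks (conts p ks)"
proof (induction p arbitrary: ks)
  case (Seq p q)
  consider "c = Seq p q # ks" | "c \<in> conts p (q # ks)" | "c \<in> conts q ks"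
    using Seq.prems by auto
  then show ?case
  proof cases
    case 2
    from Seq.IH(1)[OF 2] show ?thesis using conts_start[of q ks] by auto
  qed (use Seq.IH conts_start in auto)
next
  case (Loop b p)
  consider "c = Loop b p # ks" | "c \<in> conts p (Loop b p # ks)"
    using Loop.prems by auto
  then show ?case
    by cases (use Loop.IH conts_start in auto)
next
  case (Cond b p q)
  consider "c = Cond b p q # ks" | "c \<in> conts p ks" | "c \<in> conts q ks"
    using Cond.prems by auto
  then show ?case
    by cases (use Cond.IH conts_start[of p ks] conts_start[of q ks] in auto)
qed auto

lemma conts_advance_wf:
  assumes "c \<in> conts p ks" "wf_prog S k p" "ss \<in> lists S" "length ss = k"
  shows "length (snd (advance c ss)) = k \<and> fst ` set (snd (advance c ss)) \<subseteq> S"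
proof -
  have idle: "length (idle ss) = k" "\<And>a b. (a, b) \<in> set (idle ss) \<Longrightarrow> a \<in> S"
    using assms(3,4) by (auto simp: idle_def)
  show ?thesis
    using assms(1,2)
  proof (induction p arbitrary: ks)
    case (Act f)
    then show ?case using assms(3,4) by auto
  qed (use idle in \<open>auto dest: idle(2)\<close>)
qed

text \<open>Acceptance is termination of the program; other words are rejected by running forever.\<close>

theorem prog_to_machine:
  fixes \<Sigma> :: "'b set"
  assumes S: "finite S" "Blank \<in> S" "Input ` \<Sigma> \<subseteq> S" and k: "k \<ge> 1" and wf: "wf_prog S k p"
  shows "\<exists>M. turing_machine \<Sigma> M \<and>
    (\<forall>w t. accepts_within M w t \<longleftrightarrow>
      fst ((prog_step ^^ t) ([p], input_tape w # replicate (k - 1) blank_tape)) = [])"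
proof -
  define Q where "Q = insert [] (conts p [])"
  have finQ: "finite Q" by (simp add: Q_def finite_conts)
  then obtain enc :: "'b prog list \<Rightarrow> nat" where inj: "inj_on enc Q"
    using finite_imp_inj_to_nat_seg by blast
  \<comment> \<open>The machine model demands a rejecting state; this number encodes no stack, so
    the simulation never enters it.\<close>
  define rej where "rej = Suc (Max (enc ` Q))"
  have rej: "enc c \<noteq> rej" if "c \<in> Q" for c
    using Max_ge[of "enc ` Q" "enc c"] that finQ unfolding rej_def by fastforce
  define dec where "dec = inv_into Q enc"
  have dec: "dec (enc c) = c" if "c \<in> Q" for c
    using that inj by (simp add: dec_def)
  define M :: "'b machine" where
    "M = \<lparr>num_tapes = k, states = insert rej (enc ` Q), symbols = S, start_state = enc [p],
      accept_state = enc [], reject_state = rej,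
      delta = (\<lambda>q ss. (enc (fst (advance (dec q) ss)), snd (advance (dec q) ss)))\<rparr>"
  have closed: "fst (advance c ss) \<in> Q" if "c \<in> Q" for c ss
    using conts_closed[of c p "[]" ss] that by (auto simp: Q_def)
  have start: "[p] \<in> Q" and nil: "[] \<in> Q"
    using conts_start[of p "[]"] by (auto simp: Q_def)
  have tm: "turing_machine \<Sigma> M"
    unfolding turing_machine_def
  proof (intro conjI ballI impI)
    fix q ss
    assume q: "q \<in> states M - {accept_state M, reject_state M}"
      and ss: "ss \<in> lists (symbols M)" "length ss = num_tapes M"
    then obtain c where c: "c \<in> Q" "c \<noteq> []" "q = enc c" by (auto simp: M_def)
    then have c': "c \<in> conts p []" by (auto simp: Q_def)
    show "fst (delta M q ss) \<in> states M"
      using closed[OF c(1)] c by (simp add: M_def dec)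
    show "length (snd (delta M q ss)) = num_tapes M"
      and "fst ` set (snd (delta M q ss)) \<subseteq> symbols M"
      using conts_advance_wf[OF c' wf, of ss] ss c by (auto simp: M_def dec)
  qed (use finQ S k start nil rej in \<open>auto simp: M_def\<close>)
  have step: "machine_step M (enc c, ts) = map_prod enc id (prog_step (c, ts))" if "c \<in> Q" for c ts
  proof (cases "c = []")
    case True
    then show ?thesis by (simp add: M_def act_tape_idle)
  next
    case False
    then have "enc c \<noteq> enc []" using that nil inj by (auto dest: inj_onD)
    then show ?thesis using rej[OF that] that
      by (simp add: M_def dec case_prod_beta Let_def)
  qed
  have steps: "(machine_step M ^^ t) (enc c, ts) = map_prod enc id ((prog_step ^^ t) (c, ts))
      \<and> fst ((prog_step ^^ t) (c, ts)) \<in> Q" if "c \<in> Q" for c ts t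
  proof (induction t)
    case 0
    then show ?case using that by simp
  next
    case (Suc t)
    obtain c' ts' where c': "(prog_step ^^ t) (c, ts) = (c', ts')" by (meson surj_pair)
    then have "c' \<in> Q" using Suc by simp
    then show ?case using Suc closed[of c'] step[of c' ts']
      by (simp add: c' case_prod_beta Let_def del: machine_step.simps)
  qed
  have "accepts_within M w t \<longleftrightarrow>
      fst ((prog_step ^^ t) ([p], input_tape w # replicate (k - 1) blank_tape)) = []" for w t
  proof -
    have "initial_config M w = (enc [p], input_tape w # replicate (k - 1) blank_tape)"
      by (simp add: initial_config_def M_def)
    moreover have "accept_state M = enc []" by (simp add: M_def)
    ultimately show ?thesis
      using steps[OF start, of t "input_tape w # replicate (k - 1) blank_tape"] nil inj
      unfolding accepts_within_def by (auto dest: inj_onD)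
  qed
  with tm show ?thesis by blast
qed

text \<open>The quantifier over \<open>ks\<close> makes runs compose: a program behaves alike
  whatever is to be run after it.\<close>

definition runs :: "'b prog \<Rightarrow> 'b tape list \<Rightarrow> nat \<Rightarrow> 'b tape list \<Rightarrow> bool" where
  "runs p ts t ts' \<longleftrightarrow> (\<forall>ks. (prog_step ^^ t) (p # ks, ts) = (ks, ts'))"

lemma funpow_trans:
  assumes "(f ^^ m) x = y" "(f ^^ n) y = z" shows "(f ^^ (m + n)) x = z"
  using assms by (simp add: funpow_add add.commute[of m n])

lemma funpow_Suc_trans:
  assumes "f x = y" "(f ^^ n) y = z" shows "(f ^^ Suc n) x = z"
  using assms by (simp add: funpow_Suc_right del: funpow.simps)

lemma runs_Act: "runs (Act f) ts 1 (map2 act_tape ts (f (map read_tape ts)))"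
  by (simp add: runs_def)

lemma runs_Seq:
  assumes "runs p ts t ts'" "runs q ts' t' ts''"
  shows "runs (Seq p q) ts (Suc (t + t')) ts''"
  unfolding runs_def
proof
  fix ks
  show "(prog_step ^^ Suc (t + t')) (Seq p q # ks, ts) = (ks, ts'')"
    by (rule funpow_Suc_trans[OF _ funpow_trans])
      (use assms in \<open>auto simp: runs_def act_tape_idle\<close>)
qed

lemma runs_Cond:
  assumes "runs (if b (map read_tape ts) then p else q) ts t ts'"
  shows "runs (Cond b p q) ts (Suc t) ts'"
  unfolding runs_def
proof
  fix ks
  show "(prog_step ^^ Suc t) (Cond b p q # ks, ts) = (ks, ts')"
    by (rule funpow_Suc_trans) (use assms in \<open>auto simp: runs_def act_tape_idle\<close>)
qed

lemma runs_Loop_exit: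
  assumes "\<not> b (map read_tape ts)"
  shows "runs (Loop b p) ts 1 ts"
  using assms by (simp add: runs_def act_tape_idle)

lemma prog_step_Loop:
  assumes "b (map read_tape ts)" "runs p ts t ts'"
  shows "(prog_step ^^ Suc t) (Loop b p # ks, ts) = (Loop b p # ks, ts')"
  by (rule funpow_Suc_trans) (use assms in \<open>auto simp: runs_def act_tape_idle\<close>)

lemma runs_Loop_step:
  assumes "b (map read_tape ts)" "runs p ts t ts'" "runs (Loop b p) ts' t' ts''"
  shows "runs (Loop b p) ts (Suc t + t') ts''"
  unfolding runs_def
proof
  fix ks
  show "(prog_step ^^ (Suc t + t')) (Loop b p # ks, ts) = (ks, ts'')"
    by (rule funpow_trans[OF prog_step_Loop]) (use assms in \<open>auto simp: runs_def\<close>)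
qed

lemma prog_step_final: "(prog_step ^^ t) ([], ts) = ([], ts)"
  by (induction t) (auto simp: act_tape_idle)

lemma halted_mono:
  assumes "fst ((prog_step ^^ t) c) = []" "t \<le> t'"
  shows "fst ((prog_step ^^ t') c) = []"
proof -
  have "(prog_step ^^ t) c = ([], snd ((prog_step ^^ t) c))" using assms(1) by (metis prod.collapse)
  then have "(prog_step ^^ (t + (t' - t))) c = ([], snd ((prog_step ^^ t) c))"
    by (rule funpow_trans) (rule prog_step_final)
  then show ?thesis using assms(2) by simp
qed

lemma runs_halted: "runs p ts t ts' \<Longrightarrow> fst ((prog_step ^^ t) ([p], ts)) = []"
  by (simp add: runs_def)

lemma Loop_unrolled:
  assumes "\<And>j. j < i \<Longrightarrow> b (map read_tape (s j)) \<and> runs p (s j) (\<tau> j) (s (Suc j))"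
  shows "(prog_step ^^ (\<Sum>j<i. Suc (\<tau> j))) (Loop b p # ks, s 0) = (Loop b p # ks, s i)"
  using assms
proof (induction i)
  case (Suc i)
  show ?case
    unfolding sum.lessThan_Suc
    by (rule funpow_trans[OF Suc.IH prog_step_Loop]) (use Suc.prems in auto)
qed simp

lemma runs_Loop_iterate:
  assumes "\<And>j. j < i \<Longrightarrow> b (map read_tape (s j)) \<and> runs p (s j) (\<tau> j) (s (Suc j))"
    and "\<not> b (map read_tape (s i))"
  shows "runs (Loop b p) (s 0) ((\<Sum>j<i. Suc (\<tau> j)) + 1) (s i)"
  unfolding runs_def
proof
  fix ks
  show "(prog_step ^^ ((\<Sum>j<i. Suc (\<tau> j)) + 1)) (Loop b p # ks, s 0) = (ks, s i)"
    by (rule funpow_trans[OF Loop_unrolled])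
      (use assms runs_Loop_exit[of b "s i" p] in \<open>auto simp: runs_def\<close>)
qed

text \<open>Every round costs at least one step, so after \<open>t\<close> rounds at least
  \<open>t\<close> steps have passed and the loop is still on the stack, whereas halting would have
  persisted.\<close>

lemma Loop_diverges:
  assumes "\<And>j. b (map read_tape (s j)) \<and> runs p (s j) (\<tau> j) (s (Suc j))"
  shows "fst ((prog_step ^^ t) ([Loop b p], s 0)) \<noteq> []"
proof
  assume "fst ((prog_step ^^ t) ([Loop b p], s 0)) = []"
  moreover have "t \<le> (\<Sum>j<t. Suc (\<tau> j))"
    using sum_mono[of "{..<t}" "\<lambda>_. 1" "\<lambda>j. Suc (\<tau> j)"] by simp
  ultimately have "fst ((prog_step ^^ (\<Sum>j<t. Suc (\<tau> j))) ([Loop b p], s 0)) = []"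
    by (rule halted_mono)
  with Loop_unrolled[of t b s p \<tau> "[]"] assms show False by simp
qed

text \<open>Soundness needs this converse of \<open>runs_Seq\<close>: by determinism, a halting run
  of the sequence passes through the end of \<open>p\<close>.\<close>

lemma Seq_halted_D:
  assumes "fst ((prog_step ^^ t) ([Seq p q], ts)) = []" "runs p ts u ts'"
  shows "\<exists>t'. fst ((prog_step ^^ t') ([q], ts')) = []"
proof -
  have 1: "(prog_step ^^ Suc u) ([Seq p q], ts) = ([q], ts')"
    by (rule funpow_Suc_trans) (use assms(2) in \<open>auto simp: runs_def act_tape_idle\<close>)
  have "fst ((prog_step ^^ (Suc u + t)) ([Seq p q], ts)) = []"
    by (rule halted_mono[OF assms(1)]) simp
  moreover have "(prog_step ^^ (Suc u + t)) ([Seq p q], ts) = (prog_step ^^ t) ([q], ts')"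
    by (rule funpow_trans[OF 1]) simp
  ultimately show ?thesis by (intro exI[of _ t]) simp
qed

section \<open>Counter programs\<close>

text \<open>Variable 0 is the input position, 1 the table address, 2 and 3 are scratch for
  \<open>addr\<close>, 4 for \<open>add_mult\<close>, 5 and 6 hold the entries of a new pair, 7 to 9
  are loop counters, 10 is the number of the current pass, and 11 the code of the input.\<close>

definition num_vars :: nat where "num_vars = 12"

text \<open>\<open>Work 0\<close> at position 0 is the end marker for the zero test. On the table
  tape it makes 0 look like a member of every table, whence \<open>insert 0 E\<close> throughout;
  this is harmless because 0 codes the pair of two zeros, the starting point of all
  derivations.\<close>

definition cell :: "nat set \<Rightarrow> int \<Rightarrow> 'b tape_symbol" where
  "cell E i = (if i = 0 then Work 0 else if 0 < i \<and> nat i \<in> E then Work 1 else Blank)"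

definition content :: "'b list \<Rightarrow> nat set \<Rightarrow> nat \<Rightarrow> int \<Rightarrow> 'b tape_symbol" where
  "content w E j = (if j = 0 then fst (input_tape w) else cell (if j = 1 then E else {}))"

text \<open>
  The value of variable \<open>j\<close> is the position of head \<open>j\<close>.  Tape 0 is the input; tape 1 carries
  the table \<open>E\<close>, so that variable 1 is the address register of the table.
\<close>

definition rep :: "'b list \<Rightarrow> nat set \<Rightarrow> (nat \<Rightarrow> nat) \<Rightarrow> 'b tape list" where
  "rep w E \<sigma> = map (\<lambda>j. (content w E j, int (\<sigma> j))) [0..<num_vars]"

lemma length_rep [simp]: "length (rep w E \<sigma>) = num_vars"
  by (simp add: rep_def)

lemma nth_rep: "j < num_vars \<Longrightarrow> rep w E \<sigma> ! j = (content w E j, int (\<sigma> j))"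
  by (simp add: rep_def)

lemma read_rep: "j < num_vars \<Longrightarrow> map read_tape (rep w E \<sigma>) ! j = content w E j (int (\<sigma> j))"
  by (simp add: nth_rep)

definition upd ::
  "nat \<Rightarrow> ('b tape_symbol \<Rightarrow> 'b tape_symbol) \<Rightarrow> direction \<Rightarrow> 'b prog" where
  "upd j g m = Act (\<lambda>ss. (idle ss)[j := (g (ss ! j), m)])"

lemma wf_upd:
  assumes "j < k" "\<And>s. s \<in> S \<Longrightarrow> g s \<in> S"
  shows "wf_prog S k (upd j g m)"
proof -
  have "fst ` set ((idle ss)[j := (g (ss ! j), m)]) \<subseteq> S" if "ss \<in> lists S" "length ss = k" for ss
  proof -
    have "set ((idle ss)[j := (g (ss ! j), m)]) \<subseteq> insert (g (ss ! j), m) (set (idle ss))"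
      by (rule set_update_subset_insert)
    moreover have "g (ss ! j) \<in> S" using that assms by (auto simp: in_listsD)
    moreover have "fst ` set (idle ss) \<subseteq> S" using that by (auto simp: idle_def)
    ultimately show ?thesis by fastforce
  qed
  then show ?thesis by (simp add: upd_def idle_def)
qed

lemma runs_upd:
  assumes "j < length ts"
  shows "runs (upd j g m) ts 1 (ts[j := act_tape (ts ! j) (g (read_tape (ts ! j)), m)])"
proof -
  have "map2 act_tape ts ((idle (map read_tape ts))[j := (g (map read_tape ts ! j), m)])
      = ts[j := act_tape (ts ! j) (g (read_tape (ts ! j)), m)]"
  proof (rule nth_equalityI)
    fix i
    assume "i < length (map2 act_tape ts
      ((idle (map read_tape ts))[j := (g (map read_tape ts ! j), m)]))"
    then have i: "i < length ts" by simp
    have "act_tape (ts ! i) (read_tape (ts ! i), Stay) = ts ! i"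
      by (cases "ts ! i") simp
    then show "map2 act_tape ts ((idle (map read_tape ts))[j := (g (map read_tape ts ! j), m)]) ! i
      = ts[j := act_tape (ts ! j) (g (read_tape (ts ! j)), m)] ! i"
      using i assms by (cases "i = j") (auto simp: idle_def)
  qed (simp add: idle_def)
  then show ?thesis using runs_Act[of "\<lambda>ss. (idle ss)[j := (g (ss ! j), m)]" ts]
    by (simp add: upd_def)
qed

definition skip :: "'b prog" where "skip = Act idle"
definition inc :: "nat \<Rightarrow> 'b prog" where "inc j = upd j id Move_Right"
definition dec :: "nat \<Rightarrow> 'b prog" where "dec j = upd j id Move_Left"
text \<open>Nonblank cells stay as they are, since overwriting position 0 would destroy the end
  marker.\<close>

definition mark :: "'b prog" where
  "mark = upd 1 (\<lambda>s. if s = Blank then Work 1 else s) Stay"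
definition nonzero :: "nat \<Rightarrow> 'b tape_symbol list \<Rightarrow> bool" where
  "nonzero j ss \<longleftrightarrow> ss ! j \<noteq> Work 0"
definition marked :: "'b tape_symbol list \<Rightarrow> bool" where
  "marked ss \<longleftrightarrow> ss ! 1 \<noteq> Blank"

definition exec ::
  "'b list \<Rightarrow> 'b prog \<Rightarrow> nat set \<Rightarrow> (nat \<Rightarrow> nat) \<Rightarrow> nat \<Rightarrow> nat set \<Rightarrow> (nat \<Rightarrow> nat) \<Rightarrow> bool"
where
  "exec w p E \<sigma> T E' \<sigma>' \<longleftrightarrow> (\<exists>t\<le>T. runs p (rep w E \<sigma>) t (rep w E' \<sigma>'))"

lemma exec_mono: "exec w p E \<sigma> T E' \<sigma>' \<Longrightarrow> T \<le> T' \<Longrightarrow> exec w p E \<sigma> T' E' \<sigma>'"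
  unfolding exec_def by (meson order_trans)

lemma exec_skip: "exec w skip E \<sigma> 1 E \<sigma>"
  using runs_Act[of idle "rep w E \<sigma>"] by (auto simp: exec_def skip_def act_tape_idle)

lemma rep_update:
  assumes "j < num_vars"
  shows "(rep w E \<sigma>)[j := (content w E j, int n)] = rep w E (\<sigma>(j := n))"
  by (rule nth_equalityI) (use assms in \<open>auto simp: nth_rep nth_list_update\<close>)

lemma exec_inc:
  assumes "j < num_vars" shows "exec w (inc j) E \<sigma> 1 E (\<sigma>(j := Suc (\<sigma> j)))"
  using runs_upd[of j "rep w E \<sigma>" id Move_Right] assms rep_update[OF assms, of w E \<sigma> "Suc (\<sigma> j)"]
  by (auto simp: exec_def inc_def nth_rep add.commute)

lemma exec_dec:
  assumes "j < num_vars" "\<sigma> j = Suc n" shows "exec w (dec j) E \<sigma> 1 E (\<sigma>(j := n))"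
  using runs_upd[of j "rep w E \<sigma>" id Move_Left] assms rep_update[OF assms(1), of w E \<sigma> n]
  by (auto simp: exec_def dec_def nth_rep)

lemma exec_mark: "exec w mark E \<sigma> 1 (insert (\<sigma> 1) E) \<sigma>"
proof -
  let ?g = "\<lambda>s. if s = Blank then Work 1 else s"
  have "(rep w E \<sigma>)[1 := act_tape (rep w E \<sigma> ! 1) (?g (read_tape (rep w E \<sigma> ! 1)), Stay)]
    = rep w (insert (\<sigma> 1) E) \<sigma>"
    by (rule nth_equalityI)
      (auto simp: nth_rep nth_list_update num_vars_def content_def cell_def fun_eq_iff)
  then show ?thesis
    using runs_upd[of 1 "rep w E \<sigma>" ?g Stay] by (auto simp: exec_def mark_def num_vars_def)
qed

lemma exec_Seq:
  assumes "exec w p E \<sigma> T E' \<sigma>'" "exec w q E' \<sigma>' T' E'' \<sigma>''"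
  shows "exec w (Seq p q) E \<sigma> (T + T' + 1) E'' \<sigma>''"
  using assms unfolding exec_def by (metis (no_types, lifting) Suc_eq_plus1 add_le_mono not_less_eq_eq runs_Seq)

lemma nonzero_rep:
  assumes "0 < j" "j < num_vars"
  shows "nonzero j (map read_tape (rep w E \<sigma>)) \<longleftrightarrow> \<sigma> j \<noteq> 0"
  using assms by (simp add: nonzero_def read_rep content_def cell_def del: nth_map)

lemma marked_rep: "marked (map read_tape (rep w E \<sigma>)) \<longleftrightarrow> \<sigma> 1 \<in> insert 0 E"
proof -
  have "1 < num_vars" by (simp add: num_vars_def)
  then show ?thesis by (simp add: marked_def read_rep content_def cell_def del: nth_map)
qed

lemma exec_Cond:
  assumes "exec w (if b (map read_tape (rep w E \<sigma>)) then p else q) E \<sigma> T E' \<sigma>'"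
  shows "exec w (Cond b p q) E \<sigma> (T + 1) E' \<sigma>'"
  using assms runs_Cond unfolding exec_def by (metis (no_types, lifting) Suc_eq_plus1 Suc_le_mono)

lemma exec_Loop_exit:
  assumes "\<not> b (map read_tape (rep w E \<sigma>))"
  shows "exec w (Loop b p) E \<sigma> 1 E \<sigma>"
  using runs_Loop_exit[of b, OF assms] by (auto simp: exec_def)

lemma exec_Loop_step:
  assumes b: "b (map read_tape (rep w E \<sigma>))"
    and p: "exec w p E \<sigma> T E' \<sigma>'" and l: "exec w (Loop b p) E' \<sigma>' T' E'' \<sigma>''"
  shows "exec w (Loop b p) E \<sigma> (T + 1 + T') E'' \<sigma>''"
proof -
  obtain t where t: "t \<le> T" "runs p (rep w E \<sigma>) t (rep w E' \<sigma>')"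
    using p by (auto simp: exec_def)
  obtain t' where t': "t' \<le> T'" "runs (Loop b p) (rep w E' \<sigma>') t' (rep w E'' \<sigma>'')"
    using l by (auto simp: exec_def)
  have "runs (Loop b p) (rep w E \<sigma>) (Suc t + t') (rep w E'' \<sigma>'')"
    by (rule runs_Loop_step[of b, OF b t(2) t'(2)])
  moreover have "Suc t + t' \<le> T + 1 + T'" using t t' by simp
  ultimately show ?thesis by (auto simp: exec_def)
qed

lemma exec_countdown:
  assumes "0 < j" "j < num_vars"
    and "\<And>i. i \<le> n \<Longrightarrow> \<sigma> i j = i"
    and "\<And>i. i < n \<Longrightarrow> exec w p (E (Suc i)) (\<sigma> (Suc i)) T (E i) (\<sigma> i)"
  shows "exec w (Loop (nonzero j) p) (E n) (\<sigma> n) (n * (T + 1) + 1) (E 0) (\<sigma> 0)"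
  using assms(3,4)
proof (induction n)
  case 0
  then have "\<not> nonzero j (map read_tape (rep w (E 0) (\<sigma> 0)))"
    by (simp add: nonzero_rep[OF assms(1,2)])
  from exec_Loop_exit[of "nonzero j", OF this] show ?case by (rule exec_mono) simp
next
  case (Suc n)
  have b: "nonzero j (map read_tape (rep w (E (Suc n)) (\<sigma> (Suc n))))"
    using Suc.prems(1)[of "Suc n"] by (simp add: nonzero_rep[OF assms(1,2)])
  have "exec w (Loop (nonzero j) p) (E n) (\<sigma> n) (n * (T + 1) + 1) (E 0) (\<sigma> 0)"
    by (rule Suc.IH) (use Suc.prems in auto)
  from exec_Loop_step[of "nonzero j", OF b Suc.prems(2)[OF lessI] this] show ?case
    by (rule exec_mono) simp
qed

definition clear :: "nat \<Rightarrow> 'b prog" where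
  "clear j = Loop (nonzero j) (dec j)"

lemma exec_clear:
  assumes "0 < j" "j < num_vars"
  shows "exec w (clear j) E \<sigma> (2 * \<sigma> j + 1) E (\<sigma>(j := 0))"
proof -
  have "exec w (Loop (nonzero j) (dec j)) E (\<sigma>(j := \<sigma> j)) (\<sigma> j * (1 + 1) + 1) E (\<sigma>(j := 0))"
  proof (rule exec_countdown[OF assms, where E = "\<lambda>_. E" and \<sigma> = "\<lambda>i. \<sigma>(j := i)"])
    fix i
    show "exec w (dec j) E (\<sigma>(j := Suc i)) 1 E (\<sigma>(j := i))"
      using exec_dec[of j "\<sigma>(j := Suc i)" i w E] assms by simp
  qed simp
  then show ?thesis unfolding clear_def fun_upd_triv by (rule exec_mono) simp
qed

fun add_const :: "nat \<Rightarrow> nat \<Rightarrow> 'b prog" where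
  "add_const j 0 = skip"
| "add_const j (Suc c) = Seq (inc j) (add_const j c)"

lemma exec_add_const:
  assumes "j < num_vars"
  shows "exec w (add_const j c) E \<sigma> (2 * c + 1) E (\<sigma>(j := \<sigma> j + c))"
proof (induction c arbitrary: \<sigma>)
  case 0
  then show ?case using exec_skip[of w E \<sigma>] by simp
next
  case (Suc c)
  have "(\<sigma>(j := Suc (\<sigma> j)))(j := (\<sigma>(j := Suc (\<sigma> j))) j + c) = \<sigma>(j := \<sigma> j + Suc c)"
    by (simp add: fun_eq_iff)
  from exec_Seq[OF exec_inc[OF assms, of w E \<sigma>] Suc.IH, unfolded this] show ?case
    unfolding add_const.simps by (rule exec_mono) simp
qed

text \<open>Variable 4 is the scratch variable that restores \<open>y\<close>.\<close>

definition add_mult :: "nat \<Rightarrow> nat \<Rightarrow> nat \<Rightarrow> 'b prog" where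
  "add_mult x c y = Seq
    (Loop (nonzero y) (Seq (dec y) (Seq (inc 4) (add_const x c))))
    (Loop (nonzero 4) (Seq (dec 4) (inc y)))"

lemma exec_add_mult:
  assumes xy: "0 < x" "x < num_vars" "0 < y" "y < num_vars" "x \<noteq> y" "x \<noteq> 4" "y \<noteq> 4"
    and zero: "\<sigma> 4 = 0"
  shows "exec w (add_mult x c y) E \<sigma> (\<sigma> y * (2 * c + 10) + 3) E (\<sigma>(x := \<sigma> x + c * \<sigma> y))"
proof -
  define n where "n = \<sigma> y"
  \<comment> \<open>States by the value \<open>i\<close> still left in \<open>y\<close>: the part
    \<open>n - i\<close> already removed is kept in variable 4 and has been counted into
    \<open>x\<close>.\<close>
  define \<sigma>1 where "\<sigma>1 = (\<lambda>i. \<sigma>(y := i, 4 := n - i, x := \<sigma> x + c * (n - i)))"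
  have 4: "0 < (4::nat)" "4 < num_vars" by (auto simp: num_vars_def)
  have 1: "exec w (Loop (nonzero y) (Seq (dec y) (Seq (inc 4) (add_const x c))))
    E (\<sigma>1 n) (n * ((2 * c + 5) + 1) + 1) E (\<sigma>1 0)"
  proof (rule exec_countdown[OF xy(3,4), where E = "\<lambda>_. E"])
    fix i
    assume i: "i < n"
    let ?a = "(\<sigma>1 (Suc i))(y := i)"
    have 2: "exec w (dec y) E (\<sigma>1 (Suc i)) 1 E ?a"
      by (rule exec_dec) (use xy in \<open>auto simp: \<sigma>1_def\<close>)
    have "?a(4 := Suc (?a 4), x := (?a(4 := Suc (?a 4))) x + c) = \<sigma>1 i"
      using i xy Suc_diff_Suc[OF i, symmetric] by (auto simp: \<sigma>1_def fun_eq_iff)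
    then show "exec w (Seq (dec y) (Seq (inc 4) (add_const x c))) E (\<sigma>1 (Suc i)) (2 * c + 5) E (\<sigma>1 i)"
      using exec_Seq[OF 2 exec_Seq[OF exec_inc[OF 4(2), of w E ?a]
            exec_add_const[OF xy(2), of w c E "?a(4 := Suc (?a 4))"]]]
      by (simp add: algebra_simps numeral_eq_Suc)
  qed (use xy in \<open>auto simp: \<sigma>1_def\<close>)
  define \<sigma>2 where "\<sigma>2 = (\<lambda>i. \<sigma>(y := n - i, 4 := i, x := \<sigma> x + c * n))"
  have 2: "exec w (Loop (nonzero 4) (Seq (dec 4) (inc y))) E (\<sigma>2 n) (n * (3 + 1) + 1) E (\<sigma>2 0)"
  proof (rule exec_countdown[OF 4, where E = "\<lambda>_. E"])
    fix i
    assume i: "i < n"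
    let ?a = "(\<sigma>2 (Suc i))(4 := i)"
    have 2: "exec w (dec 4) E (\<sigma>2 (Suc i)) 1 E ?a"
      by (rule exec_dec) (use xy 4 in \<open>auto simp: \<sigma>2_def\<close>)
    have "?a(y := Suc (?a y)) = \<sigma>2 i"
      using i xy by (auto simp: \<sigma>2_def fun_eq_iff Suc_diff_Suc)
    then show "exec w (Seq (dec 4) (inc y)) E (\<sigma>2 (Suc i)) 3 E (\<sigma>2 i)"
      using exec_Seq[OF 2 exec_inc[OF xy(4), of w E ?a]] by (simp add: numeral_eq_Suc)
  qed (use xy in \<open>auto simp: \<sigma>2_def\<close>)
  have eqs: "\<sigma>1 n = \<sigma>" "\<sigma>1 0 = \<sigma>2 n" "\<sigma>2 0 = \<sigma>(x := \<sigma> x + c * \<sigma> y)"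
    using xy zero by (auto simp: \<sigma>1_def \<sigma>2_def n_def fun_eq_iff)
  have "exec w (add_mult x c y) E \<sigma>
      ((n * ((2 * c + 5) + 1) + 1) + (n * (3 + 1) + 1) + 1) E (\<sigma>(x := \<sigma> x + c * \<sigma> y))"
    unfolding add_mult_def
    by (rule exec_Seq[OF 1[unfolded eqs] 2[unfolded eqs]])
  then show ?thesis by (rule exec_mono) (simp add: n_def algebra_simps)
qed

section \<open>Saturation of a set of pairs\<close>

definition pair_code :: "nat \<Rightarrow> nat \<Rightarrow> nat" where
  "pair_code x y = (x + y) * (x + y) + x"

text \<open>Pairs with sum \<open>s\<close> get codes from \<open>s * s\<close> to
  \<open>s * s + s\<close>, which is below \<open>(s + 1) * (s + 1)\<close>. So the code determines
  the sum, and the remainder is \<open>x\<close>. Unlike Cantor's pairing this needs no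
  halving.\<close>

lemma pair_code_inject: "pair_code x y = pair_code x' y' \<longleftrightarrow> x = x' \<and> y = y'"
proof
  assume eq: "pair_code x y = pair_code x' y'"
  have less: "pair_code a b < pair_code c d" if "a + b < c + d" for a b c d
  proof -
    have "pair_code a b < Suc (a + b) * Suc (a + b)" by (simp add: pair_code_def)
    also have "\<dots> \<le> (c + d) * (c + d)" by (rule mult_le_mono) (use that in auto)
    also have "\<dots> \<le> pair_code c d" by (simp add: pair_code_def)
    finally show ?thesis .
  qed
  have "x + y = x' + y'"
    using less[of x y x' y'] less[of x' y' x y] eq by (cases "x + y" "x' + y'" rule: linorder_cases) auto
  then show "x = x' \<and> y = y'" using eq by (simp add: pair_code_def)
qed simp

text \<open>The square is formed by repeated addition: variable 2 holds the sum and variable 3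
  counts down a copy of it, while the address starts from the first entry.\<close>

definition addr :: "nat \<Rightarrow> nat \<Rightarrow> 'b prog" where
  "addr x y = Seq (add_mult 2 1 x) (Seq (add_mult 2 1 y) (Seq (add_mult 1 1 x) (Seq (add_mult 3 1 2)
    (Seq (Loop (nonzero 3) (Seq (dec 3) (add_mult 1 1 2))) (clear 2)))))"

lemma vars_less: "1 < num_vars" "2 < num_vars" "3 < num_vars" "4 < num_vars" "5 < num_vars"
    "6 < num_vars" "7 < num_vars" "8 < num_vars" "9 < num_vars" "10 < num_vars" "11 < num_vars"
  by (auto simp: num_vars_def)

lemma exec_addr:
  assumes xy: "4 < x" "x < num_vars" "4 < y" "y < num_vars"
    and zero: "\<sigma> 1 = 0" "\<sigma> 2 = 0" "\<sigma> 3 = 0" "\<sigma> 4 = 0"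
    and V: "\<sigma> x \<le> V" "\<sigma> y \<le> V"
  shows "exec w (addr x y) E \<sigma> (100 * (V + 1)\<^sup>2) E (\<sigma>(1 := pair_code (\<sigma> x) (\<sigma> y)))"
proof -
  define a b where ab: "a = \<sigma> x" "b = \<sigma> y"
  define \<sigma>1 where "\<sigma>1 = \<sigma>(2 := a)"
  have 1: "exec w (add_mult 2 1 x) E \<sigma> (a * 12 + 3) E \<sigma>1"
    using exec_add_mult[of 2 x \<sigma> w 1 E] xy zero vars_less by (simp add: \<sigma>1_def ab)
  define \<sigma>2 where "\<sigma>2 = \<sigma>(2 := a + b)"
  have 2: "exec w (add_mult 2 1 y) E \<sigma>1 (b * 12 + 3) E \<sigma>2"
    using exec_add_mult[of 2 y \<sigma>1 w 1 E] xy zero vars_less by (simp add: \<sigma>1_def \<sigma>2_def ab)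
  define \<sigma>3 where "\<sigma>3 = \<sigma>2(1 := a)"
  have 3: "exec w (add_mult 1 1 x) E \<sigma>2 (a * 12 + 3) E \<sigma>3"
    using exec_add_mult[of 1 x \<sigma>2 w 1 E] xy zero vars_less by (simp add: \<sigma>2_def \<sigma>3_def ab)
  define \<sigma>4 where "\<sigma>4 = (\<lambda>i. \<sigma>(2 := a + b, 3 := i, 1 := a + (a + b - i) * (a + b)))"
  have 4: "exec w (add_mult 3 1 2) E \<sigma>3 ((a + b) * 12 + 3) E (\<sigma>4 (a + b))"
  proof -
    have "\<sigma>3(3 := \<sigma>3 3 + 1 * \<sigma>3 2) = \<sigma>4 (a + b)"
      using zero by (auto simp: \<sigma>2_def \<sigma>3_def \<sigma>4_def fun_eq_iff)
    then show ?thesis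
      using exec_add_mult[of 3 2 \<sigma>3 w 1 E] zero vars_less by (simp add: \<sigma>3_def \<sigma>2_def)
  qed
  have 5: "exec w (Loop (nonzero 3) (Seq (dec 3) (add_mult 1 1 2))) E (\<sigma>4 (a + b))
      ((a + b) * (((a + b) * 12 + 5) + 1) + 1) E (\<sigma>4 0)"
  proof (rule exec_countdown[OF _ vars_less(3), where E = "\<lambda>_. E"])
    fix i
    assume i: "i < a + b"
    let ?a = "(\<sigma>4 (Suc i))(3 := i)"
    have 6: "exec w (dec 3) E (\<sigma>4 (Suc i)) 1 E ?a"
      by (rule exec_dec) (auto simp: \<sigma>4_def vars_less)
    have "?a(1 := ?a 1 + 1 * ?a 2) = \<sigma>4 i"
      using Suc_diff_Suc[OF i, symmetric] by (auto simp: \<sigma>4_def fun_eq_iff)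
    then have 7: "exec w (add_mult 1 1 2) E ?a (?a 2 * (2 * 1 + 10) + 3) E (\<sigma>4 i)"
      using exec_add_mult[of 1 2 ?a w 1 E] zero vars_less by (simp add: \<sigma>4_def)
    show "exec w (Seq (dec 3) (add_mult 1 1 2)) E (\<sigma>4 (Suc i)) ((a + b) * 12 + 5) E (\<sigma>4 i)"
      by (rule exec_mono[OF exec_Seq[OF 6 7]]) (simp add: \<sigma>4_def)
  qed (auto simp: \<sigma>4_def)
  have 6: "exec w (clear 2) E (\<sigma>4 0) (2 * (a + b) + 1) E (\<sigma>(1 := pair_code a b))"
  proof -
    have "(\<sigma>4 0)(2 := 0) = \<sigma>(1 := pair_code a b)"
      using zero by (auto simp: \<sigma>4_def fun_eq_iff pair_code_def)
    then show ?thesis using exec_clear[of 2 w E "\<sigma>4 0"] vars_less by (simp add: \<sigma>4_def)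
  qed
  have "a \<le> V" "b \<le> V" using V by (auto simp: ab)
  then have sq: "(a + b) * (a + b) \<le> (2 * V) * (2 * V)" by (intro mult_le_mono) auto
  show ?thesis
    unfolding addr_def ab[symmetric]
    by (rule exec_mono[OF exec_Seq[OF 1 exec_Seq[OF 2 exec_Seq[OF 3 exec_Seq[OF 4 exec_Seq[OF 5 6]]]]]])
      (use \<open>a \<le> V\<close> \<open>b \<le> V\<close> sq in \<open>simp add: power2_eq_square algebra_simps\<close>)
qed

lemma pair_code_le:
  assumes "x \<le> V" "y \<le> V" shows "pair_code x y \<le> 4 * (V + 1)\<^sup>2"
proof -
  have "(x + y) * (x + y) \<le> (2 * V) * (2 * V)" by (intro mult_le_mono) (use assms in auto)
  then show ?thesis using assms by (simp add: pair_code_def power2_eq_square)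
qed

definition mark_at :: "nat \<Rightarrow> nat \<Rightarrow> 'b prog" where
  "mark_at x y = Seq (addr x y) (Seq mark (clear 1))"

definition temps_zero :: "(nat \<Rightarrow> nat) \<Rightarrow> bool" where
  "temps_zero \<sigma> \<longleftrightarrow> (\<forall>i\<in>{1..6}. \<sigma> i = 0)"

lemma temps_zeroD:
  assumes "temps_zero \<sigma>"
  shows "\<sigma> 1 = 0" "\<sigma> (Suc 0) = 0" "\<sigma> 2 = 0" "\<sigma> 3 = 0" "\<sigma> 4 = 0" "\<sigma> 5 = 0" "\<sigma> 6 = 0"
  using assms by (auto simp: temps_zero_def)

lemma exec_mark_at:
  assumes xy: "4 < x" "x < num_vars" "4 < y" "y < num_vars"
    and zero: "\<sigma> 1 = 0" "\<sigma> 2 = 0" "\<sigma> 3 = 0" "\<sigma> 4 = 0"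
    and V: "\<sigma> x \<le> V" "\<sigma> y \<le> V"
  shows "exec w (mark_at x y) E \<sigma> (200 * (V + 1)\<^sup>2) (insert (pair_code (\<sigma> x) (\<sigma> y)) E) \<sigma>"
proof -
  let ?p = "pair_code (\<sigma> x) (\<sigma> y)"
  let ?a = "\<sigma>(1 := ?p)"
  have "?a(1 := 0) = \<sigma>" using zero by (auto simp: fun_eq_iff)
  then have c: "exec w (clear 1) (insert ?p E) ?a (2 * ?p + 1) (insert ?p E) \<sigma>"
    using exec_clear[of 1 w "insert ?p E" ?a] vars_less by simp
  have m: "exec w mark E ?a 1 (insert ?p E) ?a"
    using exec_mark[of w E ?a] by simp
  have "(V + 1)\<^sup>2 \<ge> 1" by simp
  then show ?thesis
    unfolding mark_at_def
    by (intro exec_mono[OF exec_Seq[OF exec_addr[OF xy zero V] exec_Seq[OF m c]]])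
      (use pair_code_le[OF V] in linarith)
qed

definition test_at :: "nat \<Rightarrow> nat \<Rightarrow> 'b prog \<Rightarrow> 'b prog" where
  "test_at x y p = Seq (addr x y) (Cond marked (Seq (clear 1) p) (clear 1))"

lemma exec_test_at:
  assumes xy: "4 < x" "x < num_vars" "4 < y" "y < num_vars"
    and zero: "\<sigma> 1 = 0" "\<sigma> 2 = 0" "\<sigma> 3 = 0" "\<sigma> 4 = 0"
    and V: "\<sigma> x \<le> V" "\<sigma> y \<le> V"
    and p: "pair_code (\<sigma> x) (\<sigma> y) \<in> insert 0 E \<Longrightarrow> exec w p E \<sigma> T E' \<sigma>"
    and q: "pair_code (\<sigma> x) (\<sigma> y) \<notin> insert 0 E \<Longrightarrow> E' = E"
  shows "exec w (test_at x y p) E \<sigma> (200 * (V + 1)\<^sup>2 + T) E' \<sigma>"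
proof -
  let ?p = "pair_code (\<sigma> x) (\<sigma> y)"
  let ?a = "\<sigma>(1 := ?p)"
  have "?a(1 := 0) = \<sigma>" using zero by (auto simp: fun_eq_iff)
  then have c: "exec w (clear 1) E ?a (2 * ?p + 1) E \<sigma>"
    using exec_clear[of 1 w E ?a] vars_less by simp
  have "exec w (Cond marked (Seq (clear 1) p) (clear 1)) E ?a ((2 * ?p + 1 + T + 1) + 1) E' \<sigma>"
  proof (rule exec_Cond, cases "?p \<in> insert 0 E")
    case True
    then have "marked (map read_tape (rep w E ?a :: 'a tape list))" by (simp add: marked_rep)
    with exec_Seq[OF c p[OF True]]
    show "exec w (if marked (map read_tape (rep w E ?a)) then Seq (clear 1) p else clear 1)
      E ?a (2 * ?p + 1 + T + 1) E' \<sigma>" by simp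
  next
    case False
    then have "\<not> marked (map read_tape (rep w E ?a :: 'a tape list))" by (simp add: marked_rep)
    with exec_mono[OF c, of "2 * ?p + 1 + T + 1"] q[OF False]
    show "exec w (if marked (map read_tape (rep w E ?a)) then Seq (clear 1) p else clear 1)
      E ?a (2 * ?p + 1 + T + 1) E' \<sigma>" by simp
  qed
  note 1 = exec_Seq[OF exec_addr[OF xy zero V] this]
  have "(V + 1)\<^sup>2 \<ge> 1" by simp
  then show ?thesis
    unfolding test_at_def
    by (intro exec_mono[OF 1]) (use pair_code_le[OF V] in linarith)
qed

text \<open>One affine map for each entry of a pair. On words coded in base \<open>b\<close>,
  appending a fixed word is such a map, so these rules can express a right congruence.\<close>

type_synonym rule = "nat \<times> nat \<times> nat \<times> nat"

fun rule_prog :: "rule \<Rightarrow> 'b prog" where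
  "rule_prog (k, c, k', c') = Seq (add_mult 5 k 7) (Seq (add_const 5 c) (Seq (add_mult 6 k' 8)
    (Seq (add_const 6 c') (Seq (mark_at 5 6) (Seq (clear 5) (clear 6))))))"

fun conclusion :: "nat \<Rightarrow> nat \<Rightarrow> rule \<Rightarrow> nat" where
  "conclusion u v (k, c, k', c') = pair_code (k * u + c) (k' * v + c')"

fun rule_bound :: "nat \<Rightarrow> nat \<Rightarrow> rule \<Rightarrow> bool" where
  "rule_bound V n (k, c, k', c') \<longleftrightarrow>
    k \<le> V \<and> c \<le> V \<and> k' \<le> V \<and> c' \<le> V \<and> k * n + c \<le> V \<and> k' * n + c' \<le> V"

lemma exec_rule:
  assumes zero: "temps_zero \<sigma>"
    and V: "\<sigma> 7 \<le> n" "\<sigma> 8 \<le> n" "n \<le> V" "rule_bound V n r"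
  shows "exec w (rule_prog r) E \<sigma> (300 * (V + 1)\<^sup>2) (insert (conclusion (\<sigma> 7) (\<sigma> 8) r) E) \<sigma>"
proof -
  obtain k c k' c' where r: "r = (k, c, k', c')" by (metis prod_cases4)
  note z = temps_zeroD[OF zero]
  define x y where xy: "x = k * \<sigma> 7 + c" "y = k' * \<sigma> 8 + c'"
  have "k * \<sigma> 7 + c \<le> k * n + c" "k' * \<sigma> 8 + c' \<le> k' * n + c'"
    using V by (auto intro: mult_le_mono)
  moreover have "k * n + c \<le> V" "k' * n + c' \<le> V" and cV: "c \<le> V" "c' \<le> V"
    using V by (auto simp: r)
  ultimately have xV: "x \<le> V" "y \<le> V" unfolding xy by (blast intro: order_trans)+
  define \<sigma>1 where "\<sigma>1 = \<sigma>(5 := k * \<sigma> 7)"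
  define \<sigma>2 where "\<sigma>2 = \<sigma>(5 := x)"
  define \<sigma>3 where "\<sigma>3 = \<sigma>(5 := x, 6 := k' * \<sigma> 8)"
  define \<sigma>4 where "\<sigma>4 = \<sigma>(5 := x, 6 := y)"
  let ?E = "insert (pair_code x y) E"
  have e1: "\<sigma>1(5 := \<sigma>1 5 + c) = \<sigma>2" and e2: "\<sigma>3(6 := \<sigma>3 6 + c') = \<sigma>4"
    and e3: "\<sigma>4(5 := 0) = \<sigma>(6 := y)" and e4: "\<sigma>(6 := y, 6 := 0) = \<sigma>"
    and e5: "\<sigma>2(6 := \<sigma>2 6 + k' * \<sigma>2 8) = \<sigma>3"
    using z by (auto simp: \<sigma>1_def \<sigma>2_def \<sigma>3_def \<sigma>4_def xy fun_eq_iff)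
  have t: "\<sigma> 7 * (2 * k + 10) + 3 \<le> V * (2 * V + 10) + 3"
    "\<sigma> 8 * (2 * k' + 10) + 3 \<le> V * (2 * V + 10) + 3"
    using V by (auto simp: r intro!: mult_le_mono)
  have 1: "exec w (add_mult 5 k 7) E \<sigma> (V * (2 * V + 10) + 3) E \<sigma>1"
    using exec_mono[OF exec_add_mult[of 5 7 \<sigma> w k E] t(1)] z vars_less by (simp add: \<sigma>1_def)
  have 2: "exec w (add_const 5 c) E \<sigma>1 (2 * V + 1) E \<sigma>2"
    by (rule exec_mono[OF exec_add_const[of 5 w c E \<sigma>1, unfolded e1]]) (use cV vars_less in auto)
  have 3: "exec w (add_mult 6 k' 8) E \<sigma>2 (V * (2 * V + 10) + 3) E \<sigma>3"
    by (rule exec_mono[OF exec_add_mult[of 6 8 \<sigma>2 w k' E, unfolded e5]])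
      (use t z vars_less in \<open>simp_all add: \<sigma>2_def\<close>)
  have 4: "exec w (add_const 6 c') E \<sigma>3 (2 * V + 1) E \<sigma>4"
    by (rule exec_mono[OF exec_add_const[of 6 w c' E \<sigma>3, unfolded e2]]) (use cV vars_less in auto)
  have 5: "exec w (mark_at 5 6) E \<sigma>4 (200 * (V + 1)\<^sup>2) ?E \<sigma>4"
    using exec_mark_at[of 5 6 \<sigma>4 V w E] z xV vars_less by (simp add: \<sigma>4_def)
  have 6: "exec w (clear 5) ?E \<sigma>4 (2 * V + 1) ?E (\<sigma>(6 := y))"
    by (rule exec_mono[OF exec_clear[of 5 w ?E \<sigma>4, unfolded e3]])
      (use xV vars_less in \<open>simp_all add: \<sigma>4_def\<close>)
  have 7: "exec w (clear 6) ?E (\<sigma>(6 := y)) (2 * V + 1) ?E \<sigma>"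
    by (rule exec_mono[OF exec_clear[of 6 w ?E "\<sigma>(6 := y)", unfolded e4]])
      (use xV vars_less in simp_all)
  have "exec w (rule_prog r) E \<sigma> (300 * (V + 1)\<^sup>2) ?E \<sigma>"
    unfolding r rule_prog.simps
    by (rule exec_mono[OF exec_Seq[OF 1 exec_Seq[OF 2 exec_Seq[OF 3 exec_Seq[OF 4
      exec_Seq[OF 5 exec_Seq[OF 6 7]]]]]]]) (simp add: power2_eq_square algebra_simps)
  then show ?thesis by (simp add: r xy)
qed

fun rules_prog :: "rule list \<Rightarrow> 'b prog" where
  "rules_prog [] = skip"
| "rules_prog (r # rs) = Seq (rule_prog r) (rules_prog rs)"

lemma exec_rules:
  assumes zero: "temps_zero \<sigma>"
    and V: "\<sigma> 7 \<le> n" "\<sigma> 8 \<le> n" "n \<le> V" "\<forall>r\<in>set rs. rule_bound V n r"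
  shows "exec w (rules_prog rs) E \<sigma> (length rs * (300 * (V + 1)\<^sup>2 + 1) + 1)
    (E \<union> conclusion (\<sigma> 7) (\<sigma> 8) ` set rs) \<sigma>"
  using V(4)
proof (induction rs arbitrary: E)
  case Nil
  then show ?case using exec_skip by simp
next
  case (Cons r rs)
  have "insert (conclusion (\<sigma> 7) (\<sigma> 8) r) E \<union> conclusion (\<sigma> 7) (\<sigma> 8) ` set rs
    = E \<union> conclusion (\<sigma> 7) (\<sigma> 8) ` set (r # rs)" by auto
  with exec_Seq[OF exec_rule[OF zero V(1,2,3), of r w E] Cons.IH] Cons.prems
  show ?case by (auto elim!: exec_mono)
qed

definition saturate :: "rule list \<Rightarrow> nat \<Rightarrow> nat \<Rightarrow> nat \<Rightarrow> nat set \<Rightarrow> nat set" where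
  "saturate rs u v z E =
    (if pair_code u v \<in> insert 0 E
     then let E' = E \<union> conclusion u v ` set rs in
       if pair_code z v \<in> insert 0 E' then insert (pair_code u z) E' else E'
     else E)"

definition body_prog :: "rule list \<Rightarrow> 'b prog" where
  "body_prog rs = test_at 7 8 (Seq (rules_prog rs) (test_at 9 8 (mark_at 7 9)))"

lemma exec_body:
  assumes zero: "temps_zero \<sigma>"
    and V: "\<sigma> 7 \<le> n" "\<sigma> 8 \<le> n" "\<sigma> 9 \<le> n" "n \<le> V" "\<forall>r\<in>set rs. rule_bound V n r" "length rs \<le> V"
  shows "exec w (body_prog rs) E \<sigma> (1000 * (V + 1) ^ 3) (saturate rs (\<sigma> 7) (\<sigma> 8) (\<sigma> 9) E) \<sigma>"
proof -
  note z = temps_zeroD[OF zero]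
  define T where "T = (V + 1)\<^sup>2"
  have T1: "T \<ge> 1" by (simp add: T_def)
  define P where "P = V * T"
  have "length rs * (300 * T + 1) \<le> V * (300 * T + 1)" using V by (intro mult_le_mono1) simp
  also have "\<dots> = 300 * P + V" by (simp add: P_def algebra_simps)
  finally have L: "length rs * (300 * T + 1) \<le> 300 * P + V" .
  have "(V + 1) ^ 3 = P + T"
    by (simp add: P_def T_def power3_eq_cube power2_eq_square algebra_simps)
  moreover have "V \<le> P" using T1 by (simp add: P_def)
  ultimately have le: "200 * T + (length rs * (300 * T + 1) + 1 + (200 * T + 200 * T) + 1)
    \<le> 1000 * (V + 1) ^ 3"
    using T1 L by linarith
  show ?thesis
    unfolding body_prog_def
  proof (rule exec_mono[OF exec_test_at[where V = V] le[unfolded T_def]])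
    let ?E = "E \<union> conclusion (\<sigma> 7) (\<sigma> 8) ` set rs"
    let ?E' = "if pair_code (\<sigma> 9) (\<sigma> 8) \<in> insert 0 ?E then insert (pair_code (\<sigma> 7) (\<sigma> 9)) ?E else ?E"
    assume "pair_code (\<sigma> 7) (\<sigma> 8) \<in> insert 0 E"
    then have s: "saturate rs (\<sigma> 7) (\<sigma> 8) (\<sigma> 9) E = ?E'"
      unfolding saturate_def Let_def by meson
    show "exec w (Seq (rules_prog rs) (test_at 9 8 (mark_at 7 9))) E \<sigma>
      (length rs * (300 * (V + 1)\<^sup>2 + 1) + 1 + (200 * (V + 1)\<^sup>2 + 200 * (V + 1)\<^sup>2) + 1)
      (saturate rs (\<sigma> 7) (\<sigma> 8) (\<sigma> 9) E) \<sigma>"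
      unfolding s
    proof (rule exec_Seq[OF exec_rules[OF zero V(1,2,4,5)] exec_test_at])
      assume "pair_code (\<sigma> 9) (\<sigma> 8) \<in> insert 0 ?E"
      then show "exec w (mark_at 7 9) ?E \<sigma> (200 * (V + 1)\<^sup>2) ?E' \<sigma>"
        using exec_mark_at[of 7 9 \<sigma> V w ?E] z V vars_less by simp
    qed (use z V vars_less in auto)
  qed (use z V vars_less in \<open>auto simp: saturate_def\<close>)
qed

text \<open>This is the order of the machine's loops, which decrement the counter before running the
  body: the indices go from \<open>n - 1\<close> down to 0.\<close>

fun iter_down :: "(nat \<Rightarrow> 'x \<Rightarrow> 'x) \<Rightarrow> nat \<Rightarrow> 'x \<Rightarrow> 'x" where
  "iter_down f 0 E = E"
| "iter_down f (Suc n) E = iter_down f n (f n E)"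

definition for_loop :: "nat \<Rightarrow> 'b prog \<Rightarrow> 'b prog" where
  "for_loop x p = Seq (add_mult x 1 10) (Loop (nonzero x) (Seq (dec x) p))"

lemma exec_for_loop:
  assumes x: "4 < x" "x < num_vars" "x \<noteq> 10"
    and zero: "\<sigma> 4 = 0" "\<sigma> x = 0"
    and p: "\<And>i E. i < \<sigma> 10 \<Longrightarrow> exec w p E (\<sigma>(x := i)) T (f i E) (\<sigma>(x := i))"
  shows "exec w (for_loop x p) E \<sigma> ((\<sigma> 10 + 1) * (T + 20)) (iter_down f (\<sigma> 10) E) \<sigma>"
proof -
  have loop: "exec w (Loop (nonzero x) (Seq (dec x) p)) E (\<sigma>(x := n)) (n * (T + 3) + 1)
      (iter_down f n E) (\<sigma>(x := 0))" if "n \<le> \<sigma> 10" for n E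
    using that
  proof (induction n arbitrary: E)
    case 0
    have "\<not> nonzero x (map read_tape (rep w E (\<sigma>(x := 0)) :: 'a tape list))"
      using x by (simp add: nonzero_rep)
    from exec_Loop_exit[of "nonzero x", OF this] show ?case
      unfolding iter_down.simps by (rule exec_mono) simp
  next
    case (Suc n)
    have b: "nonzero x (map read_tape (rep w E (\<sigma>(x := Suc n)) :: 'a tape list))"
      using x by (simp add: nonzero_rep)
    have "exec w (dec x) E (\<sigma>(x := Suc n)) 1 E (\<sigma>(x := n))"
      using exec_dec[of x "\<sigma>(x := Suc n)" n w E] x by simp
    note 1 = exec_Seq[OF this p[of n E]]
    show ?case
      unfolding iter_down.simps
      by (rule exec_mono[OF exec_Loop_step[of "nonzero x", OF b 1 Suc.IH]])
        (use Suc.prems in \<open>auto simp: algebra_simps\<close>)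
  qed
  have "exec w (add_mult x 1 10) E \<sigma> (\<sigma> 10 * 12 + 3) E (\<sigma>(x := \<sigma> 10))"
    using exec_add_mult[of x 10 \<sigma> w 1 E] x zero vars_less by simp
  moreover have "\<sigma>(x := 0) = \<sigma>" using zero by auto
  ultimately show ?thesis
    unfolding for_loop_def using loop[of "\<sigma> 10" E]
    by (intro exec_mono[OF exec_Seq]) (auto simp: algebra_simps)
qed

definition pass :: "rule list \<Rightarrow> nat \<Rightarrow> nat set \<Rightarrow> nat set" where
  "pass rs n E = iter_down (\<lambda>u. iter_down (\<lambda>v. iter_down (\<lambda>z. saturate rs u v z) n) n) n E"

definition pass_prog :: "rule list \<Rightarrow> 'b prog" where
  "pass_prog rs = Seq (inc 10) (for_loop 7 (for_loop 8 (for_loop 9 (body_prog rs))))"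

lemma exec_pass:
  assumes zero: "temps_zero \<sigma>" "\<sigma> 7 = 0" "\<sigma> 8 = 0" "\<sigma> 9 = 0"
    and n: "n = Suc (\<sigma> 10)"
    and V: "n \<le> V" "\<forall>r\<in>set rs. rule_bound V n r" "length rs \<le> V"
  shows "exec w (pass_prog rs) E \<sigma> (1100 * (V + 1) ^ 6) (pass rs n E) (\<sigma>(10 := n))"
proof -
  note z = temps_zeroD[OF zero(1)]
  let ?s = "\<sigma>(10 := n)"
  define B where "B = V + 1"
  have B: "B \<ge> 1" by (simp add: B_def)
  \<comment> \<open>Each nested loop raises the exponent by one, and its overhead is absorbed by
    adding 20 to the coefficient: 1000, 1020, 1040, 1060.\<close>
  have step: "(n + 1) * (c * B ^ e + 20) \<le> (c + 20) * B ^ (Suc e)" if "c \<ge> 1" for c e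
  proof -
    have "(n + 1) * (c * B ^ e + 20) \<le> B * ((c + 20) * B ^ e)"
      by (rule mult_le_mono) (use V B in \<open>auto simp: B_def algebra_simps\<close>)
    then show ?thesis by (simp add: algebra_simps)
  qed
  have loop9: "exec w (for_loop 9 (body_prog rs)) E (?s(7 := u, 8 := v)) (1020 * B ^ 4)
      (iter_down (\<lambda>z. saturate rs u v z) n E) (?s(7 := u, 8 := v))" if "u < n" "v < n" for u v E
  proof -
    let ?t = "?s(7 := u, 8 := v)"
    have "exec w (for_loop 9 (body_prog rs)) E ?t ((?t 10 + 1) * (1000 * B ^ 3 + 20))
      (iter_down (\<lambda>z. saturate rs u v z) (?t 10) E) ?t"
    proof (rule exec_for_loop)
      fix i E
      assume "i < ?t 10"
      then show "exec w (body_prog rs) E (?t(9 := i)) (1000 * B ^ 3) (saturate rs u v i E) (?t(9 := i))"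
        using exec_body[of "?t(9 := i)" n V rs w E] zero that V
        by (simp add: temps_zero_def B_def)
    qed (use zero z vars_less in auto)
    with step[of 1000 3] show ?thesis by (auto elim!: exec_mono)
  qed
  have loop8: "exec w (for_loop 8 (for_loop 9 (body_prog rs))) E (?s(7 := u)) (1040 * B ^ 5)
      (iter_down (\<lambda>v. iter_down (\<lambda>z. saturate rs u v z) n) n E) (?s(7 := u))" if "u < n" for u E
  proof -
    let ?t = "?s(7 := u)"
    have "exec w (for_loop 8 (for_loop 9 (body_prog rs))) E ?t ((?t 10 + 1) * (1020 * B ^ 4 + 20))
      (iter_down (\<lambda>v. iter_down (\<lambda>z. saturate rs u v z) n) (?t 10) E) ?t"
      by (rule exec_for_loop) (use zero z vars_less loop9 that in auto)
    with step[of 1020 4] show ?thesis by (auto elim!: exec_mono)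
  qed
  have loop7: "exec w (for_loop 7 (for_loop 8 (for_loop 9 (body_prog rs)))) E ?s (1060 * B ^ 6)
      (pass rs n E) ?s" for E
  proof -
    have "exec w (for_loop 7 (for_loop 8 (for_loop 9 (body_prog rs)))) E ?s
      ((?s 10 + 1) * (1040 * B ^ 5 + 20)) (pass rs (?s 10) E) ?s"
      unfolding pass_def
      by (rule exec_for_loop) (use zero z vars_less loop8 in auto)
    with step[of 1040 5] show ?thesis by (auto elim!: exec_mono)
  qed
  have "B ^ 6 \<ge> 1" using B by simp
  then show ?thesis
    unfolding pass_prog_def
    using exec_Seq[OF exec_inc[of 10 w E \<sigma>] loop7[unfolded n]] vars_less n
    by (auto elim!: exec_mono simp: B_def)
qed

lemma exec_Loop_upto:
  assumes "\<And>i. i < n \<Longrightarrow> b (map read_tape (rep w (E i) (\<sigma> i)))"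
    and "\<And>i. i < n \<Longrightarrow> exec w p (E i) (\<sigma> i) T (E (Suc i)) (\<sigma> (Suc i))"
    and "\<not> b (map read_tape (rep w (E n) (\<sigma> n)))"
  shows "exec w (Loop b p) (E 0) (\<sigma> 0) (n * (T + 1) + 1) (E n) (\<sigma> n)"
proof -
  have "exec w (Loop b p) (E i) (\<sigma> i) ((n - i) * (T + 1) + 1) (E n) (\<sigma> n)" if "i \<le> n" for i
    using that
  proof (induction rule: inc_induct)
    case base
    from exec_Loop_exit[of b, OF assms(3)] show ?case by simp
  next
    case (step m)
    from exec_Loop_step[of b, OF assms(1,2)[OF step.hyps(2)] step.IH]
    show ?case by (rule exec_mono) (simp add: Suc_diff_Suc[OF step.hyps(2), symmetric])
  qed
  from this[of 0] show ?thesis by simp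
qed

text \<open>Given reflexivity, \<open>join\<close> yields both symmetry and transitivity, so a
  search over triples covers it. \<open>P\<close> restricts all numbers of a derivation: soundness
  is about unrestricted derivations, completeness about those that stay below a bound.\<close>

inductive derivable :: "rule list \<Rightarrow> (nat \<Rightarrow> bool) \<Rightarrow> nat \<Rightarrow> nat \<Rightarrow> bool"
  for rs :: "rule list" and P :: "nat \<Rightarrow> bool" where
  base: "P 0 \<Longrightarrow> derivable rs P 0 0"
| rule: "\<lbrakk>derivable rs P u v; (k, c, k', c') \<in> set rs; P (k * u + c); P (k' * v + c')\<rbrakk>
    \<Longrightarrow> derivable rs P (k * u + c) (k' * v + c')"
| join: "\<lbrakk>derivable rs P u v; derivable rs P z v\<rbrakk> \<Longrightarrow> derivable rs P u z"

lemma derivable_bounded: "derivable rs P x y \<Longrightarrow> P x \<and> P y"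
  by (induction rule: derivable.induct) auto

lemma pair_code_0 [simp]: "pair_code 0 0 = 0"
  by (simp add: pair_code_def)

lemma iter_down_mono:
  fixes f :: "nat \<Rightarrow> 'x::order \<Rightarrow> 'x"
  assumes "\<And>i. mono (f i)" shows "mono (iter_down f n)"
proof (induction n)
  case (Suc n)
  then show ?case using assms[of n] by (simp add: mono_def)
qed (simp add: mono_def)

lemma iter_down_ge:
  fixes f :: "nat \<Rightarrow> 'x::order \<Rightarrow> 'x"
  assumes "\<And>i E. E \<le> f i E" shows "E \<le> iter_down f n E"
proof (induction n arbitrary: E)
  case (Suc n)
  have "E \<le> f n E" by (rule assms)
  also have "\<dots> \<le> iter_down f n (f n E)" by (rule Suc.IH)
  finally show ?case by simp
qed simp

text \<open>The rounds before round \<open>i\<close> enlarge its argument, monotonicity passes this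
  on, and the rounds after it enlarge the result.\<close>

lemma iter_down_component:
  fixes f :: "nat \<Rightarrow> 'x::order \<Rightarrow> 'x"
  assumes m: "\<And>i. mono (f i)" and g: "\<And>i E. E \<le> f i E" and "i < n"
  shows "f i E \<le> iter_down f n E"
  using \<open>i < n\<close>
proof (induction n arbitrary: E)
  case (Suc n)
  show ?case
  proof (cases "i = n")
    case True
    then show ?thesis using iter_down_ge[of f, OF g] by simp
  next
    case False
    have "f i E \<le> f i (f n E)" using m g by (meson monoD)
    also have "\<dots> \<le> iter_down f n (f n E)" using Suc False by simp
    finally show ?thesis by simp
  qed
qed simp

lemma iter_down_invariant:
  assumes "\<And>i E. I E \<Longrightarrow> I (f i E)" "I E" shows "I (iter_down f n E)"
  using assms(2) by (induction n arbitrary: E) (auto intro: assms(1))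

lemma saturate_ge: "E \<subseteq> saturate rs u v z E"
  by (auto simp: saturate_def Let_def)

lemma saturate_mono: "mono (saturate rs u v z)"
  unfolding mono_def saturate_def Let_def by (auto split: if_splits)

text \<open>The table is updated in place, so a step inside a pass acts on a table that has already
  grown. As all steps are monotone and inflationary, the outcome still contains what each step alone
  makes of \<open>E\<close>.\<close>

lemma saturate_subset_pass:
  assumes "u < n" "v < n" "z < n"
  shows "saturate rs u v z E \<subseteq> pass rs n E"
proof -
  let ?f = "\<lambda>u v. iter_down (\<lambda>z. saturate rs u v z) n"
  have mono1: "mono (?f u v)" and ge1: "E \<subseteq> ?f u v E" for u v E
    by (auto intro!: iter_down_mono saturate_mono iter_down_ge saturate_ge)
  have mono2: "mono (iter_down (?f u) n)" and ge2: "E \<subseteq> iter_down (?f u) n E" for u E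
    by (auto intro!: iter_down_mono mono1 iter_down_ge ge1)
  have "saturate rs u v z E \<subseteq> ?f u v E"
    by (rule iter_down_component[OF saturate_mono saturate_ge \<open>z < n\<close>])
  also have "\<dots> \<subseteq> iter_down (?f u) n E"
    by (rule iter_down_component[OF mono1 ge1 \<open>v < n\<close>])
  also have "\<dots> \<subseteq> pass rs n E"
    unfolding pass_def
    by (rule iter_down_component[of "\<lambda>u. iter_down (?f u) n", OF mono2 ge2 \<open>u < n\<close>])
  finally show ?thesis .
qed

lemma pass_ge: "E \<subseteq> pass rs n E"
  unfolding pass_def by (intro iter_down_ge saturate_ge)

text \<open>The range of the loops grows with the pass, because the bound that suffices for a given
  input is unknown to the machine.\<close>

fun stage :: "rule list \<Rightarrow> nat \<Rightarrow> nat set" where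
  "stage rs 0 = {}"
| "stage rs (Suc i) = pass rs (Suc i) (stage rs i)"

lemma stage_mono: "i \<le> j \<Longrightarrow> stage rs i \<subseteq> stage rs j"
  by (rule lift_Suc_mono_le[of "stage rs"]) (simp_all only: stage.simps pass_ge)

lemma stage_sound:
  assumes "pair_code x y \<in> insert 0 (stage rs i)"
  shows "derivable rs (\<lambda>_. True) x y"
proof -
  let ?D = "derivable rs (\<lambda>_. True)"
  \<comment> \<open>Conclusions may exceed the range of the loops, so the derivations here are
    unrestricted.\<close>
  define I where "I E \<longleftrightarrow> (\<forall>p\<in>E. \<exists>x y. p = pair_code x y \<and> ?D x y)" for E
  have D0: "?D 0 0" by (rule derivable.base) simp
  have I0: "?D x y" if "I E" "pair_code x y \<in> insert 0 E" for x y E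
    using that D0 unfolding I_def by (metis insertE pair_code_0 pair_code_inject)
  have concl: "I (E \<union> conclusion u v ` set rs)" if E: "I E" and uv: "?D u v" for E u v
  proof -
    have "\<exists>x y. conclusion u v r = pair_code x y \<and> ?D x y" if "r \<in> set rs" for r
    proof -
      obtain k c k' c' where "r = (k, c, k', c')" by (metis prod_cases4)
      then show ?thesis using derivable.rule[OF uv, of k c k' c'] that by auto
    qed
    then show ?thesis using E by (auto simp: I_def)
  qed
  have "I (saturate rs u v z E)" if E: "I E" for u v z E
  proof (cases "pair_code u v \<in> insert 0 E")
    case True
    then have uv: "?D u v" by (rule I0[OF E])
    let ?E = "E \<union> conclusion u v ` set rs"
    have E': "I ?E" by (rule concl[OF E uv])
    show ?thesis
    proof (cases "pair_code z v \<in> insert 0 ?E")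
      case True': True
      then have "?D u z" using derivable.join[OF uv] I0[OF E'] by blast
      then have "I (insert (pair_code u z) ?E)" using E' by (auto simp: I_def)
      moreover have "saturate rs u v z E = insert (pair_code u z) ?E"
        using True True' unfolding saturate_def Let_def by presburger
      ultimately show ?thesis by simp
    next
      case False
      then have "saturate rs u v z E = ?E"
        using True unfolding saturate_def Let_def by presburger
      then show ?thesis using E' by simp
    qed
  next
    case False
    then have "saturate rs u v z E = E" unfolding saturate_def by presburger
    then show ?thesis using E by simp
  qed
  then have "I (pass rs n E)" if "I E" for n E
    unfolding pass_def by (intro iter_down_invariant[where I = I] that)
  then have "I (stage rs i)"
    by (induction i) (auto simp: I_def)
  then show ?thesis using I0 assms by blast
qed

text \<open>
  From stage \<open>N\<close> on, each pass adds a new derivable pair of numbers below \<open>N\<close>, unless all of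
  them have been found.
\<close>

lemma stage_complete:
  assumes "derivable rs (\<lambda>x. x < N) x y"
  shows "pair_code x y \<in> insert 0 (stage rs (N + (N * N + 1)))"
proof -
  define D where "D = {(x, y). derivable rs (\<lambda>x. x < N) x y}"
  define X where "X i = {(x, y) \<in> D. pair_code x y \<in> insert 0 (stage rs (N + i))}" for i
  have D: "D \<subseteq> {..<N} \<times> {..<N}" using derivable_bounded by (auto simp: D_def)
  then have finD: "finite D" by (rule finite_subset) simp
  have cardD: "card D \<le> N * N" using card_mono[OF _ D] by simp
  have XD: "X i \<subseteq> D" for i by (auto simp: X_def)
  have XS: "X i \<subseteq> X (Suc i)" for i
    using stage_mono[of "N + i" "N + Suc i" rs] by (auto simp: X_def)
  \<comment> \<open>If a pass finds no new pair of \<open>D\<close>, the pairs found are closed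
    under all rules that stay below \<open>N\<close> and therefore exhaust \<open>D\<close>.\<close>
  have closed: "D \<subseteq> X i" if eq: "X (Suc i) = X i" for i
  proof -
    let ?E = "stage rs (N + i)"
    have sub: "saturate rs u v z ?E \<subseteq> stage rs (N + Suc i)" if "u < N" "v < N" "z < N" for u v z
      using saturate_subset_pass[of u "Suc (N + i)" v z rs ?E] that by simp
    have "(x, y) \<in> X i" if "derivable rs (\<lambda>x. x < N) x y" for x y
      using that
    proof (induction rule: derivable.induct)
      case base
      then show ?case using derivable.base[of "\<lambda>x. x < N" rs] by (simp add: X_def D_def)
    next
      case (rule u v k c k' c')
      then have uv: "u < N" "v < N" "pair_code u v \<in> insert 0 ?E"
        by (auto simp: X_def D_def dest: derivable_bounded)
      have "conclusion u v (k, c, k', c') \<in> conclusion u v ` set rs"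
        using rule.hyps(2) by (rule imageI)
      \<comment> \<open>Any third index below \<open>N\<close> serves here; \<open>u\<close> is at
        hand.\<close>
      then have "conclusion u v (k, c, k', c') \<in> saturate rs u v u ?E"
        using uv(3) unfolding saturate_def Let_def by (auto simp del: conclusion.simps)
      then have "conclusion u v (k, c, k', c') \<in> stage rs (N + Suc i)"
        using sub uv by blast
      then have "(k * u + c, k' * v + c') \<in> X (Suc i)"
        using derivable.rule[OF rule.hyps] by (simp add: X_def D_def)
      then show ?case using eq by simp
    next
      case (join u v z)
      then have uv: "u < N" "v < N" "z < N" "pair_code u v \<in> insert 0 ?E" "pair_code z v \<in> insert 0 ?E"
        by (auto simp: X_def D_def dest: derivable_bounded)
      then have "pair_code u z \<in> saturate rs u v z ?E"
        unfolding saturate_def Let_def by auto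
      then have "pair_code u z \<in> stage rs (N + Suc i)"
        using sub uv by blast
      then have "(u, z) \<in> X (Suc i)"
        using derivable.join[OF join.hyps] by (simp add: X_def D_def)
      then show ?case using eq by simp
    qed
    then show ?thesis by (auto simp: D_def)
  qed
  \<comment> \<open>The first alternative is impossible for \<open>i = N * N + 1\<close>, as
    \<open>D\<close> has at most \<open>N * N\<close> elements. The offset \<open>N\<close> of the
    stages ensures that the loops range over all numbers below \<open>N\<close>.\<close>
  have "i \<le> card (X i) \<or> D \<subseteq> X i" for i
  proof (induction i)
    case (Suc i)
    show ?case
    proof (cases "D \<subseteq> X i")
      case True
      then show ?thesis using XS by blast
    next
      case False
      then have "X i \<subset> X (Suc i)" using XS[of i] closed[of i] by blast
      then have "card (X i) < card (X (Suc i))"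
        using finD XD by (meson finite_subset psubset_card_mono)
      then show ?thesis using Suc False by simp
    qed
  qed simp
  moreover have "card (X (N * N + 1)) \<le> N * N"
    using card_mono[OF finD XD] cardD by (rule order_trans)
  ultimately have "D \<subseteq> X (N * N + 1)" by (metis Suc_eq_plus1 not_less_eq_eq)
  then show ?thesis using assms by (auto simp: D_def X_def)
qed

section \<open>Reading the input and assembling the closure machine\<close>

abbreviation zeros :: "nat \<Rightarrow> nat" where "zeros \<equiv> \<lambda>_. 0"

definition num_code :: "('b \<Rightarrow> nat) \<Rightarrow> nat \<Rightarrow> 'b list \<Rightarrow> nat" where
  "num_code dig b w = foldl (\<lambda>c x. b * c + dig x) 0 w"

lemma num_code_Nil [simp]: "num_code dig b [] = 0"
  by (simp add: num_code_def)

lemma num_code_snoc [simp]: "num_code dig b (w @ [x]) = b * num_code dig b w + dig x"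
  by (simp add: num_code_def)

lemma num_code_take_le:
  assumes "b \<ge> 1" shows "num_code dig b (take i w) \<le> num_code dig b w"
proof -
  have "num_code dig b u \<le> num_code dig b (u @ v)" for u v
  proof (induction v rule: rev_induct)
    case (snoc x v)
    have "num_code dig b (u @ v) \<le> b * num_code dig b (u @ v)" using assms by simp
    with snoc show ?case unfolding append_assoc[symmetric] num_code_snoc by linarith
  qed simp
  from this[of "take i w" "drop i w"] show ?thesis by simp
qed

fun digit_prog :: "('b \<Rightarrow> nat) \<Rightarrow> 'b list \<Rightarrow> 'b prog" where
  "digit_prog dig [] = skip"
| "digit_prog dig (x # xs) =
    Cond (\<lambda>ss. ss ! 0 = Input x) (add_const 11 (dig x)) (digit_prog dig xs)"

lemma exec_digit:
  assumes "map read_tape (rep w E \<sigma>) ! 0 = Input x" "x \<in> set xs" "dig x \<le> V" "length xs \<le> V"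
  shows "exec w (digit_prog dig xs) E \<sigma> (3 * V + 1) E (\<sigma>(11 := \<sigma> 11 + dig x))"
proof -
  have "exec w (digit_prog dig xs) E \<sigma> (2 * V + 1 + length xs) E (\<sigma>(11 := \<sigma> 11 + dig x))"
    using assms(2)
  proof (induction xs)
    case (Cons y xs)
    show ?case
    proof (cases "x = y")
      case True
      then have "map read_tape (rep w E \<sigma>) ! 0 = Input y" using assms(1) by simp
      moreover have "exec w (add_const 11 (dig y)) E \<sigma> (2 * V + 1) E (\<sigma>(11 := \<sigma> 11 + dig x))"
        by (rule exec_mono) (use exec_add_const[of 11 w "dig y" E \<sigma>] vars_less True assms(3) in auto)
      ultimately have "exec w (if map read_tape (rep w E \<sigma>) ! 0 = Input y then add_const 11 (dig y)
          else digit_prog dig xs) E \<sigma> (2 * V + 1) E (\<sigma>(11 := \<sigma> 11 + dig x))"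
        by presburger
      from exec_Cond[of w "\<lambda>ss. ss ! 0 = Input y", OF this] show ?thesis
        unfolding digit_prog.simps by (rule exec_mono) simp
    next
      case False
      then have "map read_tape (rep w E \<sigma>) ! 0 \<noteq> Input y" using assms(1) by simp
      moreover have "exec w (digit_prog dig xs) E \<sigma> (2 * V + 1 + length xs) E
          (\<sigma>(11 := \<sigma> 11 + dig x))"
        using Cons.prems False by (intro Cons.IH) simp
      ultimately have "exec w (if map read_tape (rep w E \<sigma>) ! 0 = Input y then add_const 11 (dig y)
          else digit_prog dig xs) E \<sigma> (2 * V + 1 + length xs) E (\<sigma>(11 := \<sigma> 11 + dig x))"
        by presburger
      from exec_Cond[of w "\<lambda>ss. ss ! 0 = Input y", OF this] show ?thesis
        unfolding digit_prog.simps by (rule exec_mono) simp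
    qed
  qed simp
  then show ?thesis by (rule exec_mono) (use assms in simp)
qed

definition read_prog :: "('b \<Rightarrow> nat) \<Rightarrow> nat \<Rightarrow> 'b list \<Rightarrow> 'b prog" where
  "read_prog dig b xs = Loop (\<lambda>ss. ss ! 0 \<noteq> Blank)
    (Seq (add_mult 5 b 11) (Seq (clear 11) (Seq (add_mult 11 1 5) (Seq (clear 5)
      (Seq (digit_prog dig xs) (inc 0))))))"

lemma input_rep: "map read_tape (rep w E \<sigma>) ! 0 =
    (if \<sigma> 0 < length w then Input (w ! \<sigma> 0) else Blank)"
  by (simp add: read_rep num_vars_def content_def input_tape_def del: nth_map)

lemma exec_read:
  assumes w: "set w \<subseteq> set xs" and b: "1 \<le> b" "b \<le> V" "length xs \<le> V"
    and dig: "\<And>x. x \<in> set xs \<Longrightarrow> dig x \<le> V" and cw: "num_code dig b w \<le> V"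
  shows "exec w (read_prog dig b xs) {} zeros (length w * (100 * (V + 1)\<^sup>2) + 1)
    {} (zeros(0 := length w, 11 := num_code dig b w))"
proof -
  define c where "c i = num_code dig b (take i w)" for i
  define \<sigma> where "\<sigma> i = zeros(0 := i, 11 := c i)" for i :: nat
  have "exec w (read_prog dig b xs) {} (\<sigma> 0) (length w * (((100 * (V + 1)\<^sup>2) - 1) + 1) + 1) {} (\<sigma> (length w))"
    unfolding read_prog_def
  proof (rule exec_Loop_upto[where E = "\<lambda>_. {}"])
    fix i
    assume i: "i < length w"
    then show "map read_tape (rep w {} (\<sigma> i)) ! 0 \<noteq> Blank"
      by (simp add: input_rep \<sigma>_def del: nth_map)
    have cS: "c (Suc i) = b * c i + dig (w ! i)"
      using i by (simp add: c_def take_Suc_conv_app_nth)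
    have x: "w ! i \<in> set xs" using w i by auto
    have le: "c (Suc i) \<le> V" using num_code_take_le[OF b(1), of dig "Suc i" w] cw by (simp add: c_def)
    then have bc: "b * c i \<le> V" using cS by simp
    have ci: "c i \<le> V" using num_code_take_le[OF b(1), of dig i w] cw by (simp add: c_def)
    let ?a = "(\<sigma> i)(5 := b * c i)"
    let ?b = "zeros(0 := i, 5 := b * c i)"
    let ?c = "zeros(0 := i, 5 := b * c i, 11 := b * c i)"
    let ?d = "zeros(0 := i, 11 := b * c i)"
    let ?e = "zeros(0 := i, 11 := c (Suc i))"
    have 1: "exec w (add_mult 5 b 11) {} (\<sigma> i) (c i * (2 * b + 10) + 3) {} ?a"
      using exec_add_mult[of 5 11 "\<sigma> i" w b "{}"] vars_less by (simp add: \<sigma>_def)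
    have "?a(11 := 0) = ?b" by (auto simp: \<sigma>_def fun_eq_iff)
    then have 2: "exec w (clear 11) {} ?a (2 * c i + 1) {} ?b"
      using exec_clear[of 11 w "{}" ?a] vars_less by (simp add: \<sigma>_def)
    have "?b(11 := ?b 11 + 1 * ?b 5) = ?c" by (auto simp: fun_eq_iff)
    then have 3: "exec w (add_mult 11 1 5) {} ?b (b * c i * 12 + 3) {} ?c"
      using exec_add_mult[of 11 5 ?b w 1 "{}"] vars_less by simp
    have "?c(5 := 0) = ?d" by (auto simp: fun_eq_iff)
    then have 4: "exec w (clear 5) {} ?c (2 * (b * c i) + 1) {} ?d"
      using exec_clear[of 5 w "{}" ?c] vars_less by simp
    have "?d(11 := ?d 11 + dig (w ! i)) = ?e" by (auto simp: fun_eq_iff cS)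
    moreover have "map read_tape (rep w {} ?d) ! 0 = Input (w ! i)"
      using i by (simp add: input_rep del: nth_map)
    ultimately have 5: "exec w (digit_prog dig xs) {} ?d (3 * V + 1) {} ?e"
      using exec_digit[of w "{}" ?d "w ! i" xs dig V] x dig[OF x] b by (simp del: nth_map)
    have "?e(0 := Suc (?e 0)) = \<sigma> (Suc i)" by (auto simp: \<sigma>_def fun_eq_iff)
    then have 6: "exec w (inc 0) {} ?e 1 {} (\<sigma> (Suc i))"
      using exec_inc[of 0 w "{}" ?e] by (simp add: num_vars_def)
    show "exec w (Seq (add_mult 5 b 11) (Seq (clear 11) (Seq (add_mult 11 1 5) (Seq (clear 5)
      (Seq (digit_prog dig xs) (inc 0)))))) {} (\<sigma> i) (100 * (V + 1)\<^sup>2 - 1) {} (\<sigma> (Suc i))"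
    proof (rule exec_mono[OF exec_Seq[OF 1 exec_Seq[OF 2 exec_Seq[OF 3 exec_Seq[OF 4 exec_Seq[OF 5 6]]]]]])
      have "c i * (2 * b + 10) = 2 * (b * c i) + 10 * c i" by (simp add: algebra_simps)
      moreover have "(V + 1)\<^sup>2 \<ge> V + 1" by (simp add: power2_eq_square)
      ultimately show "c i * (2 * b + 10) + 3 + (2 * c i + 1 + (b * c i * 12 + 3 +
          (2 * (b * c i) + 1 + (3 * V + 1 + 1 + 1) + 1) + 1) + 1) + 1 \<le> 100 * (V + 1)\<^sup>2 - 1"
        using bc ci by linarith
    qed
  qed (simp add: input_rep \<sigma>_def del: nth_map)
  moreover have "100 * (V + 1)\<^sup>2 - 1 + 1 = 100 * (V + 1)\<^sup>2" by simp
  moreover have "\<sigma> 0 = zeros" by (auto simp: \<sigma>_def c_def)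
  ultimately show ?thesis by (simp add: \<sigma>_def c_def)
qed

text \<open>Fresh work tapes are blank, whereas \<open>rep\<close> presupposes the end
  markers.\<close>

definition init_prog :: "'b prog" where
  "init_prog = Act (\<lambda>ss. (ss ! 0, Stay) # replicate (num_vars - 1) (Work 0, Stay))"

lemma runs_init:
  "runs init_prog (input_tape w # replicate (num_vars - 1) blank_tape) 1 (rep w {} zeros)"
proof -
  let ?s = "input_tape w # replicate (num_vars - 1) blank_tape"
  have "map2 act_tape ?s ((\<lambda>ss. (ss ! 0, Stay) # replicate (num_vars - 1) (Work 0, Stay))
      (map read_tape ?s)) = rep w {} zeros"
  proof (rule nth_equalityI)
    fix i
    assume "i < length (map2 act_tape ?s
      ((\<lambda>ss. (ss ! 0, Stay) # replicate (num_vars - 1) (Work 0, Stay)) (map read_tape ?s)))"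
    then have i: "i < num_vars" by (simp add: num_vars_def)
    show "map2 act_tape ?s ((\<lambda>ss. (ss ! 0, Stay) # replicate (num_vars - 1) (Work 0, Stay))
      (map read_tape ?s)) ! i = rep w {} zeros ! i"
    proof (cases i)
      case 0
      then show ?thesis using i by (simp add: nth_rep content_def input_tape_def fun_eq_iff)
    next
      case (Suc j)
      then show ?thesis using i
        by (simp add: nth_rep content_def blank_tape_def fun_eq_iff cell_def)
    qed
  qed (simp add: num_vars_def)
  then show ?thesis
    using runs_Act[of "\<lambda>ss. (ss ! 0, Stay) # replicate (num_vars - 1) (Work 0, Stay)" ?s]
    unfolding init_prog_def by simp
qed

text \<open>Between rounds the address register points at the pair of the input code and 0 (variable
  6 is 0), so the loop test looks at a single cell. A pass uses the register itself, hence the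
  clearing before it and the new address after it.\<close>

definition round_prog :: "rule list \<Rightarrow> 'b prog" where
  "round_prog rs = Seq (clear 1) (Seq (pass_prog rs) (addr 11 6))"

definition closure_prog :: "('b \<Rightarrow> nat) \<Rightarrow> nat \<Rightarrow> 'b list \<Rightarrow> rule list \<Rightarrow> 'b prog" where
  "closure_prog dig b xs rs = Seq init_prog (Seq (read_prog dig b xs) (Seq (addr 11 6)
    (Loop (\<lambda>ss. \<not> marked ss) (round_prog rs))))"

lemma rule_bound_exists: "\<exists>K. \<forall>r\<in>set rs. \<forall>n V. K * (n + 1) \<le> V \<longrightarrow> rule_bound V n r"
proof (induction rs)
  case (Cons r rs)
  then obtain K where K: "\<forall>r\<in>set rs. \<forall>n V. K * (n + 1) \<le> V \<longrightarrow> rule_bound V n r" by blast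
  obtain k c k' c' where r: "r = (k, c, k', c')" by (metis prod_cases4)
  let ?K = "K + k + c + k' + c'"
  have "\<forall>q\<in>set (r # rs). \<forall>n V. ?K * (n + 1) \<le> V \<longrightarrow> rule_bound V n q"
  proof (intro ballI allI impI)
    fix q n V
    assume q: "q \<in> set (r # rs)" and V: "?K * (n + 1) \<le> V"
    then have V': "K * n + K + k * n + k + c * n + c + k' * n + k' + c' * n + c' \<le> V"
      by (simp add: algebra_simps)
    show "rule_bound V n q"
    proof (cases "q = r")
      case True
      then show ?thesis unfolding r using V' by simp
    next
      case False
      have "K * (n + 1) \<le> V" using V' by simp
      then show ?thesis using K q False by simp
    qed
  qed
  then show ?case by blast
qed simp

definition round_state :: "nat \<Rightarrow> nat \<Rightarrow> nat \<Rightarrow> nat \<Rightarrow> nat" where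
  "round_state l c i = zeros(0 := l, 1 := pair_code c 0, 10 := i, 11 := c)"

lemma exec_round:
  assumes V: "Suc i \<le> V" "\<forall>r\<in>set rs. rule_bound V (Suc i) r" "length rs \<le> V" "c \<le> V"
  shows "exec w (round_prog rs) (stage rs i) (round_state l c i) (2000 * (V + 1) ^ 6)
    (stage rs (Suc i)) (round_state l c (Suc i))"
proof -
  let ?z = "\<lambda>i. zeros(0 := l, 10 := i, 11 := c)"
  have "(round_state l c i)(1 := 0) = ?z i" by (auto simp: round_state_def fun_eq_iff)
  then have 1: "exec w (clear 1) (stage rs i) (round_state l c i) (2 * pair_code c 0 + 1) (stage rs i) (?z i)"
    using exec_clear[of 1 w "stage rs i" "round_state l c i"] vars_less
    by (simp add: round_state_def)
  have "(?z i)(10 := Suc i) = ?z (Suc i)" by (auto simp: fun_eq_iff)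
  moreover have "temps_zero (?z i)" by (auto simp: temps_zero_def)
  ultimately have 2: "exec w (pass_prog rs) (stage rs i) (?z i) (1100 * (V + 1) ^ 6) (stage rs (Suc i)) (?z (Suc i))"
    using exec_pass[of "?z i" "Suc i" V rs w "stage rs i"] V by simp
  have "(?z (Suc i))(1 := pair_code ((?z (Suc i)) 11) ((?z (Suc i)) 6)) = round_state l c (Suc i)"
    by (auto simp: round_state_def fun_eq_iff)
  then have 3: "exec w (addr 11 6) (stage rs (Suc i)) (?z (Suc i)) (100 * (V + 1)\<^sup>2) (stage rs (Suc i)) (round_state l c (Suc i))"
    using exec_addr[of 11 6 "?z (Suc i)" V w "stage rs (Suc i)"] vars_less V by simp
  have "pair_code c 0 \<le> 4 * (V + 1)\<^sup>2" by (rule pair_code_le) (use V in auto)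
  moreover have "(V + 1)\<^sup>2 \<le> (V + 1) ^ 6" by (rule power_increasing) auto
  moreover have "(V + 1) ^ 6 \<ge> 1" by simp
  ultimately show ?thesis
    unfolding round_prog_def
    by (intro exec_mono[OF exec_Seq[OF 1 exec_Seq[OF 2 3]]]) linarith
qed

lemma marked_round_state:
  "marked (map read_tape (rep w (stage rs i) (round_state l c i)))
    \<longleftrightarrow> pair_code c 0 \<in> insert 0 (stage rs i)"
  by (simp add: marked_rep round_state_def)

lemma wf_simple_progs:
  fixes S :: "'b tape_symbol set"
  assumes S: "Blank \<in> S" "Work 0 \<in> S" "Work 1 \<in> S"
  shows "wf_prog S num_vars (skip :: 'b prog)"
    and "j < num_vars \<Longrightarrow> wf_prog S num_vars (inc j :: 'b prog)"
    and "j < num_vars \<Longrightarrow> wf_prog S num_vars (dec j :: 'b prog)"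
    and "wf_prog S num_vars (mark :: 'b prog)"
    and "wf_prog S num_vars (init_prog :: 'b prog)"
  using S by (auto simp: skip_def inc_def dec_def mark_def init_prog_def idle_def vars_less in_listsD
      num_vars_def intro!: wf_upd)

lemma wf_closure_prog:
  fixes S :: "'b tape_symbol set"
  assumes S: "Blank \<in> S" "Work 0 \<in> S" "Work 1 \<in> S"
  shows "wf_prog S num_vars (closure_prog dig b xs rs :: 'b prog)"
proof -
  note wf = wf_simple_progs[OF S]
  have const: "wf_prog S num_vars (add_const j c :: 'b prog)" if "j < num_vars" for j c
    by (induction c) (use that wf in auto)
  have clear: "wf_prog S num_vars (clear j :: 'b prog)" if "j < num_vars" for j
    using that wf by (simp add: clear_def)
  have mult: "wf_prog S num_vars (add_mult x c y :: 'b prog)" if "x < num_vars" "y < num_vars" for x c y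
    using that wf const vars_less by (simp add: add_mult_def)
  have addr: "wf_prog S num_vars (addr x y :: 'b prog)" if "x < num_vars" "y < num_vars" for x y
    using that wf const mult clear vars_less by (simp add: addr_def)
  have rule: "wf_prog S num_vars (rule_prog r :: 'b prog)" for r
    by (cases r) (use wf const mult clear addr vars_less in \<open>simp add: mark_at_def\<close>)
  have rules: "wf_prog S num_vars (rules_prog rs :: 'b prog)" for rs
    by (induction rs) (use wf rule in auto)
  have digit: "wf_prog S num_vars (digit_prog dig xs)"
    by (induction xs) (use wf const vars_less in auto)
  show ?thesis
    using wf const mult clear addr rules digit vars_less
    by (simp add: closure_prog_def read_prog_def round_prog_def pass_prog_def for_loop_def
        body_prog_def test_at_def mark_at_def num_vars_def[symmetric])
qed

text \<open>\<open>N\<close> belongs to the analysis only: the program runs through the stages until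
  the pair of the input code and 0 appears.\<close>

theorem closure_machine:
  fixes \<Sigma> :: "'b set" and dig :: "'b \<Rightarrow> nat"
  assumes fin: "finite \<Sigma>" and b: "b \<ge> 1"
  shows "\<exists>M. turing_machine \<Sigma> M \<and>
    (\<forall>w\<in>lists \<Sigma>. \<forall>t. accepts_within M w t \<longrightarrow> derivable rs (\<lambda>_. True) (num_code dig b w) 0) \<and>
    (\<exists>C e. \<forall>w\<in>lists \<Sigma>. \<forall>N. num_code dig b w < N \<longrightarrow> length w < N \<longrightarrow>
      derivable rs (\<lambda>x. x < N) (num_code dig b w) 0 \<longrightarrow>
      (\<exists>t \<le> C * N ^ e. accepts_within M w t))"
proof -
  obtain xs where xs: "set xs = \<Sigma>" using finite_list[OF fin] by blast
  define S :: "'b tape_symbol set" where "S = {Blank, Work 0, Work 1} \<union> Input ` \<Sigma>"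
  define p where "p = closure_prog dig b xs rs"
  have "wf_prog S num_vars p" unfolding p_def by (rule wf_closure_prog) (auto simp: S_def)
  then obtain M where M: "turing_machine \<Sigma> M" and acc: "\<And>w t. accepts_within M w t \<longleftrightarrow>
      fst ((prog_step ^^ t) ([p], input_tape w # replicate (num_vars - 1) blank_tape)) = []"
    using prog_to_machine[of S \<Sigma> num_vars p] fin by (auto simp: S_def num_vars_def)
  obtain K0 where K0: "\<forall>r\<in>set rs. \<forall>n V. K0 * (n + 1) \<le> V \<longrightarrow> rule_bound V n r"
    using rule_bound_exists by blast
  \<comment> \<open>\<open>K\<close> dominates all constants of the program, so that
    \<open>K * (m + 1)\<close> can serve as the bound \<open>V\<close> of the time estimates in the
    first \<open>m\<close> rounds.\<close>
  define K where "K = K0 + length rs + b + length xs + sum dig \<Sigma> + 1"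
  define c where "c w = num_code dig b w" for w
  define s where "s w i = (rep w (stage rs i) (round_state (length w) (c w) i) :: 'b tape list)" for w i
  have V: "Suc i \<le> V \<and> (\<forall>r\<in>set rs. rule_bound V (Suc i) r) \<and> length rs \<le> V \<and> k \<le> V
      \<and> length xs \<le> V \<and> b \<le> V \<and> (\<forall>x\<in>\<Sigma>. dig x \<le> V)"
    if "i < m" "k \<le> m" "V = K * (m + 1)" for i m k V
  proof -
    have KV: "K * (m + 1) \<le> V" and K1: "K \<ge> 1" using that by (auto simp: K_def)
    have "1 * (m + 1) \<le> K * (m + 1)" by (rule mult_le_mono1[OF K1])
    moreover have "K \<le> K * (m + 1)" by simp
    ultimately have "m + 1 \<le> K * (m + 1)" "K \<le> K * (m + 1)" by simp_all
    then have m: "m + 1 \<le> V" "K \<le> V" using KV by auto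
    have "K0 * (Suc i + 1) \<le> K * (m + 1)" by (rule mult_le_mono) (use that in \<open>auto simp: K_def\<close>)
    then have "rule_bound V (Suc i) r" if "r \<in> set rs" for r using K0 that KV by fastforce
    moreover have "dig x \<le> V" if "x \<in> \<Sigma>" for x
      using m(2) member_le_sum[OF that, of dig] fin by (simp add: K_def)
    ultimately show ?thesis using m that by (auto simp: K_def)
  qed
  have round: "exec w (round_prog rs) (stage rs i) (round_state (length w) (c w) i)
      (2000 * (K * (m + 1) + 1) ^ 6) (stage rs (Suc i)) (round_state (length w) (c w) (Suc i))"
    if "i < m" "c w \<le> m" for w i m
    by (rule exec_round) (use V[OF that refl] in auto)
  have read: "exec w (read_prog dig b xs) {} zeros (length w * (100 * (K * (m + 1) + 1)\<^sup>2) + 1)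
      {} (zeros(0 := length w, 11 := c w))" if "w \<in> lists \<Sigma>" "c w \<le> m" "m > 0" for w m
    unfolding c_def
    by (rule exec_read) (use V[OF that(3) that(2)] that b xs in \<open>auto simp: c_def\<close>)
  have start: "exec w (addr 11 6) {} (zeros(0 := length w, 11 := c w))
      (100 * (K * (m + 1) + 1)\<^sup>2) (stage rs 0) (round_state (length w) (c w) 0)"
    if "c w \<le> m" "m > 0" for w m
  proof -
    let ?z = "zeros(0 := length w, 11 := c w)"
    have "?z(1 := pair_code (?z 11) (?z 6)) = round_state (length w) (c w) 0"
      by (auto simp: round_state_def fun_eq_iff)
    then show ?thesis
      using exec_addr[of 11 6 ?z "K * (m + 1)" w "{}"] V[OF that(2,1)] vars_less by simp
  qed
  have sound: "derivable rs (\<lambda>_. True) (c w) 0" if w: "w \<in> lists \<Sigma>" and a: "accepts_within M w t" for w t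
  \<comment> \<open>Without a derivation the pair never enters a stage, so the loop runs for ever.
    The time of a round may depend on the round; only its finiteness matters.\<close>
  proof (rule ccontr)
    assume nd: "\<not> derivable rs (\<lambda>_. True) (c w) 0"
    have "\<exists>\<tau>. runs (round_prog rs) (s w i) \<tau> (s w (Suc i))" for i
      using round[of i "i + c w + 1" w] by (auto simp: exec_def s_def)
    then obtain \<tau> where \<tau>: "\<And>i. runs (round_prog rs) (s w i) (\<tau> i) (s w (Suc i))" by metis
    have "\<not> marked (map read_tape (s w i))" for i
      unfolding s_def marked_round_state using stage_sound nd by blast
    with \<tau> have div: "fst ((prog_step ^^ t) ([Loop (\<lambda>ss. \<not> marked ss) (round_prog rs)], s w 0)) \<noteq> []" for t
      by (intro Loop_diverges) auto
    obtain t1 where t1: "runs (read_prog dig b xs) (rep w {} zeros) t1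
        (rep w {} (zeros(0 := length w, 11 := c w)))"
      using read[OF w, of "c w + 1"] by (auto simp: exec_def)
    obtain t2 where t2: "runs (addr 11 6) (rep w {} (zeros(0 := length w, 11 := c w))) t2 (s w 0)"
      using start[of w "c w + 1"] by (auto simp: exec_def s_def)
    show False
      using Seq_halted_D[OF a[unfolded acc p_def closure_prog_def] runs_init]
      by (auto dest!: Seq_halted_D[OF _ t1] Seq_halted_D[OF _ t2] simp: div)
  qed
  \<comment> \<open>The number of rounds and the bound \<open>V\<close> are both of order
    \<open>N * N\<close>, and a round takes time of order \<open>V ^ 6\<close>; this gives
    \<open>V ^ 7\<close>, hence \<open>N ^ 14\<close>.\<close>
  have complete: "\<exists>t \<le> 3000 * (8 * K) ^ 7 * N ^ 14. accepts_within M w t"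
    if w: "w \<in> lists \<Sigma>" and cN: "c w < N" and lN: "length w < N"
      and d: "derivable rs (\<lambda>x. x < N) (c w) 0" for w N
  proof -
    define m where "m = N + (N * N + 1)"
    define V where "V = K * (m + 1) + 1"
    let ?P = "\<lambda>i. pair_code (c w) 0 \<in> insert 0 (stage rs i)"
    define i where "i = (LEAST i. ?P i)"
    have Pm: "?P m" using stage_complete[OF d] by (simp add: m_def)
    then have Pi: "?P i" and im: "i \<le> m" unfolding i_def by (rule LeastI, rule Least_le)
    have nP: "\<not> ?P j" if "j < i" for j using that not_less_Least unfolding i_def by blast
    have m0: "m > 0" and cm: "c w \<le> m" using cN by (auto simp: m_def)
    have loop: "exec w (Loop (\<lambda>ss. \<not> marked ss) (round_prog rs)) (stage rs 0)
        (round_state (length w) (c w) 0) (i * (2000 * V ^ 6 + 1) + 1)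
        (stage rs i) (round_state (length w) (c w) i)"
      by (rule exec_Loop_upto[where b = "\<lambda>ss. \<not> marked ss" and E = "stage rs"
            and \<sigma> = "round_state (length w) (c w)"])
        (use nP Pi round[OF _ cm] im in \<open>auto simp: marked_round_state V_def\<close>)
    let ?T = "length w * (100 * V\<^sup>2) + 1 + (100 * V\<^sup>2 + (i * (2000 * V ^ 6 + 1) + 1) + 1) + 1"
    have "exec w (Seq (read_prog dig b xs) (Seq (addr 11 6)
        (Loop (\<lambda>ss. \<not> marked ss) (round_prog rs)))) {} zeros ?T
        (stage rs i) (round_state (length w) (c w) i)"
      by (rule exec_Seq[OF read[OF w cm m0, folded V_def]
            exec_Seq[OF start[OF cm m0, folded V_def] loop]])
    then obtain t where t: "t \<le> ?T" and "runs (Seq (read_prog dig b xs) (Seq (addr 11 6)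
        (Loop (\<lambda>ss. \<not> marked ss) (round_prog rs)))) (rep w {} zeros) t (s w i)"
      by (auto simp: exec_def s_def)
    from runs_halted[OF runs_Seq[OF runs_init this(2)]]
    have "accepts_within M w (Suc (1 + t))" by (simp only: acc p_def closure_prog_def)
    moreover have "Suc (1 + t) \<le> 3000 * (8 * K) ^ 7 * N ^ 14"
    proof -
      have N1: "N \<ge> 1" using cN by simp
      have NN: "N \<le> N * N" "1 \<le> N * N" using N1 by auto
      have K1: "K \<ge> 1" by (simp add: K_def)
      have mV: "m + 1 \<le> V" using mult_le_mono1[OF K1, of "m + 1"] by (simp add: V_def)
      have iV: "i \<le> V" and lV: "length w \<le> V" and V1: "V \<ge> 1"
        using im mV lN by (auto simp: m_def)
      have p: "V\<^sup>2 \<le> V ^ 6" "V ^ 6 \<ge> 1" "V ^ 6 \<le> V ^ 7" "V \<le> V ^ 7"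
        using V1 power_increasing[of 2 6 V] power_increasing[of 6 7 V] power_increasing[of 1 7 V] by auto
      have "length w * (100 * V\<^sup>2) \<le> V * (100 * V ^ 6)" by (intro mult_le_mono) (use lV p in auto)
      also have "\<dots> = 100 * V ^ 7" using power_Suc[of V 6] by simp
      finally have 1: "length w * (100 * V\<^sup>2) \<le> 100 * V ^ 7" .
      have "i * (2000 * V ^ 6 + 1) \<le> V * (2000 * V ^ 6 + 1)" by (rule mult_le_mono1[OF iV])
      also have "\<dots> = 2000 * V ^ 7 + V" using power_Suc[of V 6] by (simp add: distrib_left)
      finally have 2: "i * (2000 * V ^ 6 + 1) \<le> 2000 * V ^ 7 + V" .
      have "Suc (1 + t) \<le> 3000 * V ^ 7" using t 1 2 p by linarith
      also have "V \<le> 8 * K * (N * N)"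
      proof -
        have "V \<le> K * (m + 1) + K" using K1 by (simp add: V_def)
        also have "\<dots> = K * (N + N * N + 3)" by (simp add: m_def algebra_simps)
        also have "\<dots> \<le> K * (8 * (N * N))" by (rule mult_le_mono2) (use NN in linarith)
        finally show ?thesis by simp
      qed
      then have "V ^ 7 \<le> (8 * K * (N * N)) ^ 7" by (rule power_mono) simp
      also have "\<dots> = (8 * K) ^ 7 * N ^ 14"
        by (simp only: power_mult_distrib power2_eq_square[symmetric] power_mult[symmetric]) simp
      finally show ?thesis by simp
    qed
    ultimately show ?thesis by blast
  qed
  show ?thesis
    using M sound complete unfolding c_def by blast
qed

section \<open>Words and reduced words\<close>

lemma inv_letter_inv [simp]: "inv_letter (inv_letter x) = x"
  by (simp add: inv_letter_def)

lemma inv_letter_in [simp]: "inv_letter x \<in> letters A \<longleftrightarrow> x \<in> letters A"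
  by (auto simp: inv_letter_def letters_def mem_Times_iff)

lemma inv_word_Nil [simp]: "inv_word [] = []"
  by (simp add: inv_word_def)

lemma inv_word_Cons [simp]: "inv_word (x # w) = inv_word w @ [inv_letter x]"
  by (simp add: inv_word_def)

lemma inv_word_append [simp]: "inv_word (u @ v) = inv_word v @ inv_word u"
  by (simp add: inv_word_def)

lemma inv_word_inv [simp]: "inv_word (inv_word w) = w"
  by (induction w) auto

lemma length_inv_word [simp]: "length (inv_word w) = length w"
  by (simp add: inv_word_def)

lemma set_inv_word [simp]: "set (inv_word w) = inv_letter ` set w"
  by (simp add: inv_word_def)

lemma inv_word_in [simp]: "inv_word w \<in> words A \<longleftrightarrow> w \<in> words A"
  by (induction w) auto

lemma pres_eq_refl [simp]: "pres_eq A R u u"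
  by (simp add: pres_eq_def)

lemma pres_eq_sym: "pres_eq A R u v \<Longrightarrow> pres_eq A R v u"
  unfolding pres_eq_def by (rule equivclp_sym)

lemma pres_eq_trans [trans]: "pres_eq A R u v \<Longrightarrow> pres_eq A R v w \<Longrightarrow> pres_eq A R u w"
  unfolding pres_eq_def by (rule equivclp_trans)

lemma pres_eq_step: "pres_step A R u v \<Longrightarrow> pres_eq A R u v"
  unfolding pres_eq_def by (rule r_into_equivclp)

lemma pres_eq_invariant:
  assumes "pres_eq A R u v" "\<And>u v. pres_step A R u v \<Longrightarrow> f u = f v"
  shows "f u = f v"
  using assms(1) unfolding pres_eq_def
  by (induction rule: equivclp_induct) (auto dest: assms(2))

lemma pres_step_context:
  assumes "pres_step A R u v" "p \<in> words A" "q \<in> words A"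
  shows "pres_step A R (p @ u @ q) (p @ v @ q)"
  using assms(1)
proof cases
  case (cancel u' v' x)
  then show ?thesis
    using pres_step.cancel[of "p @ u'" A "v' @ q" x R] assms by simp
next
  case (relator u' v' r)
  then show ?thesis
    using pres_step.relator[of "p @ u'" A "v' @ q" r R] assms by simp
qed

lemma pres_eq_context:
  assumes "pres_eq A R u v" "p \<in> words A" "q \<in> words A"
  shows "pres_eq A R (p @ u @ q) (p @ v @ q)"
  using assms(1) unfolding pres_eq_def
proof (induction rule: equivclp_induct)
  case (step y z)
  then show ?case
    using pres_step_context[OF _ assms(2,3)]
    by (meson equivclp_sym equivclp_trans r_into_equivclp)
qed simp

lemma pres_eq_append:
  assumes "pres_eq A R u u'" "pres_eq A R v v'" "u' \<in> words A" "v \<in> words A"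
  shows "pres_eq A R (u @ v) (u' @ v')"
  using pres_eq_context[OF assms(1), of "[]" v] pres_eq_context[OF assms(2), of u' "[]"] assms(3,4)
  by (auto intro: pres_eq_trans)

lemma free_imp_pres_eq:
  assumes "free_eq A u v" shows "pres_eq A R u v"
  using assms unfolding pres_eq_def
proof (induction rule: equivclp_induct)
  case (step y z)
  have "pres_step A {} y z \<Longrightarrow> pres_step A R y z" for y z
    by (auto elim!: pres_step.cases intro: pres_step.cancel)
  with step show ?case
    by (meson equivclp_sym equivclp_trans r_into_equivclp)
qed simp

lemma pres_eq_cancel:
  assumes "u \<in> words A" "v \<in> words A" "x \<in> letters A"
  shows "pres_eq A R (u @ [x, inv_letter x] @ v) (u @ v)"
  using pres_eq_step[OF pres_step.cancel] assms by blast

lemma pres_eq_right_inverse: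
  assumes "w \<in> words A" shows "pres_eq A R (w @ inv_word w) []"
  using assms
proof (induction w rule: rev_induct)
  case (snoc x w)
  have "pres_eq A R (w @ [x, inv_letter x] @ inv_word w) (w @ inv_word w)"
    by (rule pres_eq_cancel) (use snoc in auto)
  then show ?case using snoc by (auto intro: pres_eq_trans)
qed simp

lemma pres_eq_left_inverse:
  assumes "w \<in> words A" shows "pres_eq A R (inv_word w @ w) []"
  using pres_eq_right_inverse[of "inv_word w" A R] assms by simp

lemma pres_eq_relator:
  assumes R: "R \<subseteq> words A" and r: "r \<in> sym_relators R"
  shows "pres_eq A R r []"
proof -
  have *: "pres_eq A R r []" if "r \<in> R" for r
    using pres_eq_step[OF pres_step.relator[of "[]" A "[]" r R]] that by simp
  show ?thesis
  proof (cases "r \<in> R")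
    case False
    then obtain s where s: "s \<in> R" "r = inv_word s" using r by (auto simp: sym_relators_def)
    have "pres_eq A R (inv_word s @ s) (inv_word s)"
      using pres_eq_context[OF *[OF s(1)], of "inv_word s" "[]"] s R by auto
    moreover have "pres_eq A R (inv_word s @ s) []"
      using pres_eq_left_inverse s R by blast
    ultimately show ?thesis using s by (auto intro: pres_eq_trans pres_eq_sym)
  qed (rule *)
qed

lemma sym_relators_words: "R \<subseteq> words A \<Longrightarrow> r \<in> sym_relators R \<Longrightarrow> r \<in> words A"
  unfolding sym_relators_def by (metis UnE imageE inv_word_in subsetD)

lemma pres_eq_conj_word:
  assumes "R \<subseteq> words A" "r \<in> sym_relators R" "x \<in> words A"
  shows "pres_eq A R (conj_word r x) []"
proof -
  have "pres_eq A R (inv_word x @ r @ x) (inv_word x @ [] @ x)"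
    by (rule pres_eq_context) (use assms pres_eq_relator in auto)
  also have "pres_eq A R (inv_word x @ [] @ x) []"
    using pres_eq_left_inverse assms by simp
  finally show ?thesis by (simp add: conj_word_def)
qed

section \<open>Free reduction on a stack\<close>

fun push :: "'a letter \<Rightarrow> 'a word \<Rightarrow> 'a word" where
  "push x [] = [x]"
| "push x (y # ys) = (if y = inv_letter x then ys else x # y # ys)"

text \<open>The reduced word is kept as a stack, so that its last letter comes first.\<close>

definition reduce :: "'a word \<Rightarrow> 'a word" where
  "reduce w = rev (fold push w [])"

fun reduced :: "'a word \<Rightarrow> bool" where
  "reduced (x # y # ys) \<longleftrightarrow> y \<noteq> inv_letter x \<and> reduced (y # ys)"
| "reduced _ \<longleftrightarrow> True"

lemma reduced_tl: "reduced (x # xs) \<Longrightarrow> reduced xs"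
  by (cases xs) auto

lemma reduced_push: "reduced st \<Longrightarrow> reduced (push x st)"
  by (cases st) (auto dest: reduced_tl)

lemma reduced_fold_push: "reduced st \<Longrightarrow> reduced (fold push w st)"
  by (induction w arbitrary: st) (auto intro: reduced_push)

text \<open>Reducedness matters when the first push removes a top \<open>inv_letter x\<close>: the
  letter below it is not \<open>x\<close>, so the second push restores the top instead of removing
  another letter.\<close>

lemma push_cancel: "reduced st \<Longrightarrow> push (inv_letter x) (push x st) = st"
  by (cases st rule: reduced.cases) auto

text \<open>Letters act on reduced stacks as bijections, and inverse letters as their inverses (van
  der Waerden's argument). So a cancelled pair has no effect, which replaces a proof of
  confluence.\<close>

lemma reduce_free_eq:
  assumes "free_eq A u v" shows "reduce u = reduce v"
proof (rule pres_eq_invariant[OF assms])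
  fix u v :: "'a word"
  assume "pres_step A {} u v"
  then show "reduce u = reduce v"
    by cases (auto simp: reduce_def push_cancel reduced_fold_push)
qed

lemma free_eq_reduce:
  assumes "w \<in> words A" shows "free_eq A w (reduce w)"
proof -
  have "free_eq A (rev st @ w) (rev (fold push w st))" if "st \<in> words A" for st
    using that assms
  proof (induction w arbitrary: st)
    case (Cons x w)
    have push: "push x st \<in> words A" using Cons.prems by (cases st) auto
    have "free_eq A (rev st @ x # w) (rev (push x st) @ w)"
    proof (cases "\<exists>ys. st = inv_letter x # ys")
      case True
      then obtain ys where "st = inv_letter x # ys" by blast
      moreover have "rev ys \<in> words A" using calculation Cons.prems by auto
      ultimately show ?thesis
        using pres_eq_cancel[of "rev ys" A w "inv_letter x" "{}"] Cons.prems by simp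
    next
      case False
      then have "push x st = x # st" by (cases st) auto
      then show ?thesis by simp
    qed
    also have "free_eq A (rev (push x st) @ w) (rev (fold push w (push x st)))"
      by (rule Cons.IH) (use push Cons.prems in auto)
    finally show ?case by simp
  qed simp
  from this[of "[]"] show ?thesis by (simp add: reduce_def)
qed

section \<open>Coset enumeration in a ball\<close>

lemma num_code_append: "num_code dig b (u @ v) = b ^ length v * num_code dig b u + num_code dig b v"
proof (induction v rule: rev_induct)
  case (snoc x v)
  then show ?case unfolding append_assoc[symmetric] num_code_snoc by (simp add: algebra_simps)
qed simp

text \<open>0 is not a digit; otherwise leading zeros would give words of different lengths the same
  code.\<close>

definition digits :: "'a set \<Rightarrow> ('a letter \<Rightarrow> nat) \<Rightarrow> nat \<Rightarrow> bool" where
  "digits A dig b \<longleftrightarrow> inj_on dig (letters A) \<and> (\<forall>x\<in>letters A. 0 < dig x \<and> dig x < b)"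

lemma num_code_less:
  assumes "digits A dig b" "w \<in> words A" shows "num_code dig b w < b ^ length w"
  using assms(2)
proof (induction w rule: rev_induct)
  case (snoc x w)
  then have "num_code dig b w + 1 \<le> b ^ length w" and x: "dig x < b"
    using assms(1) by (auto simp: digits_def)
  then have "b * (num_code dig b w + 1) \<le> b * b ^ length w" by (intro mult_le_mono2)
  then show ?case using x by (simp add: algebra_simps)
qed simp

lemma num_code_inject:
  assumes d: "digits A dig b" and "u \<in> words A" "v \<in> words A"
    and "num_code dig b u = num_code dig b v"
  shows "u = v"
  using assms(2-)
proof (induction u arbitrary: v rule: rev_induct)
  case Nil
  then show ?case using d by (cases v rule: rev_cases) (auto simp: digits_def)
next
  case (snoc x u)
  have x: "0 < dig x" "dig x < b" "x \<in> letters A" using snoc.prems d by (auto simp: digits_def)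
  show ?case
  proof (cases v rule: rev_cases)
    case Nil
    then show ?thesis using snoc.prems x by simp
  next
    case (snoc v' y)
    have y: "dig y < b" "y \<in> letters A" using snoc.prems(2) snoc d by (auto simp: digits_def)
    have eq: "b * num_code dig b u + dig x = b * num_code dig b v' + dig y"
      using snoc.prems(3) snoc by simp
    have "dig x = (b * num_code dig b u + dig x) mod b" using x by simp
    also have "\<dots> = dig y" unfolding eq using y by simp
    finally have dxy: "dig x = dig y" .
    then have "x = y" using x y d by (auto simp: digits_def dest: inj_onD)
    moreover have "num_code dig b u = num_code dig b v'" using eq dxy x by simp
    ultimately show ?thesis using snoc.IH[of v'] snoc.prems snoc by simp
  qed
qed

text \<open>Generators of a right congruence: a letter is appended on both sides, an inverse pair or
  a relator on the left side only. A relator inside a word is reached by appending it first and the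
  rest of the word afterwards.\<close>

definition coset_rules :: "('a letter \<Rightarrow> nat) \<Rightarrow> nat \<Rightarrow> 'a letter list \<Rightarrow> 'a word list \<Rightarrow> rule list"
where
  "coset_rules dig b ls rels =
    map (\<lambda>x. (b, dig x, b, dig x)) ls @
    map (\<lambda>x. (b * b, b * dig x + dig (inv_letter x), 1, 0)) ls @
    map (\<lambda>r. (b ^ length r, num_code dig b r, 1, 0)) rels"

lemma coset_rules_sound:
  assumes R: "R \<subseteq> words A" and ls: "set ls = letters A" and rels: "set rels = sym_relators R"
    and d: "derivable (coset_rules dig b ls rels) P m n" and dig: "digits A dig b"
  shows "\<exists>u v. u \<in> words A \<and> v \<in> words A \<and> m = num_code dig b u \<and> n = num_code dig b v
    \<and> pres_eq A R u v"
  using d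
proof (induction rule: derivable.induct)
  case base
  then show ?case by (intro exI[of _ "[]"]) simp
next
  case (rule m n k c k' c')
  then obtain u v where uv: "u \<in> words A" "v \<in> words A" "m = num_code dig b u"
    "n = num_code dig b v" "pres_eq A R u v" by blast
  consider (snoc) x where "x \<in> letters A" "k = b" "c = dig x" "k' = b" "c' = dig x"
    | (cancel) x where "x \<in> letters A" "k = b * b" "c = b * dig x + dig (inv_letter x)" "k' = 1" "c' = 0"
    | (rel) r where "r \<in> sym_relators R" "k = b ^ length r" "c = num_code dig b r" "k' = 1" "c' = 0"
    using rule.hyps(2) ls rels unfolding coset_rules_def by auto
  then show ?case
  proof cases
    case snoc
    then have "pres_eq A R (u @ [x]) (v @ [x])"
      using pres_eq_append[OF uv(5), of "[x]" "[x]"] uv by simp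
    then show ?thesis using snoc uv by (intro exI[of _ "u @ [x]"] exI[of _ "v @ [x]"]) simp
  next
    case cancel
    then have "pres_eq A R (u @ [x, inv_letter x]) u"
      using pres_eq_cancel[of u A "[]" x R] uv by simp
    then have "pres_eq A R (u @ [x, inv_letter x]) v" using uv(5) by (rule pres_eq_trans)
    moreover have "num_code dig b (u @ [x, inv_letter x]) = k * m + c"
      using num_code_append[of dig b u "[x, inv_letter x]"] num_code_snoc[of dig b "[x]" "inv_letter x"]
        num_code_snoc[of dig b "[]" x] cancel uv by simp
    ultimately show ?thesis using cancel uv
      by (intro exI[of _ "u @ [x, inv_letter x]"] exI[of _ v]) simp
  next
    case rel
    then have "r \<in> words A" using sym_relators_words R by blast
    then have "pres_eq A R (u @ r) (v @ [])"
      using pres_eq_append[OF uv(5) pres_eq_relator[OF R rel(1)]] uv by simp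
    then show ?thesis using rel uv \<open>r \<in> words A\<close>
      by (intro exI[of _ "u @ r"] exI[of _ v]) (simp add: num_code_append)
  qed
next
  case (join m n k)
  \<comment> \<open>The middle number comes with one word from each premise; injectivity of the
    coding identifies them.\<close>
  then show ?case using num_code_inject[OF dig] by (metis pres_eq_sym pres_eq_trans)
qed

locale ball =
  fixes A :: "'a set" and R :: "'a word set" and dig :: "'a letter \<Rightarrow> nat" and b L :: nat
    and ls :: "'a letter list" and rels :: "'a word list"
  assumes R: "R \<subseteq> words A" and ls: "set ls = letters A" and rels: "set rels = sym_relators R"
    and dig: "digits A dig b" and b: "b \<ge> 1"
begin

definition linked :: "'a word \<Rightarrow> 'a word \<Rightarrow> bool" where
  "linked u v \<longleftrightarrow> u \<in> words A \<and> v \<in> words A \<and> length u \<le> L \<and> length v \<le> L \<and>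
    derivable (coset_rules dig b ls rels) (\<lambda>x. x < b ^ L) (num_code dig b u) (num_code dig b v)"

lemma code_bound: "u \<in> words A \<Longrightarrow> length u \<le> L \<Longrightarrow> num_code dig b u < b ^ L"
  using num_code_less[OF dig, of u] power_increasing[of "length u" L b] b by fastforce

lemma linkedD: "linked u v \<Longrightarrow> u \<in> words A \<and> v \<in> words A \<and> length u \<le> L \<and> length v \<le> L"
  by (simp add: linked_def)

lemma linked_rule:
  assumes uv: "linked u v" and r: "(k, c, k', c') \<in> set (coset_rules dig b ls rels)"
    and u': "u' \<in> words A" "length u' \<le> L" "num_code dig b u' = k * num_code dig b u + c"
    and v': "v' \<in> words A" "length v' \<le> L" "num_code dig b v' = k' * num_code dig b v + c'"
  shows "linked u' v'"
proof -
  have "derivable (coset_rules dig b ls rels) (\<lambda>x. x < b ^ L)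
      (k * num_code dig b u + c) (k' * num_code dig b v + c')"
    using uv[unfolded linked_def] r code_bound[OF u'(1,2)] code_bound[OF v'(1,2)]
    unfolding u'(3) v'(3) by (intro derivable.rule) auto
  then show ?thesis using u' v' by (simp add: linked_def)
qed

lemma linked_snoc:
  assumes "linked u v" "length u < L" "length v < L" "x \<in> letters A"
  shows "linked (u @ [x]) (v @ [x])"
  by (rule linked_rule[OF assms(1), of b "dig x" b "dig x"])
    (use assms ls linkedD[OF assms(1)] in \<open>auto simp: coset_rules_def\<close>)

lemma linked_refl: "u \<in> words A \<Longrightarrow> length u \<le> L \<Longrightarrow> linked u u"
proof (induction u rule: rev_induct)
  case Nil
  then show ?case using derivable.base[of "\<lambda>x. x < b ^ L"] b by (simp add: linked_def)
qed (auto intro: linked_snoc)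

lemma linked_join: "linked u v \<Longrightarrow> linked z v \<Longrightarrow> linked u z"
  by (auto simp: linked_def intro: derivable.join)

lemma linked_sym: "linked u v \<Longrightarrow> linked v u"
  using linked_join linked_refl linkedD by blast

lemma linked_trans: "linked u v \<Longrightarrow> linked v w \<Longrightarrow> linked u w"
  using linked_join linked_sym by blast

lemma linked_cancel:
  assumes "linked u v" "x \<in> letters A" "length u + 2 \<le> L"
  shows "linked (u @ [x, inv_letter x]) v"
proof (rule linked_rule[OF assms(1), of "b * b" "b * dig x + dig (inv_letter x)" 1 0])
  show "num_code dig b (u @ [x, inv_letter x])
      = b * b * num_code dig b u + (b * dig x + dig (inv_letter x))"
    using num_code_snoc[of dig b "u @ [x]" "inv_letter x"] by (simp add: algebra_simps)
qed (use assms ls linkedD[OF assms(1)] in \<open>auto simp: coset_rules_def\<close>)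

lemma linked_relator:
  assumes "linked u v" "r \<in> sym_relators R" "length u + length r \<le> L"
  shows "linked (u @ r) v"
  by (rule linked_rule[OF assms(1), of "b ^ length r" "num_code dig b r" 1 0])
    (use assms rels linkedD[OF assms(1)] sym_relators_words[OF R assms(2)]
      in \<open>auto simp: coset_rules_def num_code_append\<close>)

text \<open>
  The linkage classes are the vertices of a folded graph; \<open>path u w v\<close> says that the label \<open>w\<close>
  can be read in this graph from the class of \<open>u\<close> to the class of \<open>v\<close>.
\<close>

fun path :: "'a word \<Rightarrow> 'a word \<Rightarrow> 'a word \<Rightarrow> bool" where
  "path u [] v \<longleftrightarrow> linked u v"
| "path u (x # w) v \<longleftrightarrow> (\<exists>u'. linked u u' \<and> length u' + 2 \<le> L \<and> path (u' @ [x]) w v)"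

lemma path_cong: "linked u' u \<Longrightarrow> path u w v \<Longrightarrow> path u' w v"
  by (cases w) (auto intro: linked_trans)

lemma path_append: "path u p z \<Longrightarrow> path z q v \<Longrightarrow> path u (p @ q) v"
  by (induction p arbitrary: u) (auto intro: path_cong)

lemma path_source: "path u w v \<Longrightarrow> u \<in> words A \<and> length u \<le> L"
  by (cases w) (auto dest: linkedD)

lemma path_split: "path u (p @ q) v \<Longrightarrow> \<exists>z. path u p z \<and> path z q v"
proof (induction p arbitrary: u)
  case Nil
  then show ?case using path_source linked_refl by fastforce
qed fastforce

text \<open>\<open>linked_snoc\<close> does the folding: linked words with room for one more letter
  have linked extensions.\<close>

lemma path_deterministic: "path u w v \<Longrightarrow> path u' w v' \<Longrightarrow> linked u u' \<Longrightarrow> linked v v'"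
proof (induction w arbitrary: u u')
  case Nil
  then show ?case by (auto intro: linked_trans linked_sym)
next
  case (Cons x w)
  obtain y where y: "linked u y" "length y + 2 \<le> L" "path (y @ [x]) w v" using Cons.prems by auto
  obtain z where z: "linked u' z" "length z + 2 \<le> L" "path (z @ [x]) w v'" using Cons.prems by auto
  have "x \<in> letters A" using path_source[OF y(3)] by simp
  moreover have "linked y z" using y(1) z(1) Cons.prems(3) by (blast intro: linked_trans linked_sym)
  ultimately have "linked (y @ [x]) (z @ [x])" using y z by (intro linked_snoc) auto
  then show ?case using Cons.IH y(3) z(3) by blast
qed

text \<open>The vertices are the prefixes. The last letter is read from a prefix one shorter than
  the whole, so \<open>+ 1\<close> for the whole is the margin \<open>+ 2\<close> of
  \<open>path\<close> there.\<close>

lemma path_extend: "u @ w \<in> words A \<Longrightarrow> length u + length w + 1 \<le> L \<Longrightarrow> path u w (u @ w)"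
proof (induction w arbitrary: u)
  case Nil
  then show ?case by (auto intro: linked_refl)
next
  case (Cons x w)
  then have "path (u @ [x]) w (u @ x # w)" using Cons.IH[of "u @ [x]"] by simp
  moreover have "linked u u" by (rule linked_refl) (use Cons.prems in auto)
  ultimately show ?case using Cons.prems by auto
qed

text \<open>The margin \<open>+ 2\<close> in \<open>path\<close> is made for this: a representative
  with room for two more letters lets \<open>linked_cancel\<close> identify the vertex after the
  pair with the one before it.\<close>

lemma path_cancel:
  assumes "path u (x # inv_letter x # w) v" shows "path u w v"
proof -
  obtain y where y: "linked u y" "length y + 2 \<le> L" "path (y @ [x]) (inv_letter x # w) v"
    using assms by (auto simp del: path.simps(2)[of _ "inv_letter x"])
  then obtain z where z: "linked (y @ [x]) z" "length z + 2 \<le> L" "path (z @ [inv_letter x]) w v"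
    by auto
  have x: "x \<in> letters A" using path_source[OF y(3)] by simp
  have "linked (y @ [x, inv_letter x]) (z @ [inv_letter x])"
    using linked_snoc[OF z(1), of "inv_letter x"] y(2) z(2) x by simp
  moreover have "linked (y @ [x, inv_letter x]) u"
    by (rule linked_cancel[OF linked_trans]) (use y x linked_sym linked_refl linkedD[OF y(1)] in auto)
  ultimately have "linked u (z @ [inv_letter x])" by (blast intro: linked_trans linked_sym)
  then show ?thesis using z(3) by (rule path_cong)
qed

text \<open>Appending \<open>x\<close> to \<open>u @ inv_word x\<close> would need room for twice
  its length. Cancelling at every letter retraces the prefixes instead, so room for one copy
  suffices.\<close>

lemma path_back:
  assumes "u \<in> words A" "x \<in> words A" "length u + length x + 2 \<le> L"
  shows "path (u @ inv_word x) x u"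
  using assms(2,3)
proof (induction x rule: list.induct)
  case Nil
  then show ?case using assms(1) by (auto intro: linked_refl)
next
  case (Cons y x)
  let ?v = "u @ inv_word x"
  have xA: "y \<in> letters A" "x \<in> words A" using Cons.prems(1) by simp_all
  have v: "linked ?v ?v" by (rule linked_refl) (use Cons.prems(2) xA assms(1) in simp_all)
  have "linked (?v @ [inv_letter y, inv_letter (inv_letter y)]) ?v"
    by (rule linked_cancel[OF v]) (use Cons.prems(2) xA in simp_all)
  then have "path (?v @ [inv_letter y] @ [y]) x u"
    using Cons by (auto intro: path_cong)
  moreover have "linked (?v @ [inv_letter y]) (?v @ [inv_letter y])"
    by (rule linked_refl) (use Cons.prems(2) xA assms(1) in simp_all)
  ultimately show ?case using Cons.prems(2) by auto
qed

text \<open>The path goes out along \<open>inv_word x\<close>, where \<open>linked_relator\<close>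
  closes up \<open>r\<close>, and retraces its way by \<open>path_back\<close>.\<close>

lemma path_conj_word:
  assumes r: "r \<in> sym_relators R" and x: "x \<in> words A" and L: "length x + length r + 2 \<le> L"
  shows "path [] (conj_word r x) []"
proof -
  have rA: "r \<in> words A" by (rule sym_relators_words[OF R r])
  have "path [] (inv_word x) ([] @ inv_word x)"
    by (rule path_extend) (use x L in auto)
  moreover have "path (inv_word x) r (inv_word x @ r)"
    by (rule path_extend) (use x rA L in auto)
  moreover have "path (inv_word x @ r) x []"
  proof (rule path_cong)
    show "linked (inv_word x @ r) (inv_word x)"
      by (rule linked_relator[OF linked_refl r]) (use x L in auto)
    show "path (inv_word x) x []" using path_back[of "[]" x] x L by simp
  qed
  ultimately show ?thesis unfolding conj_word_def by (auto intro: path_append)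
qed

lemma path_concat:
  assumes "\<And>w. w \<in> set ws \<Longrightarrow> path [] w []" shows "path [] (concat ws) []"
  using assms
proof (induction ws)
  case Nil
  then show ?case by (auto intro: linked_refl)
qed (auto intro: path_append)

text \<open>Cancelling keeps a path inside the ball, whereas inserting inverse pairs could leave it.
  Freely equal words are therefore compared through their common reduced form and not along a chain
  of elementary steps.\<close>

lemma path_reduce:
  assumes "path u w v" shows "path u (reduce w) v"
proof -
  have "path u (rev (fold push w st)) v" if "path u (rev st @ w) v" for st
    using that
  proof (induction w arbitrary: st)
    case (Cons x w)
    have "path u (rev (push x st) @ w) v"
    proof (cases "\<exists>ys. st = inv_letter x # ys")
      case True
      then obtain ys where ys: "st = inv_letter x # ys" by blast
      then have "path u (rev ys @ (inv_letter x # inv_letter (inv_letter x) # w)) v"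
        using Cons.prems by simp
      then obtain z where "path u (rev ys) z" "path z (inv_letter x # inv_letter (inv_letter x) # w) v"
        using path_split by blast
      then have "path u (rev ys @ w) v" by (blast intro: path_append path_cancel)
      then show ?thesis by (simp add: ys)
    next
      case False
      then have "push x st = x # st" by (cases st) auto
      then show ?thesis using Cons.prems by simp
    qed
    then show ?case by (simp add: Cons.IH)
  qed simp
  from this[of "[]"] show ?thesis using assms by (simp add: reduce_def)
qed

text \<open>From \<open>[]\<close>, the word \<open>w\<close> leads to \<open>w\<close> and the
  product of conjugates leads to \<open>[]\<close>. Both have the same reduced form, and its end
  point is unique.\<close>

lemma linked_complete:
  assumes w: "w \<in> words A" "length w + 1 \<le> L"
    and ps: "\<forall>(r, x) \<in> set ps. r \<in> sym_relators R \<and> x \<in> words A \<and> length x + length r + 2 \<le> L"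
    and eq: "free_eq A w (concat (map (\<lambda>(r, x). conj_word r x) ps))"
  shows "linked w []"
proof -
  let ?P = "concat (map (\<lambda>(r, x). conj_word r x) ps)"
  have "path [] w ([] @ w)" by (rule path_extend) (use w in auto)
  then have 1: "path [] (reduce w) w" using path_reduce by simp
  have "path [] ?P []" by (rule path_concat) (use ps path_conj_word in fastforce)
  then have 2: "path [] (reduce w) []" using path_reduce reduce_free_eq[OF eq] by metis
  show ?thesis by (rule path_deterministic[OF 1 2]) (rule linked_refl, auto)
qed

end

section \<open>Counting traversals of an edge of the Cayley graph\<close>

text \<open>
  The signed number of times the path labelled \<open>w\<close> from the vertex \<open>p\<close> of the Cayley graph of
  \<open>\<langle>A; R\<rangle>\<close> traverses the edge labelled \<open>x\<close> from the vertex \<open>g\<close>.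
\<close>

fun crossings :: "'a set \<Rightarrow> 'a word set \<Rightarrow> 'a word \<Rightarrow> 'a letter \<Rightarrow> 'a word \<Rightarrow> 'a word \<Rightarrow> int" where
  "crossings A R g x p [] = 0"
| "crossings A R g x p (y # w) =
    (if pres_eq A R p g \<and> y = x then 1 else 0)
    - (if pres_eq A R p (g @ [x]) \<and> y = inv_letter x then 1 else 0)
    + crossings A R g x (p @ [y]) w"

lemma crossings_append:
  "crossings A R g x p (u @ v) = crossings A R g x p u + crossings A R g x (p @ u) v"
  by (induction u arbitrary: p) auto

lemma crossings_cong:
  assumes "pres_eq A R p q" "w \<in> words A"
  shows "crossings A R g x p w = crossings A R g x q w"
  using assms
proof (induction w arbitrary: p q rule: list.induct)
  case (Cons y w)
  have "pres_eq A R p z \<longleftrightarrow> pres_eq A R q z" for z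
    using Cons.prems(1) by (blast intro: pres_eq_trans pres_eq_sym)
  moreover have "pres_eq A R (p @ [y]) (q @ [y])"
    using pres_eq_context[OF Cons.prems(1), of "[]" "[y]"] Cons.prems(2) by simp
  ultimately show ?case using Cons.IH Cons.prems(2) by simp
qed simp

lemma pres_eq_snoc_iff:
  assumes "p \<in> words A" "g \<in> words A" "y \<in> letters A"
  shows "pres_eq A R (p @ [y]) g \<longleftrightarrow> pres_eq A R p (g @ [inv_letter y])"
proof
  assume "pres_eq A R (p @ [y]) g"
  then have "pres_eq A R (p @ [y, inv_letter y]) (g @ [inv_letter y])"
    using pres_eq_context[of A R "p @ [y]" g "[]" "[inv_letter y]"] assms by simp
  moreover have "pres_eq A R (p @ [y, inv_letter y]) p"
    using pres_eq_cancel[of p A "[]" y R] assms by simp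
  ultimately show "pres_eq A R p (g @ [inv_letter y])" by (blast intro: pres_eq_trans pres_eq_sym)
next
  assume "pres_eq A R p (g @ [inv_letter y])"
  then have "pres_eq A R (p @ [y]) (g @ [inv_letter y, y])"
    using pres_eq_context[of A R p "g @ [inv_letter y]" "[]" "[y]"] assms by simp
  moreover have "pres_eq A R (g @ [inv_letter y, y]) g"
    using pres_eq_cancel[of g A "[]" "inv_letter y" R] assms by simp
  ultimately show "pres_eq A R (p @ [y]) g" by (rule pres_eq_trans)
qed

lemma inv_letter_neq: "inv_letter x \<noteq> x"
  by (auto simp: inv_letter_def prod_eq_iff)

text \<open>The two letters traverse one edge in opposite directions and count with opposite signs.
  Even if \<open>x\<close> is an involution in the group, \<open>inv_letter_neq\<close> keeps the
  two terms of the count apart.\<close>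

lemma crossings_cancel:
  assumes "p \<in> words A" "v \<in> words A" "g \<in> words A" "x \<in> letters A" "y \<in> letters A"
  shows "crossings A R g x p (y # inv_letter y # v) = crossings A R g x p v"
proof -
  have "pres_eq A R (p @ [y, inv_letter y]) p"
    using pres_eq_cancel[of p A "[]" y R] assms by simp
  then have "crossings A R g x (p @ [y, inv_letter y]) v = crossings A R g x p v"
    using assms by (intro crossings_cong)
  moreover have "inv_letter y = x \<longleftrightarrow> y = inv_letter x" "inv_letter y = inv_letter x \<longleftrightarrow> y = x"
    by (metis inv_letter_inv)+
  moreover have "pres_eq A R (p @ [x]) (g @ [x]) \<longleftrightarrow> pres_eq A R p g"
  proof
    assume "pres_eq A R (p @ [x]) (g @ [x])"
    then have "pres_eq A R p (g @ [x, inv_letter x])"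
      using pres_eq_snoc_iff[of p A "g @ [x]" x R] assms by simp
    moreover have "pres_eq A R (g @ [x, inv_letter x]) g"
      using pres_eq_cancel[of g A "[]" x R] assms by simp
    ultimately show "pres_eq A R p g" by (rule pres_eq_trans)
  next
    assume "pres_eq A R p g"
    then show "pres_eq A R (p @ [x]) (g @ [x])"
      using pres_eq_context[of A R p g "[]" "[x]"] assms by simp
  qed
  moreover have "pres_eq A R (p @ [inv_letter x]) g \<longleftrightarrow> pres_eq A R p (g @ [x])"
    using pres_eq_snoc_iff[of p A g "inv_letter x" R] assms by simp
  moreover have "inv_letter x \<noteq> x" by (rule inv_letter_neq)
  ultimately show ?thesis by (cases "y = x"; cases "y = inv_letter x") simp_all
qed

lemma crossings_free_eq:
  assumes "free_eq A u v" "g \<in> words A" "x \<in> letters A"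
  shows "crossings A R g x [] u = crossings A R g x [] v"
proof (rule pres_eq_invariant[OF assms(1)])
  fix u v
  assume "pres_step A {} u v"
  then show "crossings A R g x [] u = crossings A R g x [] v"
  proof cases
    case (cancel p q y)
    then show ?thesis
      using crossings_cancel[of p A q g x y R] assms by (simp add: crossings_append del: crossings.simps)
  qed simp
qed

lemma crossings_inverse:
  assumes "p \<in> words A" "w \<in> words A" "g \<in> words A" "x \<in> letters A"
  shows "crossings A R g x p w + crossings A R g x (p @ w) (inv_word w) = 0"
  using assms(2)
proof (induction w rule: rev_induct)
  case (snoc y w)
  have "crossings A R g x p ((w @ [y]) @ inv_word (w @ [y]))
      = crossings A R g x p w + crossings A R g x (p @ w) (y # inv_letter y # inv_word w)"
    using crossings_append[of A R g x p w "y # inv_letter y # inv_word w"]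
    by (simp del: crossings.simps)
  also have "\<dots> = crossings A R g x p w + crossings A R g x (p @ w) (inv_word w)"
    by (subst crossings_cancel) (use snoc assms in auto)
  also have "\<dots> = 0" using snoc by simp
  finally show ?case using crossings_append[of A R g x p "w @ [y]" "inv_word (w @ [y])"] by simp
qed simp

lemma pres_eq_left_cancel:
  assumes "pres_eq A R (g @ u) (g @ v)" "g \<in> words A" "u \<in> words A" "v \<in> words A"
  shows "pres_eq A R u v"
proof -
  have *: "pres_eq A R (inv_word g @ g @ w) w" if "w \<in> words A" for w
    using pres_eq_context[OF pres_eq_left_inverse[OF assms(2)], of "[]" w R] that by simp
  have "pres_eq A R (inv_word g @ g @ u) (inv_word g @ g @ v)"
    using pres_eq_context[OF assms(1), of "inv_word g" "[]"] assms(2) by simp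
  then show ?thesis using *[OF assms(3)] *[OF assms(4)] by (blast intro: pres_eq_trans pres_eq_sym)
qed

definition far :: "'a set \<Rightarrow> 'a word set \<Rightarrow> nat \<Rightarrow> 'a word \<Rightarrow> bool" where
  "far A R D g \<longleftrightarrow> (\<forall>u\<in>words A. length u \<le> D \<longrightarrow> \<not> pres_eq A R u g)"

lemma crossings_far:
  assumes far: "far A R D g" and pw: "p \<in> words A" "w \<in> words A" "g \<in> words A" "x \<in> letters A"
    and D: "length p + length w < D"
  shows "crossings A R g x p w = 0"
  using pw(1,2) D
proof (induction w arbitrary: p rule: list.induct)
  case (Cons y w)
  have "\<not> pres_eq A R p g" using far Cons.prems by (auto simp: far_def)
  \<comment> \<open>From the other end of the edge one more letter leads to \<open>g\<close>; hence
    the strict bound by \<open>D\<close>.\<close>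
  moreover have "\<not> pres_eq A R p (g @ [x])"
  proof
    assume "pres_eq A R p (g @ [x])"
    then have "pres_eq A R (p @ [inv_letter x]) g"
      using pres_eq_snoc_iff[of p A g "inv_letter x" R] Cons.prems pw by simp
    moreover have "p @ [inv_letter x] \<in> words A" "length (p @ [inv_letter x]) \<le> D"
      using Cons.prems pw by auto
    ultimately show False using far unfolding far_def by blast
  qed
  moreover have "crossings A R g x (p @ [y]) w = 0"
    by (rule Cons.IH) (use Cons.prems in auto)
  ultimately show ?case by simp
qed simp

text \<open>The ways out and back cancel whatever they traverse, because \<open>r\<close> is trivial
  in the group. Only \<open>r\<close> itself, read from a vertex at distance at most
  \<open>length y\<close>, has to avoid the edge.\<close>

lemma crossings_conj_far:
  assumes R: "R \<subseteq> words A" and far: "far A R D g" and g: "g \<in> words A" "x \<in> letters A"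
    and r: "r \<in> sym_relators R" and y: "y \<in> words A" and D: "length y + length r < D"
    and p: "pres_eq A R p []" "p \<in> words A"
  shows "crossings A R g x p (conj_word r y) = 0"
proof -
  let ?c = "crossings A R g x"
  have rA: "r \<in> words A" by (rule sym_relators_words[OF R r])
  have "?c p (conj_word r y) = ?c [] (conj_word r y)"
    by (rule crossings_cong[OF p(1)]) (use rA y in \<open>auto simp: conj_word_def\<close>)
  also have "\<dots> = ?c [] (inv_word y) + ?c (inv_word y) r + ?c (inv_word y @ r) y"
    by (simp add: conj_word_def crossings_append)
  also have "?c (inv_word y @ r) y = ?c (inv_word y) y"
    by (rule crossings_cong)
      (use pres_eq_context[OF pres_eq_relator[OF R r], of "inv_word y" "[]"] y in auto)
  also have "?c (inv_word y) r = 0"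
    by (rule crossings_far[OF far]) (use y rA g D in auto)
  also have "?c [] (inv_word y) + 0 + ?c (inv_word y) y = 0"
    using crossings_inverse[of "[]" A "inv_word y" g x R] y g by simp
  finally show ?thesis .
qed

lemma crossings_product_far:
  assumes R: "R \<subseteq> words A" and far: "far A R D g" and g: "g \<in> words A" "x \<in> letters A"
    and ps: "\<forall>(r, y) \<in> set ps. r \<in> sym_relators R \<and> y \<in> words A \<and> length y + length r < D"
    and p: "pres_eq A R p []" "p \<in> words A"
  shows "crossings A R g x p (concat (map (\<lambda>(r, y). conj_word r y) ps)) = 0"
  using ps p
proof (induction ps arbitrary: p)
  case (Cons ry ps)
  obtain r y where ry: "ry = (r, y)" by force
  then have r: "r \<in> sym_relators R" "y \<in> words A" "length y + length r < D"
    using Cons.prems by auto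
  have "conj_word r y \<in> words A"
    using r sym_relators_words[OF R] by (auto simp: conj_word_def)
  moreover from this have "pres_eq A R (p @ conj_word r y) ([] @ [])"
    by (intro pres_eq_append) (use Cons.prems pres_eq_conj_word[OF R r(1,2)] in auto)
  ultimately have "crossings A R g x (p @ conj_word r y)
      (concat (map (\<lambda>(r, y). conj_word r y) ps)) = 0"
    using Cons by (intro Cons.IH) auto
  moreover have "crossings A R g x p (conj_word r y) = 0"
    by (rule crossings_conj_far[OF R far g r Cons.prems(2,3)])
  ultimately show ?case by (simp add: ry crossings_append)
qed simp

text \<open>
  A shortest word that is trivial in \<open>\<langle>A; R\<rangle>\<close> but not in the free group labels a simple closed
  path, so that it traverses its first edge exactly once.
\<close>

lemma simple_loop_exists:
  assumes R: "R \<subseteq> words A" and r: "r \<in> words A" "pres_eq A R r []" "\<not> free_eq A r []"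
  obtains x w where "x \<in> letters A" "w \<in> words A" "pres_eq A R (x # w) []"
    and "\<And>g. g \<in> words A \<Longrightarrow> crossings A R g x g (x # w) = 1"
proof -
  let ?P = "\<lambda>w. w \<in> words A \<and> pres_eq A R w [] \<and> \<not> free_eq A w []"
  obtain s where s: "?P s" and min: "\<And>w. ?P w \<Longrightarrow> length s \<le> length w"
    using ex_has_least_nat[of ?P r length] r by blast
  then obtain x w where xw: "s = x # w" by (cases s) auto
  then have x: "x \<in> letters A" and wA: "w \<in> words A" using s by auto
  have short: "free_eq A q []" if "q \<in> words A" "pres_eq A R q []" "length q < length s" for q
    using min[of q] that by auto
  \<comment> \<open>A return to \<open>g\<close> before the end would split \<open>s\<close> into
    two shorter trivial words; by minimality both are freely trivial, and so would be
    \<open>s\<close>.\<close>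
  have no_return: "\<not> pres_eq A R (g @ [x] @ u) g" if g: "g \<in> words A" and uv: "w = u @ y # v" for g u y v
  proof
    assume eq: "pres_eq A R (g @ [x] @ u) g"
    have words: "[x] @ u \<in> words A" "y # v \<in> words A" using x wA uv by auto
    have 1: "pres_eq A R ([x] @ u) []"
      using pres_eq_left_cancel[of A R g "[x] @ u" "[]"] eq g words by simp
    have "pres_eq A R (([x] @ u) @ (y # v)) ([] @ (y # v))"
      by (rule pres_eq_append[OF 1]) (use words in auto)
    then have 2: "pres_eq A R (y # v) []"
      using s by (simp add: xw uv) (blast intro: pres_eq_trans pres_eq_sym)
    have "free_eq A (([x] @ u) @ (y # v)) ([] @ [])"
      by (rule pres_eq_append[OF short[OF _ 1] short[OF _ 2]]) (use words in \<open>auto simp: xw uv\<close>)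
    then show False using s by (simp add: xw uv)
  qed
  \<comment> \<open>Traversing the first edge backwards would make \<open>u\<close> trivial, hence
    freely trivial by minimality; then \<open>s\<close> is freely equal to the shorter word
    \<open>v\<close>, which is freely trivial too.\<close>
  have no_backtrack: "\<not> pres_eq A R (g @ [x] @ u) (g @ [x])"
    if g: "g \<in> words A" and uv: "w = u @ inv_letter x # v" for g u v
  proof
    assume eq: "pres_eq A R (g @ [x] @ u) (g @ [x])"
    have words: "u \<in> words A" "v \<in> words A" using wA uv by auto
    have 1: "pres_eq A R u []"
      using pres_eq_left_cancel[of A R "g @ [x]" u "[]"] eq g x words by simp
    have "free_eq A ([x] @ u @ (inv_letter x # v)) ([x] @ [] @ (inv_letter x # v))"
      by (rule pres_eq_context[OF short[OF _ 1]]) (use words x in \<open>auto simp: xw uv\<close>)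
    moreover have "free_eq A ([] @ [x, inv_letter x] @ v) ([] @ v)"
      by (rule pres_eq_cancel) (use words x in auto)
    ultimately have sv: "free_eq A s v"
      by (simp add: xw uv) (blast intro: pres_eq_trans)
    then have "pres_eq A R v []"
      using s free_imp_pres_eq by (blast intro: pres_eq_trans pres_eq_sym)
    then have "free_eq A v []" by (rule short[OF words(2)]) (simp add: xw uv)
    then show False using s sv by (blast intro: pres_eq_trans)
  qed
  have rest: "crossings A R g x (g @ [x] @ u) v = 0" if "g \<in> words A" "w = u @ v" for g u v
    using that(2)
  proof (induction v arbitrary: u)
    case (Cons y v)
    have "crossings A R g x (g @ [x] @ (u @ [y])) v = 0" by (rule Cons.IH) (use Cons.prems in simp)
    then show ?case
      using no_return[OF that(1) Cons.prems] no_backtrack[OF that(1), of u v] Cons.prems by auto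
  qed simp
  have "crossings A R g x g (x # w) = 1" if "g \<in> words A" for g
    using rest[OF that, of "[]" w] inv_letter_neq[of x] by auto
  then show ?thesis using that x wA s xw by blast
qed

section \<open>Machines scanning their input once\<close>

lemma input_tape_nth: "i < length w \<Longrightarrow> fst (input_tape w) (int i) = Input (w ! i)"
  by (simp add: input_tape_def)

lemma input_tape_upd:
  "i < length w \<Longrightarrow> (fst (input_tape w))(int i := Input (w ! i)) = fst (input_tape w)"
  by (simp add: fun_upd_idem input_tape_nth)

text \<open>\<open>T m\<close> is the work tape that stores the memory \<open>m\<close>. Keeping
  \<open>T\<close> abstract lets one construction serve both for a finite memory in a single cell
  and for a stack.\<close>

lemma scan_machine:
  fixes \<Sigma> :: "'b set" and T :: "'m \<Rightarrow> 'b tape"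
  assumes S: "finite S" "Blank \<in> S" "Input ` \<Sigma> \<subseteq> S" "wf_prog S 2 B"
    and init: "T m0 = blank_tape" "I m0"
    and step: "\<And>x m. x \<in> \<Sigma> \<Longrightarrow> I m \<Longrightarrow> I (next x m)"
      "\<And>w i m. w \<in> lists \<Sigma> \<Longrightarrow> i < length w \<Longrightarrow> I m \<Longrightarrow>
        \<exists>t\<le>c. runs B [(fst (input_tape w), int i), T m] t
          [(fst (input_tape w), int (Suc i)), T (next (w ! i) m)]"
  shows "\<exists>M. turing_machine \<Sigma> M \<and> (\<forall>w\<in>lists \<Sigma>.
    (\<forall>t. accepts_within M w t \<longrightarrow> good (read_tape (T (fold next w m0)))) \<and>
    (good (read_tape (T (fold next w m0))) \<longrightarrow> (\<exists>t \<le> (c + 3) * (length w + 1). accepts_within M w t)))"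
proof -
  define scan where "scan = Loop (\<lambda>ss. ss ! 0 \<noteq> Blank) B"
  \<comment> \<open>A loop that ends at once or never turns the symbol under the work head into
    acceptance or divergence.\<close>
  define final where "final = Loop (\<lambda>ss. \<not> good (ss ! 1)) skip"
  have "wf_prog S 2 (Seq scan final)"
    using S(4) by (auto simp: scan_def final_def skip_def idle_def)
  then obtain M where M: "turing_machine \<Sigma> M" and acc: "\<And>w t. accepts_within M w t \<longleftrightarrow>
      fst ((prog_step ^^ t) ([Seq scan final], input_tape w # replicate (2 - 1) blank_tape)) = []"
    using prog_to_machine[of S \<Sigma> 2 "Seq scan final"] S by auto
  have "(\<forall>t. accepts_within M w t \<longrightarrow> good (read_tape (T (fold next w m0)))) \<and>
    (good (read_tape (T (fold next w m0))) \<longrightarrow> (\<exists>t \<le> (c + 3) * (length w + 1). accepts_within M w t))"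
    if w: "w \<in> lists \<Sigma>" for w
  proof -
    define m where "m i = fold next (take i w) m0" for i
    define s where "s i = [(fst (input_tape w), int i), T (m i)]" for i
    have mS: "m (Suc i) = next (w ! i) (m i)" if "i < length w" for i
      using that by (simp add: m_def take_Suc_conv_app_nth)
    have Im: "I (m i)" if "i \<le> length w" for i
      using that
    proof (induction i)
      case (Suc i)
      moreover have "w ! i \<in> \<Sigma>" using Suc.prems w by (auto simp: in_listsD)
      ultimately show ?case using step(1) mS by simp
    qed (simp add: m_def init)
    have "\<exists>t\<le>c. runs B (s i) t (s (Suc i))" if "i < length w" for i
      using step(2)[OF w that Im] that mS by (simp add: s_def)
    then obtain \<tau> where \<tau>: "\<And>i. i < length w \<Longrightarrow> \<tau> i \<le> c \<and> runs B (s i) (\<tau> i) (s (Suc i))"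
      by metis
    have s0: "input_tape w # replicate (2 - 1) blank_tape = s 0"
      by (simp add: s_def m_def init input_tape_def)
    have scan: "runs scan (s 0) ((\<Sum>i<length w. Suc (\<tau> i)) + 1) (s (length w))"
      unfolding scan_def
      by (rule runs_Loop_iterate[of _ "\<lambda>ss. ss ! 0 \<noteq> Blank"])
        (use \<tau> in \<open>auto simp: s_def input_tape_def\<close>)
    have "(\<Sum>i<length w. Suc (\<tau> i)) \<le> (\<Sum>i<length w. Suc c)"
      by (rule sum_mono) (use \<tau> in auto)
    then have time: "(\<Sum>i<length w. Suc (\<tau> i)) \<le> length w * (c + 1)" by simp
    have read: "map read_tape (s (length w)) ! 1 = read_tape (T (fold next w m0))"
      by (simp add: s_def m_def)
    show ?thesis
    proof (intro conjI allI impI)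
      fix t
      assume "accepts_within M w t"
      then obtain t' where t': "fst ((prog_step ^^ t') ([final], s (length w))) = []"
        using Seq_halted_D[OF _ scan] unfolding acc s0 by blast
      show "good (read_tape (T (fold next w m0)))"
      proof (rule ccontr)
        assume bad: "\<not> good (read_tape (T (fold next w m0)))"
        have "runs skip ts 1 ts" for ts :: "'b tape list"
          using runs_Act[of idle ts] by (simp add: skip_def act_tape_idle)
        then have "fst ((prog_step ^^ t') ([final], s (length w))) \<noteq> []"
          unfolding final_def
          by (intro Loop_diverges[where s = "\<lambda>_. s (length w)" and \<tau> = "\<lambda>_. 1"])
            (use bad read in \<open>simp del: nth_map\<close>)
        with t' show False by blast
      qed
    next
      assume "good (read_tape (T (fold next w m0)))"
      then have "runs final (s (length w)) 1 (s (length w))"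
        unfolding final_def
        by (intro runs_Loop_exit[where b = "\<lambda>ss. \<not> good (ss ! 1)"])
          (use read in \<open>simp del: nth_map\<close>)
      from runs_halted[OF runs_Seq[OF scan this]]
      have "accepts_within M w (Suc ((\<Sum>i<length w. Suc (\<tau> i)) + 1 + 1))"
        unfolding acc s0 .
      moreover have "Suc ((\<Sum>i<length w. Suc (\<tau> i)) + 1 + 1) \<le> (c + 3) * (length w + 1)"
        using time by (simp add: algebra_simps)
      ultimately show "\<exists>t \<le> (c + 3) * (length w + 1). accepts_within M w t" by blast
    qed
  qed
  then show ?thesis using M by blast
qed

text \<open>Linear time is paid for by \<open>real n + 1\<close> alone, so \<open>q\<close> may be
  arbitrarily small.\<close>

lemma DTime_linear:
  assumes M: "turing_machine (letters A) M"
    and acc: "\<And>w t. w \<in> words A \<Longrightarrow> accepts_within M w t \<Longrightarrow> w \<in> L"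
    and time: "\<And>w. w \<in> L \<Longrightarrow> \<exists>t \<le> C * (length w + 1). accepts_within M w t" and L: "L \<subseteq> words A"
    and C: "C > 0"
  shows "L \<in> DTime (letters A) (\<lambda>n. max (real n + 1) (q n))"
  unfolding DTime_def mem_Collect_eq
proof (intro exI[of _ M] conjI)
  show "L = machine_language (letters A) M"
    using acc time L unfolding machine_language_def by blast
  have "\<exists>t. real t \<le> real C * max (real (1 * n) + 1) (q (1 * n)) \<and> accepts_within M w t"
    if "w \<in> L" "length w \<le> n" for n w
  proof -
    obtain t where t: "t \<le> C * (length w + 1)" "accepts_within M w t" using time \<open>w \<in> L\<close> by blast
    have "t \<le> C * (n + 1)" using t(1) that(2) by (meson add_le_mono1 mult_le_mono2 order_trans)
    then have "real t \<le> real C * (real n + 1)"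
      by (metis (mono_tags) of_nat_1 of_nat_add of_nat_le_iff of_nat_mult)
    also have "\<dots> \<le> real C * max (real (1 * n) + 1) (q (1 * n))" by (intro mult_left_mono) auto
    finally show ?thesis using t(2) by blast
  qed
  then show "\<exists>c1 c2 c3. 0 < c1 \<and> 0 < c2 \<and> 0 < c3 \<and> (\<forall>n\<ge>c3. \<forall>w\<in>L. length w \<le> n \<longrightarrow>
      (\<exists>t. real t \<le> c1 * max (real (c2 * n) + 1) (q (c2 * n)) \<and> accepts_within M w t))"
    using C by (intro exI[of _ "real C"] exI[of _ "1::nat"]) auto
qed (use M in simp)

lemma finite_letters: "finite A \<Longrightarrow> finite (letters A)"
  by (simp add: letters_def)

text \<open>The classes are represented by words of length at most \<open>D\<close>; a blank cell stands for \<open>[]\<close>.\<close>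

lemma finite_group_DTime:
  assumes fp: "finite_presentation A R"
    and D: "\<And>w. w \<in> words A \<Longrightarrow> \<exists>u\<in>words A. length u \<le> D \<and> pres_eq A R u w"
  shows "word_problem A R \<in> DTime (letters A) (\<lambda>n. max (real n + 1) (q n))"
proof -
  have R: "R \<subseteq> words A" and finA: "finite A" using fp by (auto simp: finite_presentation_def)
  define Q where "Q = {u \<in> words A. length u \<le> D}"
  have finQ: "finite Q"
    using finite_lists_length_le[OF finite_letters[OF finA], of D]
    by (simp add: Q_def lists_eq_set)
  then obtain enc :: "'a word \<Rightarrow> nat" where enc: "inj_on enc Q"
    using finite_imp_inj_to_nat_seg by blast
  define rp where "rp w = (SOME u. u \<in> Q \<and> pres_eq A R u w)" for w
  have rp: "rp w \<in> Q \<and> pres_eq A R (rp w) w" if "w \<in> words A" for w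
    unfolding rp_def by (rule someI_ex) (use D[OF that] in \<open>auto simp: Q_def\<close>)
  define sym where "sym u = (if u = [] then Blank else Work (enc u) :: 'a letter tape_symbol)" for u
  have inj: "inj_on sym Q" using enc by (auto simp: sym_def inj_on_def)
  define des where "des = inv_into Q sym"
  have des: "des (sym u) = u" if "u \<in> Q" for u using that inj by (simp add: des_def)
  define T where "T u = ((\<lambda>_ :: int. Blank)(0 := sym u), 0 :: int)" for u
  \<comment> \<open>The result has to lie in \<open>S\<close> for all pairs of symbols;
    \<open>Blank\<close> is the default for those that never occur.\<close>
  define nxt where "nxt s s' = (case s of Input x \<Rightarrow>
      if x \<in> letters A \<and> des s' \<in> Q then sym (rp (des s' @ [x])) else Blank | _ \<Rightarrow> Blank)" for s s'
  define S where "S = insert Blank (sym ` Q \<union> Input ` letters A)"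
  define B where "B = Act (\<lambda>ss. [(ss ! 0, Move_Right), (nxt (ss ! 0) (ss ! 1), Stay)])"
  have QA: "u \<in> words A" if "u \<in> Q" for u using that by (simp add: Q_def)
  have nxt: "nxt s s' \<in> S" for s s'
    using rp QA by (auto simp: nxt_def S_def split: tape_symbol.split)
  have wfB: "wf_prog S 2 B" using nxt by (auto simp: B_def in_listsD)
  have S: "finite S" "Blank \<in> S" "Input ` letters A \<subseteq> S"
    using finQ finite_letters[OF finA] by (auto simp: S_def)
  have T0: "T [] = blank_tape" by (auto simp: T_def blank_tape_def sym_def)
  have Q0: "[] \<in> Q" by (simp add: Q_def)
  have Q: "rp (u @ [x]) \<in> Q" if "x \<in> letters A" "u \<in> Q" for x u
    using rp that QA by simp
  have step: "\<exists>t\<le>1. runs B [(fst (input_tape w), int i), T u] t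
      [(fst (input_tape w), int (Suc i)), T (rp (u @ [w ! i]))]"
    if w: "w \<in> words A" "i < length w" and u: "u \<in> Q" for w i u
  proof -
    have "w ! i \<in> letters A" using w by (auto simp: in_listsD)
    then show ?thesis
      using runs_Act[of "\<lambda>ss. [(ss ! 0, Move_Right), (nxt (ss ! 0) (ss ! 1), Stay)]"
          "[(fst (input_tape w), int i), T u]"] w u
      by (intro exI[of _ 1])
        (simp add: B_def T_def nxt_def des input_tape_nth input_tape_upd add.commute)
  qed
  define F where "F w = fold (\<lambda>x u. rp (u @ [x])) w []" for w
  obtain M where M: "turing_machine (letters A) M" and acc: "\<And>w. w \<in> words A \<Longrightarrow>
      (\<forall>t. accepts_within M w t \<longrightarrow> pres_eq A R (des (read_tape (T (F w)))) []) \<and>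
      (pres_eq A R (des (read_tape (T (F w)))) [] \<longrightarrow>
        (\<exists>t \<le> (1 + 3) * (length w + 1). accepts_within M w t))"
    using scan_machine[where good = "\<lambda>s. pres_eq A R (des s) []" and I = "\<lambda>u. u \<in> Q",
        OF S wfB T0 Q0 Q step] unfolding F_def by blast
  have fold: "fold (\<lambda>x u. rp (u @ [x])) w u \<in> Q \<and> pres_eq A R (fold (\<lambda>x u. rp (u @ [x])) w u) (u @ w)"
    if "w \<in> words A" "u \<in> Q" for w u
    using that
  proof (induction w arbitrary: u rule: list.induct)
    case (Cons x w)
    have 1: "rp (u @ [x]) \<in> Q" "pres_eq A R (rp (u @ [x])) (u @ [x])"
      using rp QA Cons.prems by auto
    have "pres_eq A R (fold (\<lambda>x u. rp (u @ [x])) w (rp (u @ [x]))) (rp (u @ [x]) @ w)"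
      using Cons.IH 1 Cons.prems by simp
    also have "pres_eq A R (rp (u @ [x]) @ w) (u @ x # w)"
      using pres_eq_context[OF 1(2), of "[]" w] Cons.prems by simp
    finally show ?case using Cons.IH 1 Cons.prems by simp
  qed simp
  have F: "pres_eq A R (des (read_tape (T (F w)))) [] \<longleftrightarrow> pres_eq A R w []" if "w \<in> words A" for w
    using fold[OF that Q0] des by (auto simp: T_def F_def intro: pres_eq_trans pres_eq_sym)
  show ?thesis
    by (rule DTime_linear[OF M, of _ "1 + 3"]) (use acc F in \<open>auto simp only: word_problem_def\<close>)
qed

text \<open>The bottom of the stack is in cell 1 and the head is on the top. With an empty stack the
  head is on the blank cell 0, so a blank signals emptiness.\<close>

definition stack_tape :: "'b list \<Rightarrow> 'b tape" where
  "stack_tape st = (\<lambda>i. if 1 \<le> i \<and> i \<le> int (length st) then Input (rev st ! (nat i - 1)) else Blank,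
    int (length st))"

lemma free_group_DTime:
  assumes fp: "finite_presentation A R" and free: "\<And>w. w \<in> words A \<Longrightarrow> pres_eq A R w [] \<Longrightarrow> free_eq A w []"
  shows "word_problem A R \<in> DTime (letters A) (\<lambda>n. max (real n + 1) (q n))"
proof -
  have finA: "finite A" using fp by (auto simp: finite_presentation_def)
  define S where "S = insert Blank (Input ` letters A)"
  define pop where "pop = Act (\<lambda>ss :: 'a letter tape_symbol list. [(ss ! 0, Move_Right), (Blank, Move_Left)])"
  define shift where "shift = Act (\<lambda>ss :: 'a letter tape_symbol list. [(ss ! 0, Stay), (ss ! 1, Move_Right)])"
  define copy where "copy = Act (\<lambda>ss :: 'a letter tape_symbol list. [(ss ! 0, Move_Right), (ss ! 0, Stay)])"
  define test where "test ss \<longleftrightarrow> (\<exists>x. ss ! 0 = Input x \<and> ss ! 1 = Input (inv_letter x))"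
    for ss :: "'a letter tape_symbol list"
  \<comment> \<open>An action writes before it moves, so a push takes two: \<open>shift\<close> goes
    beyond the top and \<open>copy\<close> writes there.\<close>
  define B where "B = Cond test pop (Seq shift copy)"
  have wfB: "wf_prog S 2 B" by (auto simp: B_def pop_def shift_def copy_def S_def in_listsD)
  have S: "finite S" "Blank \<in> S" "Input ` letters A \<subseteq> S"
    using finite_letters[OF finA] by (auto simp: S_def)
  have T0: "stack_tape [] = blank_tape" by (auto simp: stack_tape_def blank_tape_def)
  have step: "\<exists>t\<le>4. runs B [(fst (input_tape w), int i), stack_tape st] t
      [(fst (input_tape w), int (Suc i)), stack_tape (push (w ! i) st)]"
    if i: "i < length w" for w i and st :: "'a word"
  proof -
    let ?s = "[(fst (input_tape w), int i), stack_tape st]"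
    let ?s' = "[(fst (input_tape w), int (Suc i)), stack_tape (push (w ! i) st)]"
    have in0: "map read_tape ?s ! 0 = Input (w ! i)" using i by (simp add: input_tape_nth)
    have top: "read_tape (stack_tape (y # ys)) = Input y" for y and ys :: "'a word"
      by (simp add: stack_tape_def nth_append nat_add_distrib)
    have topN: "read_tape (stack_tape ([] :: 'a word)) = Blank" by (simp add: stack_tape_def)
    show ?thesis
    proof (cases "\<exists>ys. st = inv_letter (w ! i) # ys")
      case True
      then obtain ys where ys: "st = inv_letter (w ! i) # ys" by blast
      have t: "test (map read_tape ?s)" using in0 top unfolding test_def ys by simp
      have "act_tape (stack_tape st) (Blank, Move_Left) = stack_tape ys"
        by (auto simp: stack_tape_def ys fun_eq_iff nth_append)
      then have "runs pop ?s 1 ?s'"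
        using runs_Act[of "\<lambda>ss. [(ss ! 0, Move_Right), (Blank, Move_Left)]" ?s]
        by (simp add: pop_def ys add.commute)
      then have "runs B ?s (Suc 1) ?s'" unfolding B_def by (intro runs_Cond) (simp only: t if_True)
      then show ?thesis by (intro exI[of _ "Suc 1"]) simp
    next
      case False
      then have push: "push (w ! i) st = w ! i # st" by (cases st) auto
      have t: "\<not> test (map read_tape ?s)"
        using in0 False top topN unfolding test_def by (cases st) auto
      let ?u = "[(fst (input_tape w), int i), (fst (stack_tape st), int (length st) + 1)]"
      define f :: "int \<Rightarrow> 'a letter tape_symbol" where "f = fst (stack_tape st)"
      have "stack_tape st = (f, int (length st))" by (simp add: f_def stack_tape_def)
      then have 1: "runs shift ?s 1 ?u"
        using runs_Act[of "\<lambda>ss. [(ss ! 0, Stay), (ss ! 1, Move_Right)]" ?s]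
        by (simp add: shift_def)
      have "act_tape (fst (stack_tape st), int (length st) + 1) (Input (w ! i), Stay)
          = stack_tape (w ! i # st)"
        by (auto simp: stack_tape_def fun_eq_iff nth_append)
      then have 2: "runs copy ?u 1 ?s'"
        using runs_Act[of "\<lambda>ss. [(ss ! 0, Move_Right), (ss ! 0, Stay)]" ?u] i
        by (simp add: copy_def push input_tape_nth input_tape_upd add.commute)
      have "runs B ?s (Suc (Suc (1 + 1))) ?s'" unfolding B_def
        by (intro runs_Cond) (use runs_Seq[OF 1 2] t in \<open>simp only: if_False\<close>)
      then show ?thesis by (intro exI[of _ "Suc (Suc (1 + 1))"]) simp
    qed
  qed
  obtain M where M: "turing_machine (letters A) M" and acc: "\<And>w. w \<in> words A \<Longrightarrow>
      (\<forall>t. accepts_within M w t \<longrightarrow> read_tape (stack_tape (fold push w [])) = Blank) \<and>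
      (read_tape (stack_tape (fold push w [])) = Blank \<longrightarrow>
        (\<exists>t \<le> (4 + 3) * (length w + 1). accepts_within M w t))"
    using scan_machine[where good = "\<lambda>s. s = Blank" and I = "\<lambda>_. True",
        OF S wfB T0 TrueI TrueI step] by blast
  have empty: "read_tape (stack_tape st) = Blank \<longleftrightarrow> st = []" for st :: "'a word"
    by (cases st) (auto simp: stack_tape_def nth_append)
  have trivial: "fold push w [] = [] \<longleftrightarrow> pres_eq A R w []" if "w \<in> words A" for w
  proof
    assume "fold push w [] = []"
    then have "free_eq A w []" using free_eq_reduce[OF that] by (simp add: reduce_def)
    then show "pres_eq A R w []" by (rule free_imp_pres_eq)
  next
    assume "pres_eq A R w []"
    from reduce_free_eq[OF free[OF that this]] show "fold push w [] = []" by (simp add: reduce_def)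
  qed
  show ?thesis
    by (rule DTime_linear[OF M, of _ "4 + 3"])
      (use acc empty trivial in \<open>auto simp only: word_problem_def\<close>)
qed

section \<open>The isodiametric function of an infinite group\<close>

text \<open>A shortest far word without its last letter is no longer far. Replacing this prefix by a
  word of length at most \<open>D\<close> bounds the shortest length by
  \<open>D + 1\<close>.\<close>

lemma far_shortest:
  assumes R: "R \<subseteq> words A" and g: "g \<in> words A" "far A R D g"
  shows "\<exists>g\<in>words A. far A R D g \<and> length g = D + 1"
proof -
  let ?P = "\<lambda>g. g \<in> words A \<and> far A R D g"
  obtain h where h: "?P h" and min: "\<And>u. ?P u \<Longrightarrow> length h \<le> length u"
    using ex_has_least_nat[of ?P g length] g by blast
  have "length h > D"
    using h by (meson far_def linorder_le_less_linear pres_eq_refl)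
  then obtain h' y where hy: "h = h' @ [y]" by (cases h rule: rev_cases) auto
  have "\<not> ?P h'" using min[of h'] hy by auto
  then obtain u where u: "u \<in> words A" "length u \<le> D" "pres_eq A R u h'"
    using h hy by (auto simp: far_def)
  have "pres_eq A R (u @ [y]) h"
    using pres_eq_context[OF u(3), of "[]" "[y]"] h hy by simp
  then have "far A R D (u @ [y])"
    using h unfolding far_def by (blast intro: pres_eq_trans)
  then have "length h \<le> D + 1" using min[of "u @ [y]"] u h hy by simp
  then show ?thesis using h \<open>length h > D\<close> by (intro bexI[of _ h]) auto
qed

definition fills :: "'a set \<Rightarrow> 'a word set \<Rightarrow> nat \<Rightarrow> 'a word \<Rightarrow> bool" where
  "fills A R k w \<longleftrightarrow> (\<exists>ps.
    (\<forall>(r, x) \<in> set ps. r \<in> sym_relators R \<and> x \<in> words A \<and> length x \<le> k) \<and>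
    free_eq A w (concat (map (\<lambda>(r, x). conj_word r x) ps)))"

text \<open>
  The conjugate of a simple loop by a geodesic word of length \<open>k + \<rho> + 2\<close> traverses an edge
  that no product of short conjugates of relators traverses.
\<close>

lemma isodiametric_lower_bound:
  assumes R: "R \<subseteq> words A" and \<rho>: "\<And>r. r \<in> sym_relators R \<Longrightarrow> length r \<le> \<rho>"
    and g: "g \<in> words A" "far A R (k + \<rho> + 1) g" "length g = k + \<rho> + 2"
    and s: "x \<in> letters A" "s \<in> words A" "pres_eq A R (x # s) []" "crossings A R g x g (x # s) = 1"
    and fills: "\<And>w. w \<in> words A \<Longrightarrow> pres_eq A R w [] \<Longrightarrow> length w \<le> n \<Longrightarrow> fills A R k w"
  shows "n < 2 * (k + \<rho> + 2) + length (x # s)"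
proof (rule ccontr)
  assume n: "\<not> n < 2 * (k + \<rho> + 2) + length (x # s)"
  let ?w = "g @ (x # s) @ inv_word g"
  have "pres_eq A R ?w (g @ [] @ inv_word g)"
    by (rule pres_eq_context[OF s(3)]) (use g in auto)
  also have "pres_eq A R (g @ [] @ inv_word g) []"
    using pres_eq_right_inverse[OF g(1)] by simp
  finally have "fills A R k ?w" by (intro fills) (use g s n in auto)
  then obtain ps where ps: "\<forall>(r, y) \<in> set ps. r \<in> sym_relators R \<and> y \<in> words A \<and> length y \<le> k"
    and eq: "free_eq A ?w (concat (map (\<lambda>(r, x). conj_word r x) ps))"
    unfolding fills_def by blast
  \<comment> \<open>In each factor \<open>length y + length r\<close> is at most
    \<open>k + \<rho>\<close>, just below the radius in \<open>far\<close>.\<close>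
  have "crossings A R g x [] ?w = 0"
    unfolding crossings_free_eq[OF eq g(1) s(1)]
    by (rule crossings_product_far[OF R g(2,1) s(1)]) (use ps \<rho> in fastforce)+
  moreover have "crossings A R g x (g @ (x # s)) (inv_word g) = crossings A R g x g (inv_word g)"
    by (rule crossings_cong) (use pres_eq_context[OF s(3), of g "[]"] g in auto)
  \<comment> \<open>The ways along \<open>g\<close> and back contribute opposite counts, so the
    single traversal by the loop is left over.\<close>
  ultimately have "crossings A R g x [] g + 1 + crossings A R g x g (inv_word g) = 0"
    using s(4) by (simp only: crossings_append append_Nil)
  then show False using crossings_inverse[of "[]" A g g x R] g s(1) by simp
qed

lemma fills_free_eq: "free_eq A u v \<Longrightarrow> fills A R k v \<Longrightarrow> fills A R k u"
  unfolding fills_def by (meson pres_eq_trans)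

lemma free_eq_padding:
  assumes "x \<in> letters A" "w \<in> words A"
  shows "\<exists>v\<in>words A. free_eq A w v \<and> length v = length w + 2 * j"
proof (induction j)
  case (Suc j)
  then obtain v where v: "v \<in> words A" "free_eq A w v" "length v = length w + 2 * j" by blast
  have "free_eq A (v @ [x, inv_letter x] @ []) (v @ [])"
    by (rule pres_eq_cancel) (use v assms in auto)
  then have "free_eq A w (v @ [x, inv_letter x])"
    using v(2) by (simp) (blast intro: pres_eq_trans pres_eq_sym)
  then show ?case using v assms by (intro bexI[of _ "v @ [x, inv_letter x]"]) auto
qed (use assms in \<open>intro bexI[of _ w], auto\<close>)

lemma even_length_invariant:
  assumes "pres_eq A R u v" "\<forall>r\<in>R. even (length r)"
  shows "even (length u) \<longleftrightarrow> even (length v)"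
  by (rule pres_eq_invariant[OF assms(1)]) (use assms(2) in \<open>auto elim!: pres_step.cases\<close>)

text \<open>
  Words of even length are padded to length \<open>2 * n\<close>.  If there are trivial words of odd length,
  then there is a relator of odd length, by which they are multiplied first.
\<close>

lemma isodiametric_fills:
  assumes R: "R \<subseteq> words A" and \<rho>: "\<And>r. r \<in> sym_relators R \<Longrightarrow> length r \<le> \<rho>"
    and d: "isodiametric_le A R d" and x: "x \<in> letters A"
    and w: "w \<in> words A" "pres_eq A R w []" "length w \<le> n" "\<rho> \<le> n"
  shows "fills A R (d (2 * n)) w"
proof -
  have even: "fills A R (d (2 * n)) u"
    if u: "u \<in> words A" "pres_eq A R u []" "even (length u)" "length u \<le> 2 * n" for u
  proof -
    have "length u + 2 * ((2 * n - length u) div 2) = 2 * n" using u by simp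
    then obtain v where v: "v \<in> words A" "free_eq A u v" "length v = 2 * n"
      using free_eq_padding[OF x u(1), of "(2 * n - length u) div 2"] by metis
    then have "pres_eq A R v []"
      using u(2) free_imp_pres_eq by (blast intro: pres_eq_trans pres_eq_sym)
    then have "fills A R (d (length v)) v"
      using d v(1) unfolding isodiametric_le_def fills_def by blast
    then show ?thesis using fills_free_eq v by metis
  qed
  show ?thesis
  proof (cases "even (length w)")
    case True
    then show ?thesis using even w by simp
  next
    case False
    then obtain r where r: "r \<in> R" "odd (length r)" using even_length_invariant[OF w(2)] by auto
    then have rS: "r \<in> sym_relators R" "inv_word r \<in> sym_relators R" and rA: "r \<in> words A"
      using R by (auto simp: sym_relators_def)
    have "pres_eq A R (w @ r) ([] @ [])"
      by (rule pres_eq_append[OF w(2) pres_eq_relator[OF R rS(1)]]) (use rA in auto)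
    \<comment> \<open>Two odd lengths add up to an even one, and \<open>\<rho> \<le> n\<close> keeps
      the sum within \<open>2 * n\<close>.\<close>
    then have "fills A R (d (2 * n)) (w @ r)"
      using w rA r False \<rho>[OF rS(1)] by (intro even) auto
    then obtain ps where ps: "\<forall>(r, x) \<in> set ps. r \<in> sym_relators R \<and> x \<in> words A \<and> length x \<le> d (2 * n)"
      and eq: "free_eq A (w @ r) (concat (map (\<lambda>(r, x). conj_word r x) ps))"
      unfolding fills_def by blast
    have "free_eq A (w @ (r @ inv_word r) @ []) (w @ [] @ [])"
      by (rule pres_eq_context[OF pres_eq_right_inverse]) (use w rA in auto)
    moreover have "free_eq A ([] @ (w @ r) @ inv_word r)
        ([] @ concat (map (\<lambda>(r, x). conj_word r x) ps) @ inv_word r)"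
      by (rule pres_eq_context[OF eq]) (use rA in auto)
    \<comment> \<open>The extra relator is undone by the factor \<open>inv_word r\<close>,
      conjugated by the empty word.\<close>
    ultimately have "free_eq A w (concat (map (\<lambda>(r, x). conj_word r x) (ps @ [(inv_word r, [])])))"
      by (simp add: conj_word_def) (blast intro: pres_eq_trans pres_eq_sym)
    then show ?thesis
      unfolding fills_def using ps rS(2)
      by (intro exI[of _ "ps @ [(inv_word r, [])]"]) auto
  qed
qed

section \<open>The word problem\<close>

text \<open>For \<open>N = b ^ L\<close> the polynomial bound of \<open>closure_machine\<close> is
  exponential in \<open>L\<close>. The summand \<open>\<rho> + 2\<close> is the room that a relator
  needs in the ball beyond its conjugator.\<close>

lemma coset_machine:
  assumes fp: "finite_presentation A R" and \<rho>: "\<And>r. r \<in> sym_relators R \<Longrightarrow> length r \<le> \<rho>"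
  shows "\<exists>M C. \<exists>b>1. turing_machine (letters A) M \<and>
    (\<forall>w\<in>words A. \<forall>t. accepts_within M w t \<longrightarrow> pres_eq A R w []) \<and>
    (\<forall>w\<in>words A. \<forall>k L. fills A R k w \<longrightarrow> length w + k + \<rho> + 2 \<le> L \<longrightarrow>
      (\<exists>t \<le> C * b ^ L. accepts_within M w t))"
proof -
  have R: "R \<subseteq> words A" and fin: "finite (letters A)" "finite (sym_relators R)"
    using fp finite_letters by (auto simp: finite_presentation_def sym_relators_def)
  obtain ls rels where ls: "set ls = letters A" and rels: "set rels = sym_relators R"
    using finite_list[OF fin(1)] finite_list[OF fin(2)] by blast
  obtain f :: "'a letter \<Rightarrow> nat" and n where f: "f ` letters A = {i. i < n}" "inj_on f (letters A)"
    using finite_imp_inj_to_nat_seg[OF fin(1)] by blast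
  define dig where "dig x = Suc (f x)" for x
  \<comment> \<open>The digits are 1 to \<open>n\<close>; adding 2 keeps \<open>b\<close> above 1
    even for an empty alphabet.\<close>
  define b where "b = n + 2"
  have "f x < n" if "x \<in> letters A" for x using f(1) that by blast
  then have dig: "digits A dig b"
    using f(2) by (fastforce simp: digits_def dig_def b_def inj_on_def)
  have b: "b \<ge> 1" by (simp add: b_def)
  obtain M C e where M: "turing_machine (letters A) M"
    and sound: "\<And>w t. w \<in> words A \<Longrightarrow> accepts_within M w t \<Longrightarrow>
      derivable (coset_rules dig b ls rels) (\<lambda>_. True) (num_code dig b w) 0"
    and complete: "\<And>w N. w \<in> words A \<Longrightarrow> num_code dig b w < N \<Longrightarrow> length w < N \<Longrightarrow>
      derivable (coset_rules dig b ls rels) (\<lambda>x. x < N) (num_code dig b w) 0 \<Longrightarrow>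
      \<exists>t \<le> C * N ^ e. accepts_within M w t"
    using closure_machine[OF fin(1) b, where dig = dig and rs = "coset_rules dig b ls rels"] by metis
  have "pres_eq A R w []" if w: "w \<in> words A" and acc: "accepts_within M w t" for w t
  proof -
    obtain u v where uv: "u \<in> words A" "v \<in> words A" "num_code dig b w = num_code dig b u"
      "num_code dig b [] = num_code dig b v" "pres_eq A R u v"
      using coset_rules_sound[OF R ls rels sound[OF w acc] dig] by auto
    have "w = u" using num_code_inject[OF dig w uv(1,3)] .
    moreover have "[] = v" using num_code_inject[OF dig _ uv(2,4)] by simp
    ultimately show ?thesis using uv(5) by simp
  qed
  \<comment> \<open>\<open>e + 1\<close> instead of \<open>e\<close> makes the base exceed 1 even if
    \<open>e = 0\<close>.\<close>
  moreover have "\<exists>t \<le> C * (b ^ (e + 1)) ^ L. accepts_within M w t"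
    if w: "w \<in> words A" and fills: "fills A R k w" and L: "length w + k + \<rho> + 2 \<le> L" for w k L
  proof -
    interpret ball A R dig b L ls rels
      by unfold_locales (use R ls rels dig b in auto)
    obtain ps where ps: "\<forall>(r, x) \<in> set ps. r \<in> sym_relators R \<and> x \<in> words A \<and> length x \<le> k"
      and eq: "free_eq A w (concat (map (\<lambda>(r, x). conj_word r x) ps))"
      using fills unfolding fills_def by blast
    have "linked w []"
      by (rule linked_complete[OF w _ _ eq]) (use ps \<rho> L in fastforce)+
    then have d: "derivable (coset_rules dig b ls rels) (\<lambda>x. x < b ^ L) (num_code dig b w) 0"
      by (simp add: linked_def)
    have "length w < 2 ^ L" using L less_exp[of L] by linarith
    also have "(2 :: nat) ^ L \<le> b ^ L" by (rule power_mono) (auto simp: b_def)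
    finally obtain t where t: "t \<le> C * (b ^ L) ^ e" "accepts_within M w t"
      using complete[OF w code_bound _ d] w L by auto
    have "(b ^ L) ^ e = b ^ (L * e)" by (simp add: power_mult)
    also have "\<dots> \<le> b ^ (L * (e + 1))" by (rule power_increasing) (use b in auto)
    also have "\<dots> = (b ^ (e + 1)) ^ L" by (simp only: power_mult[symmetric] mult.commute)
    finally have "C * (b ^ L) ^ e \<le> C * (b ^ (e + 1)) ^ L" by (rule mult_le_mono2)
    then show ?thesis using t by (meson order_trans)
  qed
  moreover have "b ^ (e + 1) > 1" by (rule one_less_power) (auto simp: b_def)
  ultimately show ?thesis using M by blast
qed

lemma infinite_group_DTime:
  assumes fp: "finite_presentation A R"
    and infinite: "\<And>D. \<exists>g\<in>words A. far A R D g"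
    and r: "r \<in> words A" "pres_eq A R r []" "\<not> free_eq A r []"
  shows "\<exists>c :: real. c > 1 \<and> (\<forall>d. isodiametric_le A R d \<longrightarrow>
    word_problem A R \<in> DTime (letters A) (\<lambda>n. max (real n + 1) (c ^ d n)))"
proof -
  have R: "R \<subseteq> words A" and "finite (sym_relators R)"
    using fp by (auto simp: finite_presentation_def sym_relators_def)
  define \<rho> where "\<rho> = (\<Sum>r\<in>sym_relators R. length r)"
  have \<rho>: "length r \<le> \<rho>" if "r \<in> sym_relators R" for r
    unfolding \<rho>_def using member_le_sum[OF that, of length] \<open>finite (sym_relators R)\<close> by simp
  obtain x s where x: "x \<in> letters A" and s: "s \<in> words A" "pres_eq A R (x # s) []"
    and cross: "\<And>g. g \<in> words A \<Longrightarrow> crossings A R g x g (x # s) = 1"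
    using simple_loop_exists[OF R r] by metis
  obtain M C b where b: "(1::nat) < b" and M: "turing_machine (letters A) M"
    and sound: "\<And>w t. w \<in> words A \<Longrightarrow> accepts_within M w t \<Longrightarrow> pres_eq A R w []"
    and complete: "\<And>w k L. w \<in> words A \<Longrightarrow> fills A R k w \<Longrightarrow> length w + k + \<rho> + 2 \<le> L \<Longrightarrow>
      \<exists>t \<le> C * b ^ L. accepts_within M w t"
    using coset_machine[OF fp \<rho>] by metis
  \<comment> \<open>The radius is \<open>length w + k + \<rho> + 2\<close>, and
    \<open>length w\<close> is below \<open>2 * (k + \<rho> + 2) + length (x # s)\<close>. The sum
    is at most \<open>3 * k + K\<close>, whence the cube.\<close>
  define c where "c = real b ^ 3"
  define K where "K = 3 * \<rho> + 6 + length (x # s)"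
  have c: "c > 1" unfolding c_def using b by (intro one_less_power) auto
  have "word_problem A R \<in> DTime (letters A) (\<lambda>n. max (real n + 1) (c ^ d n))"
    if d: "isodiametric_le A R d" for d
    unfolding DTime_def mem_Collect_eq
  proof (intro exI[of _ M] conjI)
    have "\<exists>t. accepts_within M w t" if "w \<in> word_problem A R" for w
    proof -
      have "fills A R (d (length w)) w"
        using d that unfolding isodiametric_le_def fills_def word_problem_def by blast
      then show ?thesis using complete that by (fastforce simp: word_problem_def)
    qed
    then show "word_problem A R = machine_language (letters A) M"
      using sound by (auto simp: machine_language_def word_problem_def)
    have "\<exists>t. real t \<le> (real C * real b ^ K + 1) * max (real (2 * n) + 1) (c ^ d (2 * n)) \<and> accepts_within M w t"
      if n: "n \<ge> \<rho> + 1" and w: "w \<in> word_problem A R" "length w \<le> n" for n w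
    proof -
      define k where "k = d (2 * n)"
      have fills: "fills A R k w" if "w \<in> words A" "pres_eq A R w []" "length w \<le> n" for w
        unfolding k_def by (rule isodiametric_fills[OF R \<rho> d x]) (use that n in auto)
      obtain g where g: "g \<in> words A" "far A R (k + \<rho> + 1) g" "length g = k + \<rho> + 1 + 1"
        using infinite far_shortest[OF R] by meson
      have "n < 2 * (k + \<rho> + 2) + length (x # s)"
        by (rule isodiametric_lower_bound[OF R \<rho> g(1,2) _ x s cross[OF g(1)] fills]) (use g in auto)
      then have "length w + k + \<rho> + 2 \<le> 3 * k + K" using w by (simp add: K_def)
      moreover have "w \<in> words A" "pres_eq A R w []" using w by (auto simp: word_problem_def)
      ultimately obtain t where t: "t \<le> C * b ^ (3 * k + K)" "accepts_within M w t"
        using complete fills w(2) by blast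
      have "real t \<le> real (C * b ^ (3 * k + K))" using t(1) by (simp only: of_nat_le_iff)
      also have "\<dots> = real C * real b ^ K * c ^ k"
        by (simp add: c_def power_add power_mult)
      also have "\<dots> \<le> (real C * real b ^ K + 1) * c ^ k" using c by (intro mult_right_mono) auto
      also have "\<dots> \<le> (real C * real b ^ K + 1) * max (real (2 * n) + 1) (c ^ k)"
        by (intro mult_left_mono) auto
      finally show ?thesis using t(2) by (auto simp: k_def)
    qed
    then show "\<exists>c1 c2 c3. 0 < c1 \<and> 0 < c2 \<and> 0 < c3 \<and> (\<forall>n\<ge>c3. \<forall>w\<in>word_problem A R. length w \<le> n \<longrightarrow>
        (\<exists>t. real t \<le> c1 * max (real (c2 * n) + 1) (c ^ d (c2 * n)) \<and> accepts_within M w t))"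
      \<comment> \<open>The 2 comes from padding to length \<open>2 * n\<close>, and
        \<open>\<rho> + 1\<close> from the correction of odd lengths, which needs
        \<open>\<rho> \<le> n\<close>. The added 1 makes the factor positive even if
        \<open>C = 0\<close>.\<close>
      by (intro exI[of _ "real C * real b ^ K + 1"] exI[of _ "2::nat"] exI[of _ "\<rho> + 1"])
        (auto intro: add_nonneg_pos)
  qed (rule M)
  then show ?thesis using c by blast
qed

theorem proposition5p1:
  fixes A :: "'a set" and R :: "'a word set"
  assumes "finite_presentation A R"
  shows "\<exists>c :: real. c > 1 \<and>
    (\<forall>d :: nat \<Rightarrow> nat. isodiametric_le A R d \<longrightarrow>
      word_problem A R \<in> DTime (letters A) (\<lambda>n. max (real n + 1) (c ^ d n)))"
proof (cases "\<exists>D. \<forall>g\<in>words A. \<not> far A R D g")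
  case True
  then obtain D where "\<forall>g\<in>words A. \<not> far A R D g" by blast
  then have "word_problem A R \<in> DTime (letters A) (\<lambda>n. max (real n + 1) (2 ^ d n))" for d :: "nat \<Rightarrow> nat"
    by (intro finite_group_DTime[OF assms, of D]) (auto simp: far_def)
  \<comment> \<open>Linear time suffices here, so any constant above 1 will do.\<close>
  then show ?thesis by (intro exI[of _ 2]) simp
next
  case infinite: False
  show ?thesis
  proof (cases "\<forall>w\<in>words A. pres_eq A R w [] \<longrightarrow> free_eq A w []")
    case True
    then have "word_problem A R \<in> DTime (letters A) (\<lambda>n. max (real n + 1) (2 ^ d n))" for d :: "nat \<Rightarrow> nat"
      by (intro free_group_DTime[OF assms]) auto
    then show ?thesis by (intro exI[of _ 2]) simp
  next
    case False
    then show ?thesis using infinite infinite_group_DTime[OF assms] by blast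
  qed
qed

end
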